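(* Let $(\mu_n)_{n\in\mathbb N\cup\{\infty\}}\subset\mathscr K(X)$ be such that $\mu_n\to\mu_\infty$ vaguely and $G^{\mu_n}1\to G^{\mu_\infty}1$ uniformly on $X$. Then for all $u\in C_0(X)$: (1) $\lim_{n\to\infty}\|G^{\mu_n}u-G^{\mu_\infty}u\|_\infty=0$. (2) $\lim_{n\to\infty}\|\check R^n_\alpha u-\check R^\infty_\alpha u\|_\infty=0$ for all $\alpha\ge0$.
   Context: $X$ is a locally compact separable metric space, $m$ a positive Radon measure on the Borel sets of $X$ with full support, $X_\partial=X\cup\{\partial\}$ the one-point compactification; every function $u$ on $X$ is extended by $u(\partial)=0$. $\mathscr B_b(X)$ denotes the bounded Borel functions on $X$ with the sup norm $\|\cdot\|_\infty$, and $C_0(X)$ the continuous functions vanishing at infinity. $\mathbb X=(\Omega,\mathscr M,\mathscr M_t,(\mathbb P_x)_{x\in X_\partial},(\mathbb X_t)_{0\le t\le\infty},(\theta_t),\zeta)$ is a standard process in the sense of Blumenthal–Getoor (not necessarily symmetric) with state space $X$ and cemetery $\partial$ (with $\mathbb X_\infty=\partial$). It is transient and has a dual standard process $\hat{\mathbb X}$ (duality with respect to $m$) with the same properties. Its transition semigroup ${\bf P}_tu(x)=\mathbb E_x[u(\mathbb X_t)]$ has a jointly measurable density $p_t(x,y)$ with respect to $m$, with $p_t(x,y)>0$ for all $t>0$, $x,y\in X$. For $\alpha\ge0$, $G_\alpha(x,y)=\int_0^\infty e^{-\alpha t}p_t(x,y)\,dt$, $G:=G_0\not\equiv\infty$,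 and $G:X\times X\to(0,\infty]$ is lower semicontinuous. For a positive Radon measure $\mu$ on $X$, $G^\mu u(x)=\int_XG(x,y)u(y)\,d\mu(y)$; $\mu$ is $G$-Kato if $G^\mu1\in C_0(X)$, and $\mathscr K(X)$ is the set of $G$-Kato measures. Each $\mu\in\mathscr K(X)$ has a unique (up to equivalence) positive continuous additive functional (PCAF) ${\bf A}$ of $\mathbb X$ with Revuz measure $\mu$; it satisfies $\mathbb E_x[\int_0^\infty e^{-\alpha t}u(\mathbb X_t)\,d{\bf A}_t]=\int_XG_\alpha(x,y)u(y)\,d\mu(y)$ for $u\in\mathscr B_b(X)$, $\alpha\ge0$, $x\in X$. For $n\in\mathbb N\cup\{\infty\}$ let ${\bf A}^n$ be the PCAF of $\mu_n$, $\tau^n_t=\inf\{s\ge0:{\bf A}^n_s>t\}$, and, for $u\in\mathscr B_b(X)$, $\alpha\ge 0$, $x\in X$, $\check R^n_\alpha u(x)=\mathbb E_x[\int_0^\infty e^{-\alpha t}u(\mathbb X_{\tau^n_t})\,dt]$, the resolvent of the time-changed process $\check{\mathbb X}^n=(\mathbb X_{\tau^n_t})_{t\ge0}$. Vague convergence $\mu_n\to\mu_\infty$ means $\int\varphi\,d\mu_n\to\int\varphi\,d\mu_\infty$ for all continuous $\varphi$ with compact support. *)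

theory Defs
  imports "HOL-Probability.Probability"
begin

section \<open>Function spaces, measures and modes of convergence\<close>

definition C0 :: "('a::topological_space \<Rightarrow> real) set" where
  "C0 = {u. continuous_on UNIV u \<and> (\<forall>\<epsilon>>0. \<exists>K. compact K \<and> (\<forall>x. x \<notin> K \<longrightarrow> \<bar>u x\<bar> < \<epsilon>))}"

text \<open>Valued in \<open>[0,\<infinity>]\<close>, so that no boundedness side condition is needed.\<close>

definition supnorm :: "('a \<Rightarrow> real) \<Rightarrow> ennreal" where
  "supnorm f = (SUP x. ennreal \<bar>f x\<bar>)"

definition radon_measure :: "'a::topological_space measure \<Rightarrow> bool" where
  "radon_measure \<mu> \<longleftrightarrow> sets \<mu> = sets borel
     \<and> (\<forall>K. compact K \<longrightarrow> emeasure \<mu> K < \<infinity>)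
     \<and> (\<forall>B\<in>sets borel. emeasure \<mu> B = (SUP K\<in>{K. K \<subseteq> B \<and> compact K}. emeasure \<mu> K))"

definition full_support :: "'a::topological_space measure \<Rightarrow> bool" where
  "full_support \<mu> \<longleftrightarrow> (\<forall>U. open U \<and> U \<noteq> {} \<longrightarrow> 0 < emeasure \<mu> U)"

definition vague_convergence ::
    "(nat \<Rightarrow> 'a::topological_space measure) \<Rightarrow> 'a measure \<Rightarrow> bool" where
  "vague_convergence \<mu> \<nu> \<longleftrightarrow>
     (\<forall>\<phi>::'a \<Rightarrow> real. continuous_on UNIV \<phi> \<and> compact (closure {x. \<phi> x \<noteq> 0})
        \<longrightarrow> (\<lambda>n. LINT x|\<mu> n. \<phi> x) \<longlonglongrightarrow> (LINT x|\<nu>. \<phi> x))"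

section \<open>State space with cemetery\<close>

text \<open>The point \<open>\<partial>\<close> is \<^const>\<open>None\<close>. If the state space is compact, \<^const>\<open>None\<close> is isolated.\<close>

abbreviation Xcem :: "'a::topological_space option topology" where
  "Xcem \<equiv> Alexandroff_compactification euclidean"

definition borel_cem :: "'a::topological_space option measure" where
  "borel_cem = sigma UNIV {U. openin Xcem U}"

definition ext0 :: "('a \<Rightarrow> 'b::zero) \<Rightarrow> 'a option \<Rightarrow> 'b" where
  "ext0 u z = (case z of None \<Rightarrow> 0 | Some x \<Rightarrow> u x)"

section \<open>Standard processes in the sense of Blumenthal and Getoor\<close>

text \<open>
  The sextuple \<open>(\<Omega>, \<M>, \<M>\<^sub>t, X\<^sub>t, \<theta>\<^sub>t, P\<^sub>x)\<close>, where \<open>(\<Omega>, \<M>)\<close> is the measurable space \<open>events\<close>.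
  The time set \<open>[0,\<infinity>]\<close> is the type \<^typ>\<open>ennreal\<close>.
\<close>

record ('w, 'a) process =
  events :: "'w measure"
  hist :: "ennreal \<Rightarrow> 'w measure"
  traj :: "ennreal \<Rightarrow> 'w \<Rightarrow> 'a option"
  shift :: "ennreal \<Rightarrow> 'w \<Rightarrow> 'w"
  law :: "'a option \<Rightarrow> 'w measure"

abbreviation Omega :: "('w, 'a) process \<Rightarrow> 'w set" where
  "Omega Z \<equiv> space (events Z)"

definition lifetime :: "('w, 'a) process \<Rightarrow> 'w \<Rightarrow> ennreal" where
  "lifetime Z \<omega> = Inf {t. traj Z t \<omega> = None}"

text \<open>
  The completion of a \<open>\<sigma>\<close>-algebra \<open>\<B>\<close> in a larger one \<open>\<N>\<close> with respect to all \<open>P\<^sub>\<nu> = \<integral> P\<^sub>x d\<nu>(x)\<close>,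
  \<open>\<nu>\<close> a finite measure on \<open>X\<^sub>\<partial>\<close>. Being \<open>P\<^sub>\<nu>\<close>-null means being \<open>P\<^sub>x\<close>-null for \<open>\<nu>\<close>-almost
  every \<open>x\<close>.
\<close>

definition completed_in ::
    "('w, 'a::topological_space) process \<Rightarrow> 'w set set \<Rightarrow> 'w set set \<Rightarrow> 'w set set" where
  "completed_in Z \<N> \<B> = {A. A \<subseteq> Omega Z \<and>
     (\<forall>\<nu>. sets \<nu> = sets borel_cem \<and> finite_measure \<nu> \<longrightarrow>
        (\<exists>B\<in>\<B>. \<exists>N\<in>\<N>. (A - B) \<union> (B - A) \<subseteq> N \<and> (AE x in \<nu>. emeasure (law Z x) N = 0)))}"

definition natural_sets ::
    "('w, 'a::topological_space) process \<Rightarrow> ennreal \<Rightarrow> 'w set set" where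
  "natural_sets Z t =
     sigma_sets (Omega Z) {traj Z s -` B \<inter> Omega Z | s B. s \<le> t \<and> B \<in> sets borel_cem}"

text \<open>The completed natural filtration \<open>(\<F>\<^sub>t)\<close>.\<close>

definition natural_filtration ::
    "('w, 'a::topological_space) process \<Rightarrow> ennreal \<Rightarrow> 'w measure" where
  "natural_filtration Z t =
     sigma (Omega Z) (completed_in Z (natural_sets Z \<infinity>) (natural_sets Z t))"

locale markov_process =
  fixes Z :: "('w, 'a::topological_space) process"
  assumes filtration: "filtration (Omega Z) (hist Z)"
    and hist_sub: "sets (hist Z t) \<subseteq> sets (events Z)"
    and law_prob: "prob_space (law Z x)"
    and law_sets: "sets (law Z x) = sets (events Z)"
    and adapted: "traj Z t \<in> hist Z t \<rightarrow>\<^sub>M borel_cem"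
    and absorbed: "\<lbrakk>\<omega> \<in> Omega Z; traj Z s \<omega> = None; s \<le> t\<rbrakk> \<Longrightarrow> traj Z t \<omega> = None"
    and at_infinity: "\<omega> \<in> Omega Z \<Longrightarrow> traj Z \<infinity> \<omega> = None"
    and dead_path:
      "\<exists>\<omega>0\<in>Omega Z. traj Z 0 \<omega>0 = None \<and> (\<forall>\<omega>\<in>Omega Z. shift Z \<infinity> \<omega> = \<omega>0)"
    and shift_closed: "\<omega> \<in> Omega Z \<Longrightarrow> shift Z t \<omega> \<in> Omega Z"
    and homogeneous: "\<omega> \<in> Omega Z \<Longrightarrow> traj Z t (shift Z h \<omega>) = traj Z (t + h) \<omega>"
    and law_measurable: "\<lbrakk>t < \<infinity>; B \<in> sets borel_cem\<rbrakk> \<Longrightarrow>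
      (\<lambda>x. measure (law Z (Some x)) (traj Z t -` B \<inter> Omega Z)) \<in> borel_measurable borel"
    and normal: "AE \<omega> in law Z x. traj Z 0 \<omega> = x"
    and markov: "\<lbrakk>s < \<infinity>; t < \<infinity>; B \<in> sets borel_cem\<rbrakk> \<Longrightarrow>
      AE \<omega> in law Z x.
        real_cond_exp (law Z x) (hist Z t) (indicator (traj Z (t + s) -` B \<inter> Omega Z)) \<omega>
          = measure (law Z (traj Z t \<omega>)) (traj Z s -` B \<inter> Omega Z)"

locale standard_process = markov_process +
  assumes right_continuous_filtration:
      "t < \<infinity> \<Longrightarrow> sets (hist Z t) = (\<Inter>s\<in>{t<..}. sets (hist Z s))"
    and complete_filtration:
      "t < \<infinity> \<Longrightarrow> sets (hist Z t) = completed_in Z (sets (events Z)) (sets (hist Z t))"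
    and right_continuous_paths:
      "AE \<omega> in law Z x. \<forall>t<\<infinity>. limitin Xcem (\<lambda>s. traj Z s \<omega>) (traj Z t \<omega>) (at_right t)"
    and left_limits:
      "AE \<omega> in law Z x. \<forall>t. 0 < t \<and> t < lifetime Z \<omega> \<longrightarrow>
         (\<exists>l. limitin Xcem (\<lambda>s. traj Z s \<omega>) l (at_left t))"
    and stopped_measurable: "stopping_time (hist Z) T \<Longrightarrow>
      (\<lambda>\<omega>. traj Z (T \<omega>) \<omega>) \<in> filtration.pre_sigma (Omega Z) (hist Z) T \<rightarrow>\<^sub>M borel_cem"
    and strong_markov: "\<lbrakk>stopping_time (hist Z) T; t < \<infinity>; B \<in> sets borel_cem\<rbrakk> \<Longrightarrow>
      AE \<omega> in law Z x.
        real_cond_exp (law Z x) (filtration.pre_sigma (Omega Z) (hist Z) T)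
            (indicator {\<omega> \<in> Omega Z. traj Z (t + T \<omega>) \<omega> \<in> B}) \<omega>
          = measure (law Z (traj Z (T \<omega>) \<omega>)) (traj Z t -` B \<inter> Omega Z)"
    and quasi_left_continuous:
      "\<lbrakk>\<And>n::nat. stopping_time (hist Z) (S n); incseq S\<rbrakk> \<Longrightarrow>
       AE \<omega> in law Z x. (SUP n. S n \<omega>) < lifetime Z \<omega> \<longrightarrow>
         limitin Xcem (\<lambda>n. traj Z (S n \<omega>) \<omega>) (traj Z (SUP n. S n \<omega>) \<omega>) sequentially"

section \<open>Semigroup, duality, transition density and Green function\<close>

definition semigroup :: "('w, 'a) process \<Rightarrow> real \<Rightarrow> ('a \<Rightarrow> ennreal) \<Rightarrow> 'a \<Rightarrow> ennreal" where
  "semigroup Z t u x = (\<integral>\<^sup>+\<omega>. ext0 u (traj Z (ennreal t) \<omega>) \<partial>law Z (Some x))"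

definition transient :: "('w, 'a::topological_space) process \<Rightarrow> bool" where
  "transient Z \<longleftrightarrow> (\<exists>h\<in>borel_measurable borel. \<forall>x.
     0 < h x \<and> (\<integral>\<^sup>+t\<in>{0..}. semigroup Z t h x \<partial>lborel) < \<infinity>)"

definition in_duality ::
    "'a::topological_space measure \<Rightarrow> ('w, 'a) process \<Rightarrow> ('v, 'a) process \<Rightarrow> bool" where
  "in_duality m Z Z' \<longleftrightarrow> (\<forall>t\<ge>0. \<forall>f\<in>borel_measurable borel. \<forall>g\<in>borel_measurable borel.
     (\<integral>\<^sup>+x. f x * semigroup Z t g x \<partial>m) = (\<integral>\<^sup>+x. semigroup Z' t f x * g x \<partial>m))"

definition transition_density ::
    "'a::topological_space measure \<Rightarrow> ('w, 'a) process \<Rightarrow> (real \<Rightarrow> 'a \<Rightarrow> 'a \<Rightarrow> real) \<Rightarrow> bool" where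
  "transition_density m Z p \<longleftrightarrow>
     (\<lambda>(t, x, y). p t x y)
       \<in> borel_measurable (restrict_space borel {0<..} \<Otimes>\<^sub>M borel \<Otimes>\<^sub>M borel)
     \<and> (\<forall>t>0. \<forall>x y. 0 \<le> p t x y)
     \<and> (\<forall>t>0. \<forall>u\<in>borel_measurable borel. \<forall>x.
          semigroup Z t u x = (\<integral>\<^sup>+y. ennreal (p t x y) * u y \<partial>m))"

definition green :: "(real \<Rightarrow> 'a \<Rightarrow> 'a \<Rightarrow> real) \<Rightarrow> real \<Rightarrow> 'a \<Rightarrow> 'a \<Rightarrow> ennreal" where
  "green p \<alpha> x y = (\<integral>\<^sup>+t\<in>{0<..}. ennreal (exp (- \<alpha> * t) * p t x y) \<partial>lborel)"

definition lower_semicontinuous :: "('a::topological_space \<Rightarrow> ennreal) \<Rightarrow> bool" where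
  "lower_semicontinuous f \<longleftrightarrow> (\<forall>c. open {x. c < f x})"

text \<open>
  \<open>G\<^sup>\<mu> u\<close> for bounded Borel \<open>u\<close> and \<open>G\<^sup>\<mu> 1 < \<infinity>\<close>. Then \<open>{y. G(x,y) = \<infinity>}\<close> is
  \<open>\<mu>\<close>-null, so that \<^const>\<open>enn2real\<close> is harmless.
\<close>

definition green_potential ::
    "(real \<Rightarrow> 'a \<Rightarrow> 'a \<Rightarrow> real) \<Rightarrow> 'a measure \<Rightarrow> ('a \<Rightarrow> real) \<Rightarrow> 'a \<Rightarrow> real" where
  "green_potential p \<mu> u x = (LINT y|\<mu>. enn2real (green p 0 x y) * u y)"

definition green_kato ::
    "(real \<Rightarrow> 'a \<Rightarrow> 'a \<Rightarrow> real) \<Rightarrow> 'a::topological_space measure \<Rightarrow> bool" where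
  "green_kato p \<mu> \<longleftrightarrow> radon_measure \<mu>
     \<and> (\<forall>x. (\<integral>\<^sup>+y. green p 0 x y \<partial>\<mu>) < \<infinity>)
     \<and> (\<lambda>x. enn2real (\<integral>\<^sup>+y. green p 0 x y \<partial>\<mu>)) \<in> C0"

section \<open>Positive continuous additive functionals and time change\<close>

text \<open>The set \<open>\<Lambda>\<close> is a defining set. Only finite times matter in \<open>A\<close>.\<close>

definition pcaf ::
    "('w, 'a::topological_space) process \<Rightarrow> (ennreal \<Rightarrow> 'w \<Rightarrow> ennreal) \<Rightarrow> bool" where
  "pcaf Z A \<longleftrightarrow>
     (\<forall>t<\<infinity>. A t \<in> borel_measurable (natural_filtration Z t)) \<and>
     (\<exists>\<Lambda>\<in>sets (natural_filtration Z \<infinity>).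
        (\<forall>x. AE \<omega> in law Z (Some x). \<omega> \<in> \<Lambda>) \<and>
        (\<forall>t<\<infinity>. shift Z t ` \<Lambda> \<subseteq> \<Lambda>) \<and>
        (\<forall>\<omega>\<in>\<Lambda>. A 0 \<omega> = 0
           \<and> continuous_on {t. t < \<infinity>} (\<lambda>t. A t \<omega>)
           \<and> (\<forall>t<lifetime Z \<omega>. A t \<omega> < \<infinity>)
           \<and> (\<forall>t<\<infinity>. lifetime Z \<omega> \<le> t \<longrightarrow> A t \<omega> = A (lifetime Z \<omega>) \<omega>)
           \<and> (\<forall>s<\<infinity>. \<forall>t<\<infinity>. A (t + s) \<omega> = A t \<omega> + A s (shift Z t \<omega>))))"

text \<open>
  \<open>\<integral>\<^sub>0\<^sup>\<infinity> \<phi>(t) dA\<^sub>t\<close> for a continuous nondecreasing path \<open>a : [0,\<infinity>) \<rightarrow> [0,\<infinity>]\<close>, \<open>a(0) = 0\<close>. The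
  Stieltjes measures of \<open>a \<and> n\<close> increase to that of \<open>a\<close> on \<open>{a < \<infinity>}\<close>, so the supremum also
  covers paths that become infinite at the lifetime. For negative \<open>t\<close>, \<^term>\<open>ennreal t = 0\<close>.
\<close>

definition stieltjes :: "(ennreal \<Rightarrow> ennreal) \<Rightarrow> (real \<Rightarrow> ennreal) \<Rightarrow> ennreal" where
  "stieltjes a \<phi> =
     (SUP n::nat. \<integral>\<^sup>+t. \<phi> t \<partial>interval_measure (\<lambda>t. enn2real (min (of_nat n) (a (ennreal t)))))"

text \<open>
  The Revuz correspondence \<open>\<integral> f d\<mu> = lim\<^sub>t\<^sub>\<rightarrow>\<^sub>0 t\<^sup>-\<^sup>1 E\<^sub>m[\<integral>\<^sub>0\<^sup>t f(X\<^sub>s) dA\<^sub>s]\<close>. The inner expectation is a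
  universally measurable function of \<open>x\<close>; \<open>\<integral>\<^sup>+\<close> with respect to \<open>m\<close> and to its completion agree
  on all functions.
\<close>

definition revuz_measure ::
    "'a::topological_space measure \<Rightarrow> ('w, 'a) process \<Rightarrow> (ennreal \<Rightarrow> 'w \<Rightarrow> ennreal) \<Rightarrow>
     'a measure \<Rightarrow> bool" where
  "revuz_measure m Z A \<mu> \<longleftrightarrow> (\<forall>f\<in>borel_measurable borel.
     ((\<lambda>t. (\<integral>\<^sup>+x. \<integral>\<^sup>+\<omega>. stieltjes (\<lambda>s. A s \<omega>)
               (\<lambda>s. indicator {0..t} s * ext0 f (traj Z (ennreal s) \<omega>)) \<partial>law Z (Some x) \<partial>m)
           / ennreal t)
        \<longlongrightarrow> (\<integral>\<^sup>+y. f y \<partial>\<mu>)) (at_right 0))"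

text \<open>
  \<open>E\<^sub>x[\<integral>\<^sub>0\<^sup>\<infinity> e\<^sup>-\<^sup>\<alpha>\<^sup>t u(X\<^sub>t) dA\<^sub>t] = \<integral> G\<^sub>\<alpha>(x,y) u(y) d\<mu>(y)\<close>. Nonnegative Borel \<open>u\<close> suffice: when both
  sides are finite for \<open>u = 1\<close>, this is the identity for all bounded Borel \<open>u\<close>.
\<close>

definition potential_formula ::
    "(real \<Rightarrow> 'a \<Rightarrow> 'a \<Rightarrow> real) \<Rightarrow> ('w, 'a::topological_space) process \<Rightarrow>
     (ennreal \<Rightarrow> 'w \<Rightarrow> ennreal) \<Rightarrow> 'a measure \<Rightarrow> bool" where
  "potential_formula p Z A \<mu> \<longleftrightarrow> (\<forall>u\<in>borel_measurable borel. \<forall>\<alpha>\<ge>0. \<forall>x.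
     (\<integral>\<^sup>+\<omega>. stieltjes (\<lambda>t. A t \<omega>)
         (\<lambda>t. ennreal (exp (- \<alpha> * t)) * ext0 u (traj Z (ennreal t) \<omega>)) \<partial>law Z (Some x))
     = (\<integral>\<^sup>+y. green p \<alpha> x y * u y \<partial>\<mu>))"

definition inverse_time :: "(ennreal \<Rightarrow> 'w \<Rightarrow> ennreal) \<Rightarrow> real \<Rightarrow> 'w \<Rightarrow> ennreal" where
  "inverse_time A t \<omega> = Inf {s. s < \<infinity> \<and> ennreal t < A s \<omega>}"

text \<open>
  \<open>P\<^sub>x\<close> is extended to its completion, because path regularity of \<open>X\<close> and \<open>A\<close> is only almost sure
  while the Bochner integral of a non-measurable function is \<open>0\<close> by convention.
\<close>

definition time_changed_resolvent ::
    "('w, 'a) process \<Rightarrow> (ennreal \<Rightarrow> 'w \<Rightarrow> ennreal) \<Rightarrow> real \<Rightarrow> ('a \<Rightarrow> real) \<Rightarrow> 'a \<Rightarrow> real" where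
  "time_changed_resolvent Z A \<alpha> u x =
     (LINT \<omega>|completion (law Z (Some x)).
        (LINT t:{0..}|lborel. exp (- \<alpha> * t) * ext0 u (traj Z (inverse_time A t \<omega>) \<omega>)))"

end

(*
  (1) Lower semicontinuity of G and vague convergence give
  liminf G^{mu_n} w (x_n) >= G^{mu} w (x) for x_n -> x and bounded continuous w >= 0. Applied to w and
  to c - w, together with G^{mu_n} 1 -> G^{mu} 1, this yields convergence along every convergent
  sequence, hence locally uniformly; near infinity both potentials are bounded by c times potentials
  of 1, which are uniformly small.

  (2) The additivity of A and the Markov property show R_alpha (w + alpha G^mu w) = G^mu w for every
  bounded continuous w. As alpha R_alpha is a contraction, |w| <= 2 |w + alpha G^mu w|, so by the
  method of continuity u = w + alpha G^{mu_infinity} w can be solved for w. Then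
    R^n_alpha u - R^infinity_alpha u
      = (G^{mu_n} w - G^{mu_infinity} w) + alpha R^n_alpha (G^{mu_infinity} w - G^{mu_n} w),
  which is at most 2 |G^{mu_n} w - G^{mu_infinity} w| and tends to 0 by (1).
*)
theory Submission
  imports Defs
begin

section \<open>The state space with cemetery\<close>

text \<open>The delicate point is the resolvent identity. The time-changed process is observed at
  random times, which suggests the strong Markov property. Instead, the substitution t = A_s turns
  its resolvent into an integral against dA, and Riemann sums reduce the identity to the Markov
  property at deterministic times. The price: that property is needed for functionals of the whole
  future path that are measurable only for the completed natural filtration, as A is. It is given
  for single later times and has to be extended to finitely many times, to the generated
  sigma-algebra and to its completion. A Neumann series need not solve u = w + alpha G^mu w, because
  alpha times the supremum of G^mu 1 may be large. The a priori bound has the constant 2 for every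
  value of the parameter, so solvability can be continued from 0 to alpha in steps of equal length.
  The solution w is only known to be bounded and continuous; this is why the convergence of
  potentials is proved for all such functions and not just on C_0(X). The bounds by 1/alpha say
  nothing at alpha = 0, where the resolvent is G^mu itself.\<close>

lemma space_borel_cem [simp]: "space borel_cem = UNIV"
  by (simp add: borel_cem_def)

lemma openin_sets_borel_cem: "openin Xcem U \<Longrightarrow> U \<in> sets borel_cem"
  by (auto simp: borel_cem_def)

text \<open>An open set of X stays open in the one-point compactification, so induction over the
  generated sigma-algebra works once complements are taken inside \<open>range Some\<close>.\<close>

lemma Some_image_sets_borel_cem:
  assumes "B \<in> sets (borel :: 'a::topological_space measure)"
  shows "Some ` B \<in> sets borel_cem"
proof -
  have "B \<in> sigma_sets UNIV {S::'a set. open S}"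
    using assms by (simp add: borel_def)
  then show ?thesis
  proof induction
    case (Basic a)
    then show ?case by (auto intro: openin_sets_borel_cem)
  next
    case (Compl a)
    have "Some ` (UNIV - a) = range Some - Some ` a" by auto
    moreover have "range (Some :: 'a \<Rightarrow> _) \<in> sets borel_cem"
      by (auto intro: openin_sets_borel_cem)
    ultimately show ?case using Compl by auto
  next
    case (Union a)
    then show ?case by (simp add: image_UN)
  qed auto
qed

text \<open>The axiom \<open>law_measurable\<close> speaks only of live starting points. Since the
  cemetery is a measurable atom, measurability has to be checked on X alone.\<close>

lemma measurable_borel_cem:
  fixes f :: "'a::topological_space option \<Rightarrow> 'b"
  assumes "(\<lambda>x. f (Some x)) \<in> borel \<rightarrow>\<^sub>M N" and "f None \<in> space N"
  shows "f \<in> borel_cem \<rightarrow>\<^sub>M N"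
proof (rule measurableI)
  show "f z \<in> space N" for z
    using assms measurable_space[OF assms(1)] by (cases z) auto
  fix B assume B: "B \<in> sets N"
  have r: "range (Some :: 'a \<Rightarrow> _) \<in> sets borel_cem"
    by (auto intro: openin_sets_borel_cem)
  have "UNIV - range (Some :: 'a \<Rightarrow> _) = {None}"
    by (auto simp: not_None_eq[symmetric] notin_range_Some)
  then have n: "{None :: 'a option} \<in> sets borel_cem"
    using sets.compl_sets[OF r] by simp
  have "(\<lambda>x. f (Some x)) -` B \<in> sets borel"
    using measurable_sets[OF assms(1) B] by simp
  then have "Some ` ((\<lambda>x. f (Some x)) -` B) \<in> sets borel_cem"
    by (rule Some_image_sets_borel_cem)
  moreover have "f -` B = Some ` ((\<lambda>x. f (Some x)) -` B) \<union> (if f None \<in> B then {None} else {})"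
  proof (intro set_eqI)
    show "z \<in> f -` B \<longleftrightarrow> z \<in> Some ` ((\<lambda>x. f (Some x)) -` B) \<union> (if f None \<in> B then {None} else {})" for z
      by (cases z) auto
  qed
  ultimately show "f -` B \<inter> space borel_cem \<in> sets borel_cem"
    using n by (simp add: sets.Un)
qed

lemma ext0_simps [simp]: "ext0 u None = 0" "ext0 u (Some x) = u x"
  by (simp_all add: ext0_def)

lemma measurable_ext0:
  "u \<in> borel_measurable borel \<Longrightarrow> ext0 u \<in> borel_measurable borel_cem"
  by (rule measurable_borel_cem) simp_all

text \<open>Testing against the sets of \<open>F\<close> makes the \<open>F\<close>-measurable
  \<open>g\<close> a version of the conditional expectation of \<open>f\<close>; the defining
  property of the latter then admits the weight \<open>\<Phi>\<close>.\<close>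

lemma nn_integral_mult_subalgebra_cong:
  assumes "prob_space M" and "subalgebra M F"
    and f: "f \<in> borel_measurable M" and g: "g \<in> borel_measurable F"
    and \<Phi>: "\<Phi> \<in> borel_measurable F"
    and eq: "\<And>H. H \<in> sets F \<Longrightarrow>
      (\<integral>\<^sup>+x. indicator H x * f x \<partial>M) = (\<integral>\<^sup>+x. indicator H x * g x \<partial>M)"
  shows "(\<integral>\<^sup>+x. \<Phi> x * f x \<partial>M) = (\<integral>\<^sup>+x. \<Phi> x * g x \<partial>M)"
proof -
  interpret prob_space M by fact
  interpret finite_measure_subalgebra M F
    by unfold_locales fact
  have "AE x in M. g x = nn_cond_exp M F f x"
    using eq f g by (intro nn_cond_exp_charact) (auto simp: mult.commute)
  then have "(\<integral>\<^sup>+x. \<Phi> x * g x \<partial>M) = (\<integral>\<^sup>+x. \<Phi> x * nn_cond_exp M F f x \<partial>M)"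
    by (intro nn_integral_cong_AE) auto
  also have "\<dots> = (\<integral>\<^sup>+x. \<Phi> x * f x \<partial>M)"
    by (rule nn_cond_exp_intg[OF \<Phi> f])
  finally show ?thesis by simp
qed

section \<open>The Markov property for path functionals\<close>

context markov_process
begin

lemma space_law [simp]: "space (law Z x) = Omega Z"
  using law_sets by (rule sets_eq_imp_space_eq)

lemma space_hist [simp]: "space (hist Z t) = Omega Z"
  using filtration by (simp add: filtration_def)

lemma hist_mono: "s \<le> t \<Longrightarrow> sets (hist Z s) \<subseteq> sets (hist Z t)"
  using filtration by (simp add: filtration_def)

lemma subalgebra_hist: "subalgebra (law Z x) (hist Z t)"
  using hist_sub law_sets by (auto simp: subalgebra_def)

lemma measurable_hist_mono: "f \<in> hist Z s \<rightarrow>\<^sub>M N \<Longrightarrow> s \<le> t \<Longrightarrow> f \<in> hist Z t \<rightarrow>\<^sub>M N"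
  using hist_mono[of s t] by (auto simp: measurable_def)

lemma measurable_traj_hist: "s \<le> t \<Longrightarrow> traj Z s \<in> hist Z t \<rightarrow>\<^sub>M borel_cem"
  using adapted by (rule measurable_hist_mono)

lemma measurable_hist_events: "f \<in> hist Z s \<rightarrow>\<^sub>M N \<Longrightarrow> f \<in> events Z \<rightarrow>\<^sub>M N"
  using hist_sub[of s] by (auto simp: measurable_def)

lemma measurable_law_cong: "f \<in> law Z x \<rightarrow>\<^sub>M N \<longleftrightarrow> f \<in> events Z \<rightarrow>\<^sub>M N"
  by (rule arg_cong[where f="\<lambda>A. f \<in> A"]) (rule measurable_cong_sets[OF law_sets refl])

lemma measurable_traj_events: "traj Z s \<in> events Z \<rightarrow>\<^sub>M borel_cem"
  using adapted by (rule measurable_hist_events)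

lemma measurable_traj_law: "traj Z s \<in> law Z x \<rightarrow>\<^sub>M borel_cem"
  using measurable_traj_events by (simp add: measurable_law_cong)

text \<open>The laws of the position at a fixed time form a kernel, so measurability in the starting
  point passes from sets to nonnegative functions through \<open>subprob_algebra\<close>.\<close>

lemma measurable_transition:
  assumes "s < \<infinity>" and f: "f \<in> borel_measurable borel_cem"
  shows "(\<lambda>z. \<integral>\<^sup>+\<omega>. f (traj Z s \<omega>) \<partial>law Z z) \<in> borel_measurable borel_cem"
proof -
  let ?K = "\<lambda>z. distr (law Z z) borel_cem (traj Z s)"
  have pr: "prob_space (?K z)" for z
    by (rule prob_space.prob_space_distr[OF law_prob measurable_traj_law])
  have "?K \<in> borel_cem \<rightarrow>\<^sub>M subprob_algebra borel_cem"
  proof (rule measurable_subprob_algebra)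
    fix B :: "'a option set" assume B: "B \<in> sets borel_cem"
    have "emeasure (?K z) B = ennreal (measure (law Z z) (traj Z s -` B \<inter> Omega Z))" for z
      using B law_prob[of z] measurable_traj_law[of s z]
      by (simp add: emeasure_distr prob_space.finite_measure finite_measure.emeasure_eq_measure)
    then show "(\<lambda>z. emeasure (?K z) B) \<in> borel_measurable borel_cem"
      using law_measurable[OF assms(1) B] by (auto intro: measurable_borel_cem)
  qed (auto simp: pr prob_space_imp_subprob_space)
  then have "(\<lambda>z. \<integral>\<^sup>+y. f y \<partial>?K z) \<in> borel_measurable borel_cem"
    using f by (intro nn_integral_measurable_subprob_algebra2[where N=borel_cem])
      (auto intro: measurable_compose[OF measurable_snd])
  then show ?thesis
    using f measurable_traj_law by (simp add: nn_integral_distr)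
qed

lemma measurable_transition_hist:
  assumes "s < \<infinity>" and "f \<in> borel_measurable borel_cem"
  shows "(\<lambda>\<omega>. \<integral>\<^sup>+\<omega>'. f (traj Z s \<omega>') \<partial>law Z (traj Z t \<omega>)) \<in> borel_measurable (hist Z t)"
  using measurable_transition[OF assms] by (rule measurable_compose[OF adapted])

text \<open>Turns the almost sure identity of real conditional expectations into one of nonnegative
  integrals. The weights are indicators at first: then all integrands are bounded by 1 and the
  detour through real integrals is safe.\<close>

lemma markov_indicator:
  assumes "s < \<infinity>" "t < \<infinity>" "B \<in> sets borel_cem" and \<Phi>: "\<Phi> \<in> borel_measurable (hist Z t)"
  shows "(\<integral>\<^sup>+\<omega>. \<Phi> \<omega> * indicator B (traj Z (t + s) \<omega>) \<partial>law Z x)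
    = (\<integral>\<^sup>+\<omega>. \<Phi> \<omega> * (\<integral>\<^sup>+\<omega>'. indicator B (traj Z s \<omega>') \<partial>law Z (traj Z t \<omega>)) \<partial>law Z x)"
proof (rule nn_integral_mult_subalgebra_cong[OF law_prob subalgebra_hist[of _ t] _ _ \<Phi>])
  interpret prob_space "law Z x" by (rule law_prob)
  interpret finite_measure_subalgebra "law Z x" "hist Z t"
    by unfold_locales (rule subalgebra_hist)
  show "(\<lambda>\<omega>. indicator B (traj Z (t + s) \<omega>) :: ennreal) \<in> borel_measurable (law Z x)"
    using assms by (intro measurable_compose[OF measurable_traj_law]) auto
  show "(\<lambda>\<omega>. \<integral>\<^sup>+\<omega>'. indicator B (traj Z s \<omega>') \<partial>law Z (traj Z t \<omega>)) \<in> borel_measurable (hist Z t)"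
    using assms by (intro measurable_transition_hist) auto
  fix H assume H: "H \<in> sets (hist Z t)"
  then have H': "H \<in> sets (law Z x)"
    using hist_sub law_sets by auto
  let ?S = "traj Z (t + s) -` B \<inter> Omega Z"
  have S: "?S \<in> sets (law Z x)"
    using measurable_sets[OF measurable_traj_law assms(3)] by simp
  have i: "(\<integral>\<^sup>+\<omega>'. indicator B (traj Z s \<omega>') \<partial>law Z z)
      = ennreal (measure (law Z z) (traj Z s -` B \<inter> Omega Z))" for z
  proof -
    have "(\<integral>\<^sup>+\<omega>'. indicator B (traj Z s \<omega>') \<partial>law Z z)
        = (\<integral>\<^sup>+\<omega>'. indicator (traj Z s -` B \<inter> Omega Z) \<omega>' \<partial>law Z z)"
      by (intro nn_integral_cong) (auto simp: indicator_def)
    also have "\<dots> = emeasure (law Z z) (traj Z s -` B \<inter> Omega Z)"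
      using measurable_sets[OF measurable_traj_law assms(3)] by (intro nn_integral_indicator) simp
    also have "\<dots> = ennreal (measure (law Z z) (traj Z s -` B \<inter> Omega Z))"
      using law_prob[of z] by (simp add: prob_space.finite_measure finite_measure.emeasure_eq_measure)
    finally show ?thesis .
  qed
  let ?m = "\<lambda>\<omega>. measure (law Z (traj Z t \<omega>)) (traj Z s -` B \<inter> Omega Z)"
  have m [measurable]: "?m \<in> borel_measurable (law Z x)"
    by (rule measurable_compose[OF measurable_traj_law])
      (rule measurable_borel_cem[OF law_measurable[OF assms(1,3)]], simp)
  let ?c = "real_cond_exp (law Z x) (hist Z t) (indicator ?S)"
  have int: "integrable (law Z x) (indicator ?S :: _ \<Rightarrow> real)"
    using S by (auto simp: emeasure_eq_measure)
  have "(\<integral>\<omega>. indicator H \<omega> * ?c \<omega> \<partial>law Z x) = (\<integral>\<omega>. indicator H \<omega> * indicator ?S \<omega> \<partial>law Z x)"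
    using real_cond_exp_intA[OF int H] by (simp add: set_lebesgue_integral_def)
  then have eq: "(\<integral>\<omega>. indicator H \<omega> * measure (law Z (traj Z t \<omega>)) (traj Z s -` B \<inter> Omega Z) \<partial>law Z x)
      = (\<integral>\<omega>. indicator H \<omega> * indicator ?S \<omega> \<partial>law Z x)"
    using markov[OF assms(1,2,3), of x]
    using H' m by (subst (asm) integral_cong_AE[of _ _ "\<lambda>\<omega>. indicator H \<omega> * ?m \<omega>"]) auto
  have "(\<integral>\<^sup>+\<omega>. indicator H \<omega> * indicator B (traj Z (t + s) \<omega>) \<partial>law Z x)
      = (\<integral>\<^sup>+\<omega>. ennreal (indicator H \<omega> * indicator ?S \<omega>) \<partial>law Z x)"
    by (intro nn_integral_cong) (auto simp: indicator_def)
  also have "\<dots> = ennreal (\<integral>\<omega>. indicator H \<omega> * indicator ?S \<omega> \<partial>law Z x)"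
    using S H' by (intro nn_integral_eq_integral integrable_const_bound[where B=1]
        borel_measurable_times borel_measurable_indicator) (auto simp: indicator_def)
  also have "\<dots> = (\<integral>\<^sup>+\<omega>. ennreal (indicator H \<omega> * measure (law Z (traj Z t \<omega>)) (traj Z s -` B \<inter> Omega Z)) \<partial>law Z x)"
    unfolding eq[symmetric]
  proof (intro nn_integral_eq_integral[symmetric] integrable_const_bound[where B=1] AE_I2)
    show "norm (indicator H \<omega> * measure (law Z (traj Z t \<omega>)) (traj Z s -` B \<inter> Omega Z)) \<le> 1" for \<omega>
      using prob_space.prob_le_1[OF law_prob] by (auto simp: indicator_def)
    show "(\<lambda>\<omega>. indicator H \<omega> * measure (law Z (traj Z t \<omega>)) (traj Z s -` B \<inter> Omega Z)) \<in> borel_measurable (law Z x)"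
      using H' by measurable
  qed auto
  also have "\<dots> = (\<integral>\<^sup>+\<omega>. indicator H \<omega> * (\<integral>\<^sup>+\<omega>'. indicator B (traj Z s \<omega>') \<partial>law Z (traj Z t \<omega>)) \<partial>law Z x)"
    unfolding i by (intro nn_integral_cong) (auto simp: indicator_def)
  finally show "(\<integral>\<^sup>+\<omega>. indicator H \<omega> * indicator B (traj Z (t + s) \<omega>) \<partial>law Z x)
      = (\<integral>\<^sup>+\<omega>. indicator H \<omega> * (\<integral>\<^sup>+\<omega>'. indicator B (traj Z s \<omega>') \<partial>law Z (traj Z t \<omega>)) \<partial>law Z x)" .
qed

lemma markov_nn_integral:
  assumes s: "s < \<infinity>" and t: "t < \<infinity>" and f: "f \<in> borel_measurable borel_cem"
    and \<Phi>: "\<Phi> \<in> borel_measurable (hist Z t)"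
  shows "(\<integral>\<^sup>+\<omega>. \<Phi> \<omega> * f (traj Z (t + s) \<omega>) \<partial>law Z x)
    = (\<integral>\<^sup>+\<omega>. \<Phi> \<omega> * (\<integral>\<^sup>+\<omega>'. f (traj Z s \<omega>') \<partial>law Z (traj Z t \<omega>)) \<partial>law Z x)"
  using f
proof (induction rule: borel_measurable_induct)
  note X [measurable] = measurable_traj_law
  have U [measurable]: "(\<lambda>\<omega>. g (traj Z r \<omega>)) \<in> borel_measurable (law Z z)"
    if "g \<in> borel_measurable borel_cem" for g r z
    using that by (rule measurable_compose[OF measurable_traj_law])
  have \<Phi>' [measurable]: "\<Phi> \<in> borel_measurable (law Z x)"
    using measurable_hist_events[OF \<Phi>] by (simp add: measurable_law_cong)
  have k [measurable]: "(\<lambda>\<omega>. \<integral>\<^sup>+\<omega>'. g (traj Z s \<omega>') \<partial>law Z (traj Z t \<omega>)) \<in> borel_measurable (law Z x)"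
    if "g \<in> borel_measurable borel_cem" for g
    using measurable_transition[OF s that] by (rule measurable_compose[OF measurable_traj_law])
  {
    case (cong f g)
    then show ?case by (simp cong: nn_integral_cong)
  next
    case (set B)
    then show ?case using markov_indicator[OF s t _ \<Phi>] by simp
  next
    case (mult u c)
    then show ?case
      by (simp add: nn_integral_cmult mult.left_commute[of _ c])
  next
    case (add u v)
    then show ?case
      by (simp add: nn_integral_add distrib_left)
  next
    case (seq U)
    have inc: "incseq (\<lambda>i \<omega>. \<Phi> \<omega> * U i (traj Z (t + s) \<omega>))"
      "incseq (\<lambda>i \<omega>. U i (traj Z s \<omega>))"
      using seq(3) by (auto simp: incseq_def le_fun_def intro!: mult_left_mono)
    have inc': "incseq (\<lambda>i \<omega>. \<Phi> \<omega> * (\<integral>\<^sup>+\<omega>'. U i (traj Z s \<omega>') \<partial>law Z (traj Z t \<omega>)))"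
      using seq(3) by (auto simp: incseq_def le_fun_def intro!: mult_left_mono nn_integral_mono)
    have "(\<integral>\<^sup>+\<omega>. \<Phi> \<omega> * (SUP i. U i) (traj Z (t + s) \<omega>) \<partial>law Z x)
        = (\<integral>\<^sup>+\<omega>. (SUP i. \<Phi> \<omega> * U i (traj Z (t + s) \<omega>)) \<partial>law Z x)"
      by (simp add: SUP_mult_left_ennreal image_comp)
    also have "\<dots> = (SUP i. \<integral>\<^sup>+\<omega>. \<Phi> \<omega> * U i (traj Z (t + s) \<omega>) \<partial>law Z x)"
      using seq(1) inc by (intro nn_integral_monotone_convergence_SUP) auto
    also have "\<dots> = (SUP i. \<integral>\<^sup>+\<omega>. \<Phi> \<omega> * (\<integral>\<^sup>+\<omega>'. U i (traj Z s \<omega>') \<partial>law Z (traj Z t \<omega>)) \<partial>law Z x)"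
      using seq.IH by simp
    also have "\<dots> = (\<integral>\<^sup>+\<omega>. (SUP i. \<Phi> \<omega> * (\<integral>\<^sup>+\<omega>'. U i (traj Z s \<omega>') \<partial>law Z (traj Z t \<omega>))) \<partial>law Z x)"
      using seq(1) inc' by (intro nn_integral_monotone_convergence_SUP[symmetric]) auto
    also have "\<dots> = (\<integral>\<^sup>+\<omega>. \<Phi> \<omega> * (\<integral>\<^sup>+\<omega>'. (SUP i. U i) (traj Z s \<omega>') \<partial>law Z (traj Z t \<omega>)) \<partial>law Z x)"
    proof (intro nn_integral_cong)
      fix \<omega>
      have "(\<integral>\<^sup>+\<omega>'. (SUP i. U i) (traj Z s \<omega>') \<partial>law Z (traj Z t \<omega>))
          = (SUP i. \<integral>\<^sup>+\<omega>'. U i (traj Z s \<omega>') \<partial>law Z (traj Z t \<omega>))"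
        using seq(1) inc(2)
        by (subst nn_integral_monotone_convergence_SUP[symmetric])
          (auto simp: image_comp intro!: measurable_compose[OF measurable_traj_law])
      then show "(SUP i. \<Phi> \<omega> * (\<integral>\<^sup>+\<omega>'. U i (traj Z s \<omega>') \<partial>law Z (traj Z t \<omega>)))
          = \<Phi> \<omega> * (\<integral>\<^sup>+\<omega>'. (SUP i. U i) (traj Z s \<omega>') \<partial>law Z (traj Z t \<omega>))"
        by (simp add: SUP_mult_left_ennreal)
    qed
    finally show ?case .
  }
qed

text \<open>Induction on the largest time \<open>b\<close>: conditioning at the last earlier time
  \<open>m\<close> replaces the factor at \<open>b\<close> by a function of the position at
  \<open>m\<close>. That \<open>k\<close> depends neither on \<open>t\<close> nor on
  \<open>x\<close> is essential, since it is computed later at time 0.\<close>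

lemma markov_finite_dimensional:
  assumes "finite J" and "J \<subseteq> {0<..<\<infinity>}" and "\<And>s. f s \<in> borel_measurable borel_cem"
  shows "\<exists>k\<in>borel_measurable borel_cem. \<forall>t x \<Phi>. t < \<infinity> \<longrightarrow> \<Phi> \<in> borel_measurable (hist Z t) \<longrightarrow>
    (\<integral>\<^sup>+\<omega>. \<Phi> \<omega> * (\<Prod>s\<in>insert 0 J. f s (traj Z (t + s) \<omega>)) \<partial>law Z x)
      = (\<integral>\<^sup>+\<omega>. \<Phi> \<omega> * k (traj Z t \<omega>) \<partial>law Z x)"
  using assms
proof (induction J arbitrary: f rule: finite_linorder_max_induct)
  case empty
  then show ?case by (intro bexI[of _ "f 0"]) auto
next
  case (insert b J)
  \<comment> \<open>Time 0 always belongs to the set, so the maximum exists even for empty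
    \<open>J\<close>.\<close>
  define m where "m = Max (insert 0 J)"
  have m: "m \<in> insert 0 J"
    unfolding m_def using insert(1) by (intro Max_in) auto
  have le_m: "s \<le> m" if "s \<in> insert 0 J" for s
    unfolding m_def using insert(1) that by (intro Max_ge) auto
  have b: "0 < b" "b < \<infinity>" using insert.prems by auto
  have mb: "m < b" using m b insert(2) by auto
  have bm: "b - m < \<infinity>" using b(2) by (meson diff_le_self_ennreal le_less_trans)
  define q where "q z = (\<integral>\<^sup>+\<omega>. f b (traj Z (b - m) \<omega>) \<partial>law Z z)" for z
  have q: "q \<in> borel_measurable borel_cem"
    unfolding q_def using bm insert.prems(2) by (rule measurable_transition)
  \<comment> \<open>The integrated last factor \<open>q\<close> is absorbed into the factor at time
    \<open>m\<close>, which leaves a product over \<open>insert 0 J\<close>.\<close>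
  define g where "g = f(m := \<lambda>z. f m z * q z)"
  have "g s \<in> borel_measurable borel_cem" for s
    using insert.prems(2) q by (auto simp: g_def)
  moreover have "J \<subseteq> {0<..<\<infinity>}" using insert.prems by auto
  ultimately obtain k where k: "k \<in> borel_measurable borel_cem"
    and eq: "\<And>t x \<Phi>. t < \<infinity> \<Longrightarrow> \<Phi> \<in> borel_measurable (hist Z t) \<Longrightarrow>
      (\<integral>\<^sup>+\<omega>. \<Phi> \<omega> * (\<Prod>s\<in>insert 0 J. g s (traj Z (t + s) \<omega>)) \<partial>law Z x)
        = (\<integral>\<^sup>+\<omega>. \<Phi> \<omega> * k (traj Z t \<omega>) \<partial>law Z x)"
    using insert.IH[of g] by blast
  have "(\<integral>\<^sup>+\<omega>. \<Phi> \<omega> * (\<Prod>s\<in>insert 0 (insert b J). f s (traj Z (t + s) \<omega>)) \<partial>law Z x)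
      = (\<integral>\<^sup>+\<omega>. \<Phi> \<omega> * k (traj Z t \<omega>) \<partial>law Z x)"
    if t: "t < \<infinity>" and \<Phi>: "\<Phi> \<in> borel_measurable (hist Z t)" for t x \<Phi>
  proof -
    let ?\<Psi> = "\<lambda>\<omega>. \<Phi> \<omega> * (\<Prod>s\<in>insert 0 J. f s (traj Z (t + s) \<omega>))"
    have \<Psi>: "?\<Psi> \<in> borel_measurable (hist Z (t + m))"
      using insert.prems(2) le_m
      by (intro borel_measurable_times_ennreal borel_measurable_prod_ennreal
          measurable_hist_mono[OF \<Phi>] measurable_compose[OF measurable_traj_hist] add_left_mono) auto
    have tb: "t + b = t + m + (b - m)"
      using mb by (simp add: add.assoc add_diff_inverse_ennreal)
    have b': "b \<notin> insert 0 J" using insert(2) b by auto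
    have "(\<integral>\<^sup>+\<omega>. \<Phi> \<omega> * (\<Prod>s\<in>insert 0 (insert b J). f s (traj Z (t + s) \<omega>)) \<partial>law Z x)
        = (\<integral>\<^sup>+\<omega>. ?\<Psi> \<omega> * f b (traj Z (t + m + (b - m)) \<omega>) \<partial>law Z x)"
      unfolding insert_commute[of 0 b] prod.insert[OF finite.insertI[OF insert(1)] b'] tb
      by (simp add: ac_simps)
    also have "\<dots> = (\<integral>\<^sup>+\<omega>. ?\<Psi> \<omega> * q (traj Z (t + m) \<omega>) \<partial>law Z x)"
      unfolding q_def using t mb b
      by (intro markov_nn_integral bm insert.prems(2) \<Psi>)
        (metis ennreal_add_eq_top infinity_ennreal_def less_top order_less_trans)
    also have "\<dots> = (\<integral>\<^sup>+\<omega>. \<Phi> \<omega> * (\<Prod>s\<in>insert 0 J. g s (traj Z (t + s) \<omega>)) \<partial>law Z x)"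
    proof (intro nn_integral_cong)
      fix \<omega>
      have "(\<Prod>s\<in>insert 0 J - {m}. g s (traj Z (t + s) \<omega>)) = (\<Prod>s\<in>insert 0 J - {m}. f s (traj Z (t + s) \<omega>))"
        by (intro prod.cong) (auto simp: g_def)
      then show "?\<Psi> \<omega> * q (traj Z (t + m) \<omega>) = \<Phi> \<omega> * (\<Prod>s\<in>insert 0 J. g s (traj Z (t + s) \<omega>))"
        using insert(1) by (simp only: prod.remove[OF finite.insertI m]) (simp add: g_def ac_simps)
    qed
    also have "\<dots> = (\<integral>\<^sup>+\<omega>. \<Phi> \<omega> * k (traj Z t \<omega>) \<partial>law Z x)"
      using eq[OF t \<Phi>] .
    finally show ?thesis .
  qed
  with k show ?case by blast
qed

section \<open>Cylinder events and the natural sigma-algebra\<close>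

definition cylinder :: "ennreal set \<Rightarrow> (ennreal \<Rightarrow> 'a option set) \<Rightarrow> 'w set" where
  "cylinder J B = {\<omega> \<in> Omega Z. \<forall>s\<in>insert 0 J. traj Z s \<omega> \<in> B s}"

definition cylinders :: "'w set set" where
  "cylinders = {cylinder J B | J B. finite J \<and> J \<subseteq> {0<..<\<infinity>} \<and> (\<forall>s. B s \<in> sets borel_cem)}"

lemma Int_stable_cylinders: "Int_stable cylinders"
proof (rule Int_stableI)
  fix a b assume ab: "a \<in> cylinders" "b \<in> cylinders"
  from ab(1) obtain J B where *: "a = cylinder J B"
    "finite J" "J \<subseteq> {0<..<\<infinity>}" "\<And>s. B s \<in> sets borel_cem"
    unfolding cylinders_def by blast
  from ab(2) obtain J' B' where **: "b = cylinder J' B'"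
    "finite J'" "J' \<subseteq> {0<..<\<infinity>}" "\<And>s. B' s \<in> sets borel_cem"
    unfolding cylinders_def by blast
  \<comment> \<open>Outside its own time set a cylinder imposes no condition, so its sets are
    replaced there by \<open>UNIV\<close> before intersecting.\<close>
  let ?B = "\<lambda>s. (if s \<in> insert 0 J then B s else UNIV) \<inter> (if s \<in> insert 0 J' then B' s else UNIV)"
  have "a \<inter> b = cylinder (J \<union> J') ?B"
  proof (intro set_eqI)
    fix \<omega>
    have "traj Z s \<omega> \<in> ?B s \<longleftrightarrow> (s \<in> insert 0 J \<longrightarrow> traj Z s \<omega> \<in> B s)
        \<and> (s \<in> insert 0 J' \<longrightarrow> traj Z s \<omega> \<in> B' s)" for s
      by (simp only: Int_iff if_split_mem2 UNIV_I) blast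
    then show "\<omega> \<in> a \<inter> b \<longleftrightarrow> \<omega> \<in> cylinder (J \<union> J') ?B"
      unfolding *(1) **(1) cylinder_def by blast
  qed
  moreover have "?B s \<in> sets borel_cem" for s
  proof (rule sets.Int)
    have u: "UNIV \<in> sets (borel_cem :: 'a option measure)"
      using sets.top[of "borel_cem :: 'a option measure"] by simp
    show "(if s \<in> insert 0 J then B s else UNIV) \<in> sets borel_cem"
      by (rule if_split[THEN iffD2]) (use u *(4) in blast)
    show "(if s \<in> insert 0 J' then B' s else UNIV) \<in> sets borel_cem"
      by (rule if_split[THEN iffD2]) (use u **(4) in blast)
  qed
  moreover have "finite (J \<union> J')" "J \<union> J' \<subseteq> {0<..<\<infinity>}"
    using *(2,3) **(2,3) by simp_all
  ultimately show "a \<inter> b \<in> cylinders"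
    unfolding cylinders_def by (intro CollectI exI[of _ "J \<union> J'"] exI[of _ ?B] conjI allI)
qed

lemma sets_traj: "B \<in> sets borel_cem \<Longrightarrow> traj Z s -` B \<inter> Omega Z \<in> sets (events Z)"
  using measurable_sets[OF measurable_traj_events] by auto

lemma cylinder_in_events:
  assumes "finite J" "\<And>s. B s \<in> sets borel_cem"
  shows "cylinder J B \<in> sets (events Z)"
proof -
  have "cylinder J B = (\<Inter>s\<in>insert 0 J. traj Z s -` B s \<inter> Omega Z)"
    by (auto simp: cylinder_def)
  moreover have "(\<Inter>s\<in>insert 0 J. traj Z s -` B s \<inter> Omega Z) \<in> sets (events Z)"
    using assms by (intro sets.finite_INT sets_traj) auto
  ultimately show ?thesis by (simp only:)
qed

lemma natural_sets_space: "natural_sets Z t \<subseteq> Pow (Omega Z)"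
proof (intro subsetI PowI)
  fix A \<omega> assume A: "A \<in> natural_sets Z t" and \<omega>: "\<omega> \<in> A"
  have sp: "{traj Z s -` B \<inter> Omega Z | s B. s \<le> t \<and> B \<in> sets borel_cem} \<subseteq> Pow (Omega Z)"
    by blast
  from sigma_sets_into_sp[OF sp A[unfolded natural_sets_def]] \<omega> show "\<omega> \<in> Omega Z" ..
qed

lemma natural_sets_events: "natural_sets Z t \<subseteq> sets (events Z)"
  unfolding natural_sets_def by (rule sets.sigma_sets_subset) (blast intro: sets_traj)

lemma natural_sets_hist: "natural_sets Z t \<subseteq> sets (hist Z t)"
proof -
  have "sigma_sets (space (hist Z t)) {traj Z s -` B \<inter> Omega Z | s B. s \<le> t \<and> B \<in> sets borel_cem} \<subseteq> sets (hist Z t)"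
  proof (rule sets.sigma_sets_subset, safe)
    fix s B assume "s \<le> t" "B \<in> sets (borel_cem :: 'a option measure)"
    from measurable_sets[OF measurable_traj_hist[OF this(1)] this(2)]
    show "traj Z s -` B \<inter> Omega Z \<in> sets (hist Z t)" by simp
  qed
  then show ?thesis by (simp add: natural_sets_def)
qed

lemma natural_sets_cylinders: "natural_sets Z \<infinity> = sigma_sets (Omega Z) cylinders"
proof
  show "natural_sets Z \<infinity> \<subseteq> sigma_sets (Omega Z) cylinders"
    unfolding natural_sets_def
  proof (rule sigma_sets_mono, safe)
    fix s :: ennreal and B assume B: "B \<in> sets (borel_cem :: 'a option measure)"
    consider "s = \<infinity>" | "s = 0" | "s \<in> {0<..<\<infinity>}"
      by (metis greaterThanLessThan_iff infinity_ennreal_def top.not_eq_extremum zero_less_iff_neq_zero)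
    then show "traj Z s -` B \<inter> Omega Z \<in> sigma_sets (Omega Z) cylinders"
    proof cases
      \<comment> \<open>At time infinity every path is in the cemetery, so the preimage is all of
        \<open>Omega Z\<close> or empty.\<close>
      case 1
      have "traj Z s -` B \<inter> Omega Z = (if None \<in> B then Omega Z else {})"
        using at_infinity unfolding 1 by force
      then show ?thesis by (simp add: sigma_sets.Empty sigma_sets_top)
    next
      case 2
      have "traj Z s -` B \<inter> Omega Z = cylinder {} (\<lambda>_. B)"
        by (auto simp: cylinder_def 2)
      moreover have "cylinder {} (\<lambda>_. B) \<in> cylinders"
        unfolding cylinders_def using B by blast
      ultimately show ?thesis by (simp add: sigma_sets.Basic)
    next
      case 3
      have "traj Z s -` B \<inter> Omega Z = cylinder {s} (\<lambda>r. if r = s then B else UNIV)"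
        using 3 by (auto simp: cylinder_def)
      moreover have "(if r = s then B else UNIV) \<in> sets borel_cem" for r
        using B sets.top[of borel_cem] by auto
      then have "cylinder {s} (\<lambda>r. if r = s then B else UNIV) \<in> cylinders"
        unfolding cylinders_def using 3
        by (intro CollectI exI[of _ "{s}"] exI[of _ "\<lambda>r. if r = s then B else UNIV"]) simp
      ultimately show ?thesis by (simp add: sigma_sets.Basic)
    qed
  qed
  show "sigma_sets (Omega Z) cylinders \<subseteq> natural_sets Z \<infinity>"
    unfolding natural_sets_def
  proof (rule sigma_sets_mono, safe)
    let ?N = "sigma (Omega Z) {traj Z s -` B \<inter> Omega Z | s B. s \<le> \<infinity> \<and> B \<in> sets borel_cem}"
    fix C assume "C \<in> cylinders"
    then obtain J B where *: "C = cylinder J B" "finite J" "\<And>s. B s \<in> sets borel_cem"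
      by (auto simp: cylinders_def)
    have sp: "{traj Z s -` B \<inter> Omega Z | s B. s \<le> \<infinity> \<and> B \<in> sets borel_cem} \<subseteq> Pow (Omega Z)"
      by blast
    have eq: "C = (\<Inter>s\<in>insert 0 J. traj Z s -` B s \<inter> Omega Z)"
      unfolding *(1) cylinder_def by blast
    have gen: "traj Z s -` B s \<inter> Omega Z \<in> sets ?N" for s
      unfolding sets_measure_of[OF sp] using *(3) by (intro sigma_sets.Basic) auto
    have "C \<in> sets ?N"
      unfolding eq by (intro sets.finite_INT gen) (use *(2) in auto)
    then show "C \<in> sigma_sets (Omega Z) {traj Z s -` B \<inter> Omega Z | s B. s \<le> \<infinity> \<and> B \<in> sets borel_cem}"
      unfolding sets_measure_of[OF sp] .
  qed
qed

definition natural :: "'w measure" where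
  "natural = sigma (Omega Z) (natural_sets Z \<infinity>)"

lemma space_natural [simp]: "space natural = Omega Z"
  using natural_sets_space by (simp add: natural_def space_measure_of)

lemma sets_natural: "sets natural = natural_sets Z \<infinity>"
  unfolding natural_def sets_measure_of[OF natural_sets_space]
  unfolding natural_sets_def by (rule sigma_sets_sigma_sets_eq) auto

lemma measurable_traj_natural: "traj Z s \<in> natural \<rightarrow>\<^sub>M borel_cem"
proof (rule measurableI)
  show "traj Z s -` B \<inter> space natural \<in> sets natural" if "B \<in> sets borel_cem" for B
    unfolding sets_natural natural_sets_def space_natural
    using that by (intro sigma_sets.Basic) auto
qed auto

text \<open>By \<open>homogeneous\<close>, a condition at time s on the shifted path is a condition
  at time s + t on the original one, so cylinders pull back to finite intersections.\<close>

lemma measurable_shift_natural: "shift Z t \<in> events Z \<rightarrow>\<^sub>M natural"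
  unfolding natural_def natural_sets_cylinders
proof (rule measurable_measure_of)
  show "sigma_sets (Omega Z) cylinders \<subseteq> Pow (Omega Z)"
    using natural_sets_space[of \<infinity>] unfolding natural_sets_cylinders .
  show "shift Z t \<in> Omega Z \<rightarrow> Omega Z"
    using shift_closed by auto
  fix C assume C: "C \<in> sigma_sets (Omega Z) cylinders"
  show "shift Z t -` C \<inter> Omega Z \<in> sets (events Z)"
    using C
  proof induction
    case (Basic a)
    then obtain J B where *: "a = cylinder J B" "finite J" "\<And>s. B s \<in> sets borel_cem"
      by (auto simp: cylinders_def)
    have "shift Z t -` a \<inter> Omega Z = (\<Inter>s\<in>insert 0 J. traj Z (s + t) -` B s \<inter> Omega Z)"
    proof (intro set_eqI)
      fix \<omega>
      show "\<omega> \<in> shift Z t -` a \<inter> Omega Z \<longleftrightarrow> \<omega> \<in> (\<Inter>s\<in>insert 0 J. traj Z (s + t) -` B s \<inter> Omega Z)"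
        using shift_closed[of \<omega> t] homogeneous[of \<omega> _ t]
        by (cases "\<omega> \<in> Omega Z") (simp_all add: *(1) cylinder_def)
    qed
    moreover have "(\<Inter>s\<in>insert 0 J. traj Z (s + t) -` B s \<inter> Omega Z) \<in> sets (events Z)"
      using * by (intro sets.finite_INT sets_traj) auto
    ultimately show ?case by (simp only:)
  next
    case (Compl a)
    have "shift Z t -` (Omega Z - a) \<inter> Omega Z = Omega Z - (shift Z t -` a \<inter> Omega Z)"
      using shift_closed by auto
    then show ?case using sets.compl_sets[OF Compl.IH] by (simp only:)
  next
    case (Union a)
    have "shift Z t -` \<Union> (range a) \<inter> Omega Z = (\<Union>i. shift Z t -` a i \<inter> Omega Z)"
      by auto
    moreover have "(\<Union>i. shift Z t -` a i \<inter> Omega Z) \<in> sets (events Z)"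
      by (intro sets.countable_nat_UN) (use Union.IH in blast)
    ultimately show ?case by (simp only:)
  qed auto
qed

lemma markov_cylinder:
  assumes C: "C \<in> cylinders"
  shows "(\<lambda>z. emeasure (law Z z) C) \<in> borel_measurable borel_cem"
    and "\<lbrakk>t < \<infinity>; \<Phi> \<in> borel_measurable (hist Z t)\<rbrakk> \<Longrightarrow>
      (\<integral>\<^sup>+\<omega>. \<Phi> \<omega> * indicator C (shift Z t \<omega>) \<partial>law Z x)
        = (\<integral>\<^sup>+\<omega>. \<Phi> \<omega> * emeasure (law Z (traj Z t \<omega>)) C \<partial>law Z x)"
proof -
  from C obtain J B where *: "C = cylinder J B" "finite J" "J \<subseteq> {0<..<\<infinity>}" "\<And>s. B s \<in> sets borel_cem"
    by (auto simp: cylinders_def)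
  obtain k where k: "k \<in> borel_measurable borel_cem"
    and eq: "\<And>t x \<Phi>. t < \<infinity> \<Longrightarrow> \<Phi> \<in> borel_measurable (hist Z t) \<Longrightarrow>
      (\<integral>\<^sup>+\<omega>. \<Phi> \<omega> * (\<Prod>s\<in>insert 0 J. indicator (B s) (traj Z (t + s) \<omega>)) \<partial>law Z x)
        = (\<integral>\<^sup>+\<omega>. \<Phi> \<omega> * k (traj Z t \<omega>) \<partial>law Z x)"
    using markov_finite_dimensional[of J "\<lambda>s. indicator (B s)"] * by auto
  have ind: "(\<Prod>s\<in>insert 0 J. indicator (B s) (h s)) = (if \<forall>s\<in>insert 0 J. h s \<in> B s then 1 else (0::ennreal))" for h
  proof (cases "\<forall>s\<in>insert 0 J. h s \<in> B s")
    case True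
    then show ?thesis by (simp add: prod.neutral)
  next
    case False
    then obtain s where "s \<in> insert 0 J" "h s \<notin> B s" by blast
    then have "\<exists>s\<in>insert 0 J. indicator (B s) (h s) = (0::ennreal)"
      by (intro bexI[of _ s]) simp_all
    then have "(\<Prod>s\<in>insert 0 J. indicator (B s) (h s)) = (0::ennreal)"
      using \<open>finite J\<close> by (intro prod_zero) auto
    then show ?thesis using False by auto
  qed
  \<comment> \<open>As \<open>k\<close> is the same for all conditioning times, it may be read off
    at time 0 with weight 1, where normality of the process identifies it with the probability of
    \<open>C\<close>.\<close>
  have prob: "k z = emeasure (law Z z) C" for z
  proof -
    have "emeasure (law Z z) C = (\<integral>\<^sup>+\<omega>. indicator C \<omega> \<partial>law Z z)"
      using cylinder_in_events[of J B] * by (simp add: law_sets)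
    also have "\<dots> = (\<integral>\<^sup>+\<omega>. 1 * (\<Prod>s\<in>insert 0 J. indicator (B s) (traj Z (0 + s) \<omega>)) \<partial>law Z z)"
      unfolding ind by (intro nn_integral_cong) (auto simp: * cylinder_def indicator_def)
    also have "\<dots> = (\<integral>\<^sup>+\<omega>. 1 * k (traj Z 0 \<omega>) \<partial>law Z z)"
      by (rule eq) auto
    also have "\<dots> = (\<integral>\<^sup>+\<omega>. k z \<partial>law Z z)"
      using normal[of z] by (intro nn_integral_cong_AE) auto
    also have "\<dots> = k z"
      using prob_space.emeasure_space_1[OF law_prob[of z]] by simp
    finally show ?thesis by simp
  qed
  then have "k = (\<lambda>z. emeasure (law Z z) C)" by auto
  with k show "(\<lambda>z. emeasure (law Z z) C) \<in> borel_measurable borel_cem" by simp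
  show "(\<integral>\<^sup>+\<omega>. \<Phi> \<omega> * indicator C (shift Z t \<omega>) \<partial>law Z x)
        = (\<integral>\<^sup>+\<omega>. \<Phi> \<omega> * emeasure (law Z (traj Z t \<omega>)) C \<partial>law Z x)"
    if "t < \<infinity>" "\<Phi> \<in> borel_measurable (hist Z t)"
  proof -
    have "(\<integral>\<^sup>+\<omega>. \<Phi> \<omega> * indicator C (shift Z t \<omega>) \<partial>law Z x)
        = (\<integral>\<^sup>+\<omega>. \<Phi> \<omega> * (\<Prod>s\<in>insert 0 J. indicator (B s) (traj Z (t + s) \<omega>)) \<partial>law Z x)"
    proof (intro nn_integral_cong)
      fix \<omega> assume "\<omega> \<in> space (law Z x)"
      then have "shift Z t \<omega> \<in> C \<longleftrightarrow> (\<forall>s\<in>insert 0 J. traj Z (t + s) \<omega> \<in> B s)"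
        using shift_closed[of \<omega> t] homogeneous[of \<omega> _ t]
        by (simp add: *(1) cylinder_def add.commute[of t])
      then show "\<Phi> \<omega> * indicator C (shift Z t \<omega>)
          = \<Phi> \<omega> * (\<Prod>s\<in>insert 0 J. indicator (B s) (traj Z (t + s) \<omega>))"
        unfolding ind by simp
    qed
    also have "\<dots> = (\<integral>\<^sup>+\<omega>. \<Phi> \<omega> * k (traj Z t \<omega>) \<partial>law Z x)"
      by (rule eq[OF that])
    finally show ?thesis by (simp only: prob)
  qed
qed

text \<open>Dynkin's argument with the intersection-stable cylinders as generator. The weights are
  indicators because the complement step subtracts integrals, which must be finite.\<close>

lemma markov_event:
  assumes C: "C \<in> natural_sets Z \<infinity>"
  shows "(\<lambda>z. emeasure (law Z z) C) \<in> borel_measurable borel_cem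
    \<and> (\<forall>t x H. t < \<infinity> \<longrightarrow> H \<in> sets (hist Z t) \<longrightarrow>
      (\<integral>\<^sup>+\<omega>. indicator H \<omega> * indicator C (shift Z t \<omega>) \<partial>law Z x)
        = (\<integral>\<^sup>+\<omega>. indicator H \<omega> * emeasure (law Z (traj Z t \<omega>)) C \<partial>law Z x))"
    (is "?P C")
proof -
  have C': "C \<in> sigma_sets (Omega Z) cylinders"
    using C unfolding natural_sets_cylinders .
  have sp: "cylinders \<subseteq> Pow (Omega Z)"
    by (auto simp: cylinders_def cylinder_def)
  have ev: "A \<in> sets (law Z x)" if "A \<in> sigma_sets (Omega Z) cylinders" for A x
    using that natural_sets_events[of \<infinity>] unfolding law_sets natural_sets_cylinders by auto
  have sh: "(\<lambda>\<omega>. indicator A (shift Z t \<omega>) :: ennreal) \<in> borel_measurable (law Z x)"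
    if "A \<in> sigma_sets (Omega Z) cylinders" for A t x
    unfolding measurable_law_cong
    by (rule measurable_compose[OF measurable_shift_natural])
      (intro borel_measurable_indicator, use that in \<open>simp add: sets_natural natural_sets_cylinders del: infinity_ennreal_def\<close>)
  have hm: "H \<in> sets (law Z x)" if "H \<in> sets (hist Z t)" for H t x
    using that hist_sub by (auto simp: law_sets)
  have tm: "(\<lambda>\<omega>. g (traj Z t \<omega>)) \<in> borel_measurable (law Z x)"
    if "g \<in> borel_measurable borel_cem" for g :: "_ \<Rightarrow> ennreal" and t x
    using that by (rule measurable_compose[OF measurable_traj_law])
  have one: "emeasure (law Z x) (Omega Z) = 1" for x
    using prob_space.emeasure_space_1[OF law_prob[of x]] by simp
  have fin: "(\<integral>\<^sup>+\<omega>. indicator H \<omega> * f \<omega> \<partial>law Z x) \<noteq> \<infinity>" if "\<And>\<omega>. \<omega> \<in> Omega Z \<Longrightarrow> f \<omega> \<le> 1" for f H x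
  proof -
    have "(\<integral>\<^sup>+\<omega>. indicator H \<omega> * f \<omega> \<partial>law Z x) \<le> (\<integral>\<^sup>+\<omega>. 1 \<partial>law Z x)"
      using that by (intro nn_integral_mono) (auto simp: indicator_def)
    then show ?thesis using one by (auto simp: top_unique)
  qed
  show ?thesis
  proof (rule sigma_sets_induct_disjoint[OF Int_stable_cylinders sp C', of ?P], goal_cases)
    case (1 A)
    then show ?case using markov_cylinder[OF 1] by auto
  next
    case 2
    then show ?case by simp
  next
    case (3 A)
    have eq: "emeasure (law Z z) (Omega Z - A) = 1 - emeasure (law Z z) A" for z
      using emeasure_compl[of A "law Z z"] ev[OF 3(1)] one
        finite_measure.emeasure_finite[OF prob_space.finite_measure[OF law_prob]] by simp
    have le: "emeasure (law Z z) A \<le> 1" for z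
      using prob_space.measure_le_1[OF law_prob] .
    have "(\<integral>\<^sup>+\<omega>. indicator H \<omega> * indicator (Omega Z - A) (shift Z t \<omega>) \<partial>law Z x)
        = (\<integral>\<^sup>+\<omega>. indicator H \<omega> * emeasure (law Z (traj Z t \<omega>)) (Omega Z - A) \<partial>law Z x)"
      if t: "t < \<infinity>" and H: "H \<in> sets (hist Z t)" for t x H
    proof -
      note [measurable] = hm[OF H] sh[OF 3(1)]
      have [measurable]: "(\<lambda>\<omega>. emeasure (law Z (traj Z t \<omega>)) A) \<in> borel_measurable (law Z x)"
        using tm[of "\<lambda>z. emeasure (law Z z) A"] 3(2) by blast
      have "(\<integral>\<^sup>+\<omega>. indicator H \<omega> * indicator (Omega Z - A) (shift Z t \<omega>) \<partial>law Z x)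
          = (\<integral>\<^sup>+\<omega>. indicator H \<omega> - indicator H \<omega> * indicator A (shift Z t \<omega>) \<partial>law Z x)"
        by (intro nn_integral_cong) (auto simp: indicator_def shift_closed)
      also have "\<dots> = (\<integral>\<^sup>+\<omega>. indicator H \<omega> \<partial>law Z x) - (\<integral>\<^sup>+\<omega>. indicator H \<omega> * indicator A (shift Z t \<omega>) \<partial>law Z x)"
        by (rule nn_integral_diff[OF _ _ fin AE_I2]; (measurable)?) (simp_all add: indicator_def)
      also have "\<dots> = (\<integral>\<^sup>+\<omega>. indicator H \<omega> \<partial>law Z x) - (\<integral>\<^sup>+\<omega>. indicator H \<omega> * emeasure (law Z (traj Z t \<omega>)) A \<partial>law Z x)"
        by (simp only: conjunct2[OF 3(2), rule_format, OF t H])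
      also have "\<dots> = (\<integral>\<^sup>+\<omega>. indicator H \<omega> - indicator H \<omega> * emeasure (law Z (traj Z t \<omega>)) A \<partial>law Z x)"
        by (rule nn_integral_diff[OF _ _ fin AE_I2, symmetric]; (measurable)?) (simp_all add: indicator_def le)
      also have "\<dots> = (\<integral>\<^sup>+\<omega>. indicator H \<omega> * emeasure (law Z (traj Z t \<omega>)) (Omega Z - A) \<partial>law Z x)"
        by (intro nn_integral_cong) (auto simp: indicator_def eq)
      finally show ?thesis .
    qed
    moreover have "(\<lambda>z. emeasure (law Z z) (Omega Z - A)) \<in> borel_measurable borel_cem"
      unfolding eq by (intro borel_measurable_minus_ennreal borel_measurable_const conjunct1[OF 3(2)])
    ultimately show ?case by blast
  next
    case (4 A)
    have un: "emeasure (law Z z) (\<Union> (range A)) = (\<Sum>i. emeasure (law Z z) (A i))" for z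
      by (rule suminf_emeasure[symmetric, OF _ 4(1)]) (use 4(2) ev in blast)
    have ind: "indicator (\<Union> (range A)) \<omega> = (\<Sum>i. indicator (A i) \<omega> :: ennreal)" for \<omega>
      by (rule suminf_indicator[OF 4(1), symmetric])
    have "(\<integral>\<^sup>+\<omega>. indicator H \<omega> * indicator (\<Union> (range A)) (shift Z t \<omega>) \<partial>law Z x)
        = (\<integral>\<^sup>+\<omega>. indicator H \<omega> * emeasure (law Z (traj Z t \<omega>)) (\<Union> (range A)) \<partial>law Z x)"
      if t: "t < \<infinity>" and H: "H \<in> sets (hist Z t)" for t x H
    proof -
      note [measurable] = hm[OF H]
      have [measurable]: "(\<lambda>\<omega>. indicator (A i) (shift Z t \<omega>) :: ennreal) \<in> borel_measurable (law Z x)" for i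
        by (rule sh) (use 4(2) in blast)
      have [measurable]: "(\<lambda>\<omega>. emeasure (law Z (traj Z t \<omega>)) (A i)) \<in> borel_measurable (law Z x)" for i
        using tm[of "\<lambda>z. emeasure (law Z z) (A i)"] 4(3) by blast
      show ?thesis
        unfolding un ind ennreal_suminf_cmult[symmetric]
        by (subst (1 2) nn_integral_suminf)
          (measurable, simp only: conjunct2[OF 4(3), rule_format, OF t H])
    qed
    moreover have "(\<lambda>z. emeasure (law Z z) (\<Union> (range A))) \<in> borel_measurable borel_cem"
      unfolding un by (intro borel_measurable_suminf_order conjunct1[OF 4(3)])
    ultimately show ?case by blast
  qed
qed

lemma measurable_natural_events: "f \<in> natural \<rightarrow>\<^sub>M N \<Longrightarrow> f \<in> events Z \<rightarrow>\<^sub>M N"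
  using natural_sets_events[of \<infinity>] sets_natural by (auto simp: measurable_def)

text \<open>Monotone approximation by simple functions. For a single event,
  \<open>nn_integral_mult_subalgebra_cong\<close> restores general weights from the indicator
  weights of \<open>markov_event\<close>.\<close>

lemma markov_natural:
  assumes C: "C \<in> borel_measurable natural" and t: "t < \<infinity>"
    and \<Phi>: "\<Phi> \<in> borel_measurable (hist Z t)"
  shows "(\<lambda>z. \<integral>\<^sup>+\<omega>. C \<omega> \<partial>law Z z) \<in> borel_measurable borel_cem \<and>
    (\<integral>\<^sup>+\<omega>. \<Phi> \<omega> * C (shift Z t \<omega>) \<partial>law Z x)
      = (\<integral>\<^sup>+\<omega>. \<Phi> \<omega> * (\<integral>\<^sup>+\<omega>'. C \<omega>' \<partial>law Z (traj Z t \<omega>)) \<partial>law Z x)"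
  using C
proof (induction rule: borel_measurable_induct)
  have \<Phi>': "\<Phi> \<in> borel_measurable (law Z x)"
    using measurable_hist_events[OF \<Phi>] by (simp add: measurable_law_cong)
  have nat: "f \<in> borel_measurable (law Z z)" if "f \<in> borel_measurable natural" for f :: "'w \<Rightarrow> ennreal" and z
    using measurable_natural_events[OF that] by (simp add: measurable_law_cong)
  have sh: "(\<lambda>\<omega>. f (shift Z t \<omega>)) \<in> borel_measurable (law Z z)"
    if "f \<in> borel_measurable natural" for f :: "'w \<Rightarrow> ennreal" and z
    unfolding measurable_law_cong using measurable_compose[OF measurable_shift_natural that] .
  have tr: "(\<lambda>\<omega>. f (traj Z t \<omega>)) \<in> borel_measurable (law Z z)"
    if "f \<in> borel_measurable borel_cem" for f :: "_ \<Rightarrow> ennreal" and z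
    using measurable_compose[OF measurable_traj_law that] .
  {
    case (cong f g)
    have "(\<integral>\<^sup>+\<omega>. f \<omega> \<partial>law Z z) = (\<integral>\<^sup>+\<omega>. g \<omega> \<partial>law Z z)" for z
      using cong(3) by (intro nn_integral_cong) simp
    moreover have "(\<integral>\<^sup>+\<omega>. \<Phi> \<omega> * f (shift Z t \<omega>) \<partial>law Z x) = (\<integral>\<^sup>+\<omega>. \<Phi> \<omega> * g (shift Z t \<omega>) \<partial>law Z x)"
      using cong(3) shift_closed by (intro nn_integral_cong) simp
    ultimately show ?case using cong(4) by simp
  next
    case (set B)
    then have B: "B \<in> natural_sets Z \<infinity>" by (simp only: sets_natural)
    have i: "(\<integral>\<^sup>+\<omega>. indicator B \<omega> \<partial>law Z z) = emeasure (law Z z) B" for z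
      using B natural_sets_events law_sets by (intro nn_integral_indicator) blast
    note ev = markov_event[OF B]
    have "(\<integral>\<^sup>+\<omega>. \<Phi> \<omega> * indicator B (shift Z t \<omega>) \<partial>law Z x)
        = (\<integral>\<^sup>+\<omega>. \<Phi> \<omega> * emeasure (law Z (traj Z t \<omega>)) B \<partial>law Z x)"
    proof (rule nn_integral_mult_subalgebra_cong[OF law_prob subalgebra_hist[of _ t] _ _ \<Phi>])
      show "(\<lambda>\<omega>. indicator B (shift Z t \<omega>) :: ennreal) \<in> borel_measurable (law Z x)"
        using set by (intro sh borel_measurable_indicator)
      show "(\<lambda>\<omega>. emeasure (law Z (traj Z t \<omega>)) B) \<in> borel_measurable (hist Z t)"
        using measurable_compose[OF adapted conjunct1[OF ev]] .
    qed (rule conjunct2[OF ev, rule_format, OF t])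
    then show ?case using conjunct1[OF ev] by (simp only: i)
  next
    case (mult u c)
    have "(\<integral>\<^sup>+\<omega>. c * u \<omega> \<partial>law Z z) = c * (\<integral>\<^sup>+\<omega>. u \<omega> \<partial>law Z z)" for z
      using nat[OF mult(2)] by (rule nn_integral_cmult)
    with conjunct1[OF mult.IH] conjunct2[OF mult.IH] \<Phi>' sh[OF mult(2), of x] tr[OF conjunct1[OF mult.IH], of x]
    show ?case
      by (simp add: nn_integral_cmult mult.left_commute[of _ c])
  next
    case (add u v)
    have "(\<integral>\<^sup>+\<omega>. u \<omega> + v \<omega> \<partial>law Z z) = (\<integral>\<^sup>+\<omega>. u \<omega> \<partial>law Z z) + (\<integral>\<^sup>+\<omega>. v \<omega> \<partial>law Z z)" for z
      using nat[OF add(1)] nat[OF add(3)] by (intro nn_integral_add)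
    with \<Phi>' sh[OF add(1), of x] tr[OF conjunct1[OF add.IH(1)], of x] sh[OF add(3), of x] tr[OF conjunct1[OF add.IH(2)], of x]
      conjunct1[OF add.IH(1)] conjunct2[OF add.IH(1)] conjunct1[OF add.IH(2)] conjunct2[OF add.IH(2)]
    show ?case
      by (simp add: nn_integral_add distrib_left add.commute)
  next
    case (seq U)
    have mono: "U i \<omega> \<le> U j \<omega>" if "i \<le> j" for i j \<omega>
      using seq(3) that by (auto simp: incseq_def le_fun_def)
    have un: "(\<integral>\<^sup>+\<omega>. (SUP i. U i) \<omega> \<partial>law Z z) = (SUP i. \<integral>\<^sup>+\<omega>. U i \<omega> \<partial>law Z z)" for z
      using nn_integral_monotone_convergence_SUP[OF seq(3) nat[OF seq(1)], of z]
      by (simp add: image_comp)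
    have "(\<integral>\<^sup>+\<omega>. \<Phi> \<omega> * (SUP i. U i) (shift Z t \<omega>) \<partial>law Z x)
        = (\<integral>\<^sup>+\<omega>. (SUP i. \<Phi> \<omega> * U i (shift Z t \<omega>)) \<partial>law Z x)"
      by (simp add: SUP_mult_left_ennreal image_comp)
    also have "\<dots> = (SUP i. \<integral>\<^sup>+\<omega>. \<Phi> \<omega> * U i (shift Z t \<omega>) \<partial>law Z x)"
      using mono by (intro nn_integral_monotone_convergence_SUP borel_measurable_times_ennreal \<Phi>' sh seq(1))
        (auto simp: incseq_def le_fun_def intro!: mult_left_mono)
    also have "\<dots> = (SUP i. \<integral>\<^sup>+\<omega>. \<Phi> \<omega> * (\<integral>\<^sup>+\<omega>'. U i \<omega>' \<partial>law Z (traj Z t \<omega>)) \<partial>law Z x)"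
      by (simp only: conjunct2[OF seq.IH])
    also have "\<dots> = (\<integral>\<^sup>+\<omega>. (SUP i. \<Phi> \<omega> * (\<integral>\<^sup>+\<omega>'. U i \<omega>' \<partial>law Z (traj Z t \<omega>))) \<partial>law Z x)"
      using mono by (intro nn_integral_monotone_convergence_SUP[symmetric] borel_measurable_times_ennreal \<Phi>'
          tr[OF conjunct1[OF seq.IH]])
        (auto simp: incseq_def le_fun_def intro!: mult_left_mono nn_integral_mono)
    also have "\<dots> = (\<integral>\<^sup>+\<omega>. \<Phi> \<omega> * (\<integral>\<^sup>+\<omega>'. (SUP i. U i) \<omega>' \<partial>law Z (traj Z t \<omega>)) \<partial>law Z x)"
      by (simp only: un SUP_mult_left_ennreal)
    finally have "(\<integral>\<^sup>+\<omega>. \<Phi> \<omega> * (SUP i. U i) (shift Z t \<omega>) \<partial>law Z x)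
        = (\<integral>\<^sup>+\<omega>. \<Phi> \<omega> * (\<integral>\<^sup>+\<omega>'. (SUP i. U i) \<omega>' \<partial>law Z (traj Z t \<omega>)) \<partial>law Z x)" .
    moreover have "(\<lambda>z. \<integral>\<^sup>+\<omega>. (SUP i. U i) \<omega> \<partial>law Z z) \<in> borel_measurable borel_cem"
      unfolding un using conjunct1[OF seq.IH] by (intro borel_measurable_SUP) simp_all
    ultimately show ?case unfolding seq(5) by blast
  }
qed

section \<open>Completion of the natural filtration\<close>

lemma completed_in_space: "completed_in Z \<N> \<B> \<subseteq> Pow (Omega Z)"
  by (auto simp: completed_in_def)

lemma completed_in_mono:
  "\<N> \<subseteq> \<N>' \<Longrightarrow> \<B> \<subseteq> \<B>' \<Longrightarrow> completed_in Z \<N> \<B> \<subseteq> completed_in Z \<N>' \<B>'"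
  unfolding completed_in_def by blast

lemma space_natural_filtration [simp]: "space (natural_filtration Z t) = Omega Z"
  using completed_in_space by (simp add: natural_filtration_def space_measure_of)

lemma sets_natural_filtration:
  "sets (natural_filtration Z t)
    = sigma_sets (Omega Z) (completed_in Z (natural_sets Z \<infinity>) (natural_sets Z t))"
  unfolding natural_filtration_def using completed_in_space by (rule sets_measure_of)

lemma natural_sets_mono: "s \<le> t \<Longrightarrow> natural_sets Z s \<subseteq> natural_sets Z t"
  unfolding natural_sets_def by (rule sigma_sets_mono') (blast intro: order_trans)

lemma natural_sets_subset_filtration: "natural_sets Z \<infinity> \<subseteq> sets (natural_filtration Z \<infinity>)"
proof
  fix C assume C: "C \<in> natural_sets Z \<infinity>"
  have e: "{} \<in> natural_sets Z \<infinity>"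
    unfolding natural_sets_def by (rule sigma_sets.Empty)
  have "C \<in> completed_in Z (natural_sets Z \<infinity>) (natural_sets Z \<infinity>)"
    using C natural_sets_space[of \<infinity>] unfolding completed_in_def
    by (intro CollectI conjI allI impI bexI[OF _ C] bexI[OF _ e]) auto
  then show "C \<in> sets (natural_filtration Z \<infinity>)"
    unfolding sets_natural_filtration by (rule sigma_sets.Basic)
qed

lemma measurable_natural_filtration:
  "f \<in> natural_filtration Z t \<rightarrow>\<^sub>M N \<Longrightarrow> f \<in> natural_filtration Z \<infinity> \<rightarrow>\<^sub>M N"
proof -
  have "sets (natural_filtration Z t) \<subseteq> sets (natural_filtration Z \<infinity>)"
    unfolding sets_natural_filtration
    by (intro sigma_sets_mono' completed_in_mono natural_sets_mono) auto
  then show "f \<in> natural_filtration Z t \<rightarrow>\<^sub>M N \<Longrightarrow> f \<in> natural_filtration Z \<infinity> \<rightarrow>\<^sub>M N"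
    by (auto simp: measurable_def)
qed

lemma measurable_traj_natural_filtration: "traj Z s \<in> natural_filtration Z \<infinity> \<rightarrow>\<^sub>M borel_cem"
  using measurable_traj_natural[of s] natural_sets_subset_filtration sets_natural
  by (auto simp: measurable_def)

text \<open>Applied to the law of \<open>X\<^sub>t\<close>, the definition of \<^const>\<open>completed_in\<close> says that a completed set is
  measurable for the completion of the image of \<open>P\<^sub>x\<close> under the shift.\<close>

lemma markov_natural_filtration:
  assumes C: "C \<in> borel_measurable (natural_filtration Z \<infinity>)" and t: "t < \<infinity>"
    and \<Phi>: "\<Phi> \<in> borel_measurable (hist Z t)"
  shows "(\<integral>\<^sup>+\<omega>. \<Phi> \<omega> * C (shift Z t \<omega>) \<partial>law Z x)
      = (\<integral>\<^sup>+\<omega>. \<Phi> \<omega> * (\<integral>\<^sup>+\<omega>'. C \<omega>' \<partial>law Z (traj Z t \<omega>)) \<partial>law Z x)"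
proof -
  let ?M = "distr (law Z x) natural (shift Z t)"
  have sh: "shift Z t \<in> law Z x \<rightarrow>\<^sub>M natural"
    using measurable_shift_natural by (simp add: measurable_law_cong)
  have null: "emeasure ?M N = (\<integral>\<^sup>+\<omega>. emeasure (law Z (traj Z t \<omega>)) N \<partial>law Z x)"
    if N: "N \<in> natural_sets Z \<infinity>" for N
  proof -
    have N': "N \<in> sets natural" using N by (simp only: sets_natural)
    have "emeasure ?M N = (\<integral>\<^sup>+\<omega>. indicator N \<omega> \<partial>?M)"
      using N' by simp
    also have "\<dots> = (\<integral>\<^sup>+\<omega>. indicator N (shift Z t \<omega>) \<partial>law Z x)"
      using N' by (intro nn_integral_distr sh) simp
    also have "\<dots> = (\<integral>\<^sup>+\<omega>. indicator (Omega Z) \<omega> * indicator N (shift Z t \<omega>) \<partial>law Z x)"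
      by (intro nn_integral_cong) simp
    also have "\<dots> = (\<integral>\<^sup>+\<omega>. indicator (Omega Z) \<omega> * emeasure (law Z (traj Z t \<omega>)) N \<partial>law Z x)"
      using sets.top[of "hist Z t"] by (intro conjunct2[OF markov_event[OF N], rule_format, OF t]) simp
    also have "\<dots> = (\<integral>\<^sup>+\<omega>. emeasure (law Z (traj Z t \<omega>)) N \<partial>law Z x)"
      by (intro nn_integral_cong) simp
    finally show ?thesis .
  qed
  have "sets (natural_filtration Z \<infinity>) \<subseteq> sets (completion ?M)"
  proof -
    have "\<Gamma> \<in> sets (completion ?M)" if \<Gamma>: "\<Gamma> \<in> completed_in Z (natural_sets Z \<infinity>) (natural_sets Z \<infinity>)" for \<Gamma>
    proof -
      let ?\<nu> = "distr (law Z x) borel_cem (traj Z t)"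
      have "sets ?\<nu> = sets borel_cem \<and> finite_measure ?\<nu>"
        using prob_space.prob_space_distr[OF law_prob measurable_traj_law]
        by (simp add: prob_space.finite_measure)
      then have "\<exists>B\<in>natural_sets Z \<infinity>. \<exists>N\<in>natural_sets Z \<infinity>.
          (\<Gamma> - B) \<union> (B - \<Gamma>) \<subseteq> N \<and> (AE y in ?\<nu>. emeasure (law Z y) N = 0)"
        using \<Gamma> unfolding completed_in_def by blast
      then obtain B N where BN: "B \<in> natural_sets Z \<infinity>" "N \<in> natural_sets Z \<infinity>"
        "(\<Gamma> - B) \<union> (B - \<Gamma>) \<subseteq> N" and ae: "AE y in ?\<nu>. emeasure (law Z y) N = 0"
        by blast
      have "AE \<omega> in law Z x. emeasure (law Z (traj Z t \<omega>)) N = 0"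
        using AE_distrD[OF measurable_traj_law ae] .
      then have "emeasure ?M N = 0"
        unfolding null[OF BN(2)] by (simp add: nn_integral_0_iff_AE nn_integral_cong_AE)
      then have N: "N \<in> null_sets ?M"
        using BN(2) by (simp add: null_sets_def sets_natural)
      have B: "B \<in> sets ?M" using BN(1) by (simp add: sets_natural)
      have "\<Gamma> = (B - N) \<union> (\<Gamma> \<inter> N)" using BN(3) by blast
      then show ?thesis
        using sets_completionI[of \<Gamma> "B - N" "\<Gamma> \<inter> N" N ?M] N B by (auto intro: sets.Diff null_setsD2)
    qed
    then show ?thesis
      unfolding sets_natural_filtration
      using sets.sigma_sets_subset[of "completed_in Z (natural_sets Z \<infinity>) (natural_sets Z \<infinity>)" "completion ?M"]
      by (auto simp: subset_eq)
  qed
  then have "C \<in> borel_measurable (completion ?M)"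
    using C by (auto simp: measurable_def)
  then obtain C' where C': "C' \<in> borel_measurable ?M" and ae: "AE \<omega> in ?M. C \<omega> = C' \<omega>"
    using completion_ex_borel_measurable by blast
  then have C'n: "C' \<in> borel_measurable natural" by simp
  obtain N where N: "{\<omega> \<in> space ?M. C \<omega> \<noteq> C' \<omega>} \<subseteq> N" "emeasure ?M N = 0" "N \<in> sets ?M"
    using ae by (rule AE_E)
  then have Nn: "N \<in> natural_sets Z \<infinity>" by (simp add: sets_natural)
  have "(\<integral>\<^sup>+\<omega>. emeasure (law Z (traj Z t \<omega>)) N \<partial>law Z x) = 0"
    using null[OF Nn] N(2) by simp
  \<comment> \<open>It is not enough that the exceptional set \<open>N\<close> is null for the image
    measure: the inner integrals of \<open>C\<close> and \<open>C'\<close> agree because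
    \<open>N\<close> is null under almost every law started from the position at time
    \<open>t\<close>.\<close>
  then have aeN: "AE \<omega> in law Z x. emeasure (law Z (traj Z t \<omega>)) N = 0"
    using measurable_compose[OF measurable_traj_law conjunct1[OF markov_event[OF Nn]]]
    by (subst (asm) nn_integral_0_iff_AE) auto
  have "(\<integral>\<^sup>+\<omega>. \<Phi> \<omega> * C (shift Z t \<omega>) \<partial>law Z x) = (\<integral>\<^sup>+\<omega>. \<Phi> \<omega> * C' (shift Z t \<omega>) \<partial>law Z x)"
    using AE_distrD[OF sh ae] by (intro nn_integral_cong_AE) auto
  also have "\<dots> = (\<integral>\<^sup>+\<omega>. \<Phi> \<omega> * (\<integral>\<^sup>+\<omega>'. C' \<omega>' \<partial>law Z (traj Z t \<omega>)) \<partial>law Z x)"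
    by (rule conjunct2[OF markov_natural[OF C'n t \<Phi>]])
  also have "\<dots> = (\<integral>\<^sup>+\<omega>. \<Phi> \<omega> * (\<integral>\<^sup>+\<omega>'. C \<omega>' \<partial>law Z (traj Z t \<omega>)) \<partial>law Z x)"
  proof (rule nn_integral_cong_AE, rule eventually_mono[OF aeN])
    fix \<omega> assume "emeasure (law Z (traj Z t \<omega>)) N = 0"
    moreover have "N \<in> sets (law Z (traj Z t \<omega>))"
      using Nn natural_sets_events law_sets by blast
    ultimately have "AE \<omega>' in law Z (traj Z t \<omega>). C' \<omega>' = C \<omega>'"
      using N(1) by (intro AE_I[of _ _ N]) auto
    then show "\<Phi> \<omega> * (\<integral>\<^sup>+\<omega>'. C' \<omega>' \<partial>law Z (traj Z t \<omega>)) = \<Phi> \<omega> * (\<integral>\<^sup>+\<omega>'. C \<omega>' \<partial>law Z (traj Z t \<omega>))"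
      by (intro arg_cong2[where f="(*)"] refl nn_integral_cong_AE)
  qed
  finally show ?thesis .
qed

end

text \<open>\<open>completed_in\<close> is monotone in both arguments and the history is complete
  relative to all events. This is what allows values of the additive functional to serve as weights
  in the Markov property.\<close>

lemma (in standard_process) measurable_natural_filtration_hist:
  assumes "t < \<infinity>" and "f \<in> natural_filtration Z t \<rightarrow>\<^sub>M N"
  shows "f \<in> hist Z t \<rightarrow>\<^sub>M N"
proof -
  have "completed_in Z (natural_sets Z \<infinity>) (natural_sets Z t) \<subseteq> completed_in Z (sets (events Z)) (sets (hist Z t))"
    by (intro completed_in_mono natural_sets_events natural_sets_hist)
  also have "\<dots> = sets (hist Z t)"
    using complete_filtration[OF assms(1)] by simp
  finally have "sigma_sets (space (hist Z t)) (completed_in Z (natural_sets Z \<infinity>) (natural_sets Z t)) \<subseteq> sets (hist Z t)"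
    by (rule sets.sigma_sets_subset)
  then have "sets (natural_filtration Z t) \<subseteq> sets (hist Z t)"
    by (simp add: sets_natural_filtration)
  then show ?thesis
    using assms(2) by (auto simp: measurable_def)
qed

section \<open>Bounded continuous clocks\<close>

text \<open>Models a path of an additive functional with finite total mass \<open>L\<close>.
  Extended by 0 to negative times, it defines a measure on the whole line that does not charge the
  nonpositive half.\<close>

locale bounded_clock =
  fixes F :: "real \<Rightarrow> real" and L :: real
  assumes F_mono: "s \<le> t \<Longrightarrow> F s \<le> F t"
    and F_continuous: "continuous_on UNIV F"
    and F_nonpos: "t \<le> 0 \<Longrightarrow> F t = 0"
    and F_lim: "(F \<longlongrightarrow> L) at_top"
begin

text \<open>The right-continuous inverse of the clock, meaningful for levels 0 \<le> t <
  \<open>L\<close>, where the set is nonempty and bounded below.\<close>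

definition inv_clock :: "real \<Rightarrow> real" where
  "inv_clock t = Inf {s. t < F s}"

abbreviation M :: "real measure" where
  "M \<equiv> interval_measure F"

lemma F_nonneg: "0 \<le> F t"
  using F_mono[of 0 t] F_nonpos[of t] F_nonpos[of 0] by (cases "t \<le> 0") auto

lemma F_le: "F t \<le> L"
  using F_lim by (rule tendsto_lowerbound) (auto simp: eventually_at_top_linorder intro!: exI[of _ t] F_mono)

lemma L_nonneg: "0 \<le> L"
  using F_nonneg F_le order_trans by blast

lemma F_exceeds: "t < L \<Longrightarrow> \<exists>s. t < F s"
  using order_tendstoD(1)[OF F_lim] eventually_happens'[of "at_top :: real filter"] by force

lemma F_isCont: "isCont F s"
  using F_continuous by (simp add: continuous_on_eq_continuous_at)

lemma F_right_continuous: "continuous (at_right s) F"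
  using F_isCont by (rule continuous_within_subset) simp

lemma F_measurable [measurable]: "F \<in> borel_measurable borel"
  using F_continuous by (rule borel_measurable_continuous_onI)

context
  fixes t assumes t: "0 \<le> t" "t < L"
begin

lemma inv_set: "{s. t < F s} \<noteq> {}" "bdd_below {s. t < F s}"
proof -
  show "{s. t < F s} \<noteq> {}" using F_exceeds t by auto
  show "bdd_below {s. t < F s}"
    using F_nonpos t by (intro bdd_belowI[of _ 0]) (metis linorder_not_le mem_Collect_eq less_eq_real_def order_less_le_trans)
qed

lemma inv_clock_nonneg: "0 \<le> inv_clock t"
  unfolding inv_clock_def using F_nonpos t
  by (intro cInf_greatest inv_set) (metis linorder_not_le mem_Collect_eq less_eq_real_def order_less_le_trans)

text \<open>Left continuity of \<open>F\<close> at \<open>s\<close> provides an earlier time at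
  which the level is already exceeded; hence the strict inequality.\<close>

lemma inv_clock_less: "t < F s \<Longrightarrow> inv_clock t < s"
proof -
  assume "t < F s"
  moreover have "(F \<longlongrightarrow> F s) (at_left s)"
    using F_isCont[of s] by (simp add: isCont_def filterlim_at_split)
  ultimately have "\<forall>\<^sub>F r in at_left s. t < F r"
    by (intro order_tendstoD(1))
  moreover have "\<forall>\<^sub>F r in at_left s. r < s"
    by (simp add: eventually_at_filter)
  ultimately have "\<exists>r. t < F r \<and> r < s"
    using eventually_happens'[OF trivial_limit_at_left_real] eventually_conj by blast
  then show "inv_clock t < s"
    unfolding inv_clock_def using inv_set(2) by (metis cInf_lower mem_Collect_eq order_le_less_trans)
qed

lemma F_inv_clock: "F (inv_clock t) = t"
proof (rule antisym)
  show "F (inv_clock t) \<le> t"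
    using inv_clock_less[of "inv_clock t"] by (meson less_irrefl not_le)
  have "(F \<longlongrightarrow> F (inv_clock t)) (at_right (inv_clock t))"
    using F_right_continuous by (simp add: continuous_within)
  moreover have "\<forall>\<^sub>F s in at_right (inv_clock t). t \<le> F s"
    unfolding eventually_at_right_field
  proof (intro exI[of _ "inv_clock t + 1"] conjI allI impI)
    fix s assume "inv_clock t < s" "s < inv_clock t + 1"
    then obtain r where "t < F r" "r < s"
      using cInf_lessD[OF inv_set(1), of s] by (auto simp: inv_clock_def)
    then show "t \<le> F s" using F_mono[of r s] by simp
  qed simp
  ultimately show "t \<le> F (inv_clock t)"
    by (rule tendsto_lowerbound) simp
qed

end

lemma inv_clock_mono: "mono_on {0..<L} inv_clock"
proof (rule mono_onI)
  fix s t assume *: "s \<in> {0..<L}" "t \<in> {0..<L}" "s \<le> t"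
  show "inv_clock s \<le> inv_clock t"
    unfolding inv_clock_def using * by (intro cInf_superset_mono inv_set) auto
qed

lemma inv_clock_measurable [measurable]: "inv_clock \<in> restrict_space lborel {0..<L} \<rightarrow>\<^sub>M borel"
  using borel_measurable_mono_on_fnc[OF inv_clock_mono]
  by (simp cong: measurable_cong_sets sets_restrict_space_cong)

lemma emeasure_Ioi: "emeasure M {x<..} = ennreal (L - F x)"
proof (rule LIMSEQ_unique)
  have "(\<lambda>n. emeasure M {x<..x + real n}) \<longlonglongrightarrow> emeasure M (\<Union>n. {x<..x + real n})"
    by (rule Lim_emeasure_incseq) (auto simp: incseq_def)
  also have "(\<Union>n. {x<..x + real n}) = {x<..}"
    by (auto intro: exI[of _ "nat \<lceil>_\<rceil>"]) (metis add.commute diff_le_eq real_arch_simple)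
  finally show "(\<lambda>n. emeasure M {x<..x + real n}) \<longlonglongrightarrow> emeasure M {x<..}" .
  have "filterlim (\<lambda>n. x + real n) at_top sequentially"
    by (intro filterlim_tendsto_add_at_top[OF tendsto_const] filterlim_real_sequentially)
  then have "(\<lambda>n. ennreal (F (x + real n) - F x)) \<longlonglongrightarrow> ennreal (L - F x)"
    by (intro tendsto_ennrealI tendsto_diff tendsto_const filterlim_compose[OF F_lim])
  then show "(\<lambda>n. emeasure M {x<..x + real n}) \<longlonglongrightarrow> ennreal (L - F x)"
    by (simp add: emeasure_interval_measure_Ioc F_mono F_right_continuous)
qed

text \<open>Change of variables by comparison on half-lines. The levels whose inverse exceeds
  \<open>x\<close> lie between the open and the closed interval from \<open>F x\<close> to
  \<open>L\<close>, and these have the same length.\<close>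

lemma interval_measure_eq_distr: "M = distr (restrict_space lborel {0..<L}) borel inv_clock"
proof (rule measure_eqI_lessThan)
  fix x
  let ?S = "{t \<in> {0..<L}. x < inv_clock t}"
  have S: "?S \<in> sets borel"
  proof -
    have "inv_clock -` {x<..} \<inter> space (restrict_space lborel {0..<L}) \<in> sets (restrict_space lborel {0..<L})"
      by (rule measurable_sets[OF inv_clock_measurable]) simp
    moreover have "inv_clock -` {x<..} \<inter> space (restrict_space lborel {0..<L}) = ?S"
      by (auto simp: space_restrict_space)
    ultimately show ?thesis by (auto simp: sets_restrict_space)
  qed
  have "{F x<..<L} \<subseteq> ?S"
  proof
    fix t assume t: "t \<in> {F x<..<L}"
    then have *: "0 \<le> t" "t < L" using F_nonneg[of x] by auto
    have "\<not> inv_clock t \<le> x"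
      using F_mono[of "inv_clock t" x] F_inv_clock[OF *] t by auto
    then show "t \<in> ?S" using * by auto
  qed
  then have "ennreal (L - F x) \<le> emeasure lborel ?S"
    using emeasure_mono[of "{F x<..<L}" ?S lborel] S F_le[of x] by simp
  moreover have "?S \<subseteq> {F x..L}"
  proof
    fix t assume "t \<in> ?S"
    then have "0 \<le> t" "t < L" "x < inv_clock t" by auto
    then have "\<not> t < F x" using inv_clock_less[of t x] by auto
    then show "t \<in> {F x..L}" using \<open>t < L\<close> by auto
  qed
  then have "emeasure lborel ?S \<le> ennreal (L - F x)"
    using emeasure_mono[of ?S "{F x..L}" lborel] F_le[of x] by simp
  ultimately have "emeasure lborel ?S = ennreal (L - F x)" by (rule antisym[rotated])
  moreover have "emeasure (distr (restrict_space lborel {0..<L}) borel inv_clock) {x<..} = emeasure lborel ?S"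
  proof -
    have "inv_clock -` {x<..} \<inter> space (restrict_space lborel {0..<L}) = ?S"
      by (auto simp: space_restrict_space)
    then show ?thesis
      by (simp add: emeasure_distr emeasure_restrict_space Collect_subset subset_eq)
  qed
  ultimately show "emeasure M {x<..} = emeasure (distr (restrict_space lborel {0..<L}) borel inv_clock) {x<..}"
    by (simp add: emeasure_Ioi)
qed (auto simp: emeasure_Ioi)

lemma nn_integral_clock:
  assumes [measurable]: "\<phi> \<in> borel_measurable borel"
  shows "(\<integral>\<^sup>+s. \<phi> s \<partial>M) = (\<integral>\<^sup>+t. \<phi> (inv_clock t) * indicator {0..<L} t \<partial>lborel)"
  by (subst interval_measure_eq_distr) (simp add: nn_integral_distr nn_integral_restrict_space)

lemma integral_clock:
  fixes \<phi> :: "real \<Rightarrow> real"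
  assumes [measurable]: "\<phi> \<in> borel_measurable borel"
  shows "(\<integral>s. \<phi> s \<partial>M) = (\<integral>t. indicator {0..<L} t * \<phi> (inv_clock t) \<partial>lborel)"
  by (subst interval_measure_eq_distr) (simp add: integral_distr integral_restrict_space)

lemma emeasure_clock: "emeasure M UNIV = ennreal L"
proof -
  have "emeasure M UNIV = (\<integral>\<^sup>+s. 1 \<partial>M)" by simp
  also have "\<dots> = ennreal L"
    using L_nonneg by (subst nn_integral_clock) simp_all
  finally show ?thesis .
qed

lemma finite_measure_clock: "finite_measure M"
  by (rule finite_measureI) (simp add: emeasure_clock)

lemma AE_clock_pos: "AE r in M. 0 < r"
proof -
  have "emeasure M {..0} = 0"
    using emeasure_Ioi[of 0] emeasure_clock emeasure_compl[of "{0<..}" M]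
    by (simp add: F_nonpos Compl_eq_Diff_UNIV[symmetric])
  then have "AE r in M. r \<notin> {..0}"
    by (intro AE_not_in) (simp add: null_sets_def)
  then show ?thesis by (rule eventually_mono) simp
qed

text \<open>The substitution t = \<open>F s\<close> turns the left side into the integral of
  exp(-\<alpha> t) over the levels up to \<open>F r\<close>.\<close>

lemma nn_integral_exp_clock:
  assumes "\<alpha> > 0"
  shows "(\<integral>\<^sup>+s. ennreal (exp (- \<alpha> * F s)) * indicator {..<r} s \<partial>M) = ennreal ((1 - exp (- \<alpha> * F r)) / \<alpha>)"
proof -
  have "(\<integral>\<^sup>+s. ennreal (exp (- \<alpha> * F s)) * indicator {..<r} s \<partial>M)
      = (\<integral>\<^sup>+t. ennreal (exp (- \<alpha> * F (inv_clock t))) * indicator {..<r} (inv_clock t) * indicator {0..<L} t \<partial>lborel)"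
    by (subst nn_integral_clock) simp_all
  also have "\<dots> = (\<integral>\<^sup>+t. ennreal (exp (- \<alpha> * t)) * indicator {0..F r} t \<partial>lborel)"
  proof (rule nn_integral_cong_AE)
    \<comment> \<open>The interval of levels is closed at \<open>F r\<close> for the sake of the
      fundamental theorem of calculus; the two integrands differ there, on a null set.\<close>
    have "AE t in lborel. t \<noteq> F r" by (rule AE_lborel_singleton)
    then show "AE t in lborel. ennreal (exp (- \<alpha> * F (inv_clock t))) * indicator {..<r} (inv_clock t) * indicator {0..<L} t
        = ennreal (exp (- \<alpha> * t)) * indicator {0..F r} t"
    proof (rule eventually_mono)
      fix t assume ne: "t \<noteq> F r"
      consider "0 \<le> t" "t < F r" | "0 \<le> t" "F r < t" "t < L" | "t < 0" | "t \<ge> L" "t > F r"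
        using ne F_le[of r] by linarith
      then show "ennreal (exp (- \<alpha> * F (inv_clock t))) * indicator {..<r} (inv_clock t) * indicator {0..<L} t
        = ennreal (exp (- \<alpha> * t)) * indicator {0..F r} t"
      proof cases
        case 1
        then have "t < L" using F_le[of r] by simp
        with 1 inv_clock_less[of t r] F_inv_clock[of t] show ?thesis by simp
      next
        case 2
        then have "\<not> inv_clock t < r" using F_mono[of "inv_clock t" r] F_inv_clock[of t] by auto
        with 2 show ?thesis by simp
      qed auto
    qed
  qed
  also have "\<dots> = ennreal (- exp (- \<alpha> * F r) / \<alpha> - (- exp (- \<alpha> * 0) / \<alpha>))"
    using assms F_nonneg[of r]
    by (intro nn_integral_FTC_Icc) (auto intro!: derivative_eq_intros)
  also have "\<dots> = ennreal ((1 - exp (- \<alpha> * F r)) / \<alpha>)"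
    by (simp add: diff_divide_distrib)
  finally show ?thesis .
qed

text \<open>The bound is independent of the total mass \<open>L\<close>; it is the pathwise reason
  why \<alpha> times the resolvent is a contraction.\<close>

lemma nn_integral_exp_clock_le:
  assumes "\<alpha> > 0"
  shows "(\<integral>\<^sup>+s. ennreal (exp (- \<alpha> * F s)) \<partial>M) \<le> ennreal (1 / \<alpha>)"
proof -
  have "(\<integral>\<^sup>+s. ennreal (exp (- \<alpha> * F s)) \<partial>M)
      = (\<integral>\<^sup>+t. ennreal (exp (- \<alpha> * F (inv_clock t))) * indicator {0..<L} t \<partial>lborel)"
    by (subst nn_integral_clock) simp_all
  also have "\<dots> \<le> (\<integral>\<^sup>+t. ennreal (exp (- \<alpha> * t)) * indicator {0..L} t \<partial>lborel)"
    by (intro nn_integral_mono) (auto simp: F_inv_clock split: split_indicator)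
  also have "\<dots> = ennreal (- exp (- \<alpha> * L) / \<alpha> - (- exp (- \<alpha> * 0) / \<alpha>))"
    using assms L_nonneg
    by (intro nn_integral_FTC_Icc) (auto intro!: derivative_eq_intros)
  also have "\<dots> \<le> ennreal (1 / \<alpha>)"
    using assms by (intro ennreal_leI) (simp add: field_simps)
  finally show ?thesis .
qed

end

section \<open>Riemann sums\<close>

text \<open>Right endpoints are used because only right continuity of the integrand is available.\<close>

definition riemann_sum :: "(real \<Rightarrow> ennreal) \<Rightarrow> (real \<Rightarrow> ennreal) \<Rightarrow> real \<Rightarrow> nat \<Rightarrow> ennreal" where
  "riemann_sum g a s n = (\<Sum>k. g (s + real (Suc k) / real (Suc n)) *
     (a (s + real (Suc k) / real (Suc n)) - a (s + real k / real (Suc n))))"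

text \<open>The step function whose integral against the clock measure is
  \<open>riemann_sum\<close>. Its measurability does not depend on \<open>g\<close>, as only
  countably many values of \<open>g\<close> enter.\<close>

definition step_approx :: "(real \<Rightarrow> ennreal) \<Rightarrow> real \<Rightarrow> nat \<Rightarrow> real \<Rightarrow> ennreal" where
  "step_approx g s n r = (\<Sum>k. g (s + real (Suc k) / real (Suc n)) *
     indicator {s + real k / real (Suc n)<..s + real (Suc k) / real (Suc n)} r)"

lemma step_approx_measurable [measurable]: "step_approx g s n \<in> borel_measurable borel"
  unfolding step_approx_def by measurable

lemma step_approx_eq:
  assumes "s < r"
  obtains c where "r \<le> c" "c < r + 1 / real (Suc n)" "step_approx g s n r = g c"
proof -
  define N where "N = real (Suc n)"
  have N: "N > 0" by (simp add: N_def)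
  \<comment> \<open>Cells are open on the left and closed on the right, so the cell of
    \<open>r\<close> has index ceiling minus one; at a grid point a floor would pick the next
    cell.\<close>
  define k where "k = nat (\<lceil>(r - s) * N\<rceil> - 1)"
  have pos: "(r - s) * N > 0" using assms N by simp
  then have "real_of_int \<lceil>(r - s) * N\<rceil> > 0" using le_of_int_ceiling[of "(r - s) * N"] by linarith
  then have ce: "\<lceil>(r - s) * N\<rceil> \<ge> 1" by linarith
  have k: "real k = real_of_int \<lceil>(r - s) * N\<rceil> - 1"
    using ce by (simp add: k_def)
  have k1: "real k < (r - s) * N" "(r - s) * N \<le> real k + 1"
    using k ceiling_correct[of "(r - s) * N"] by linarith+
  have in_iff: "r \<in> {s + real j / N<..s + real (Suc j) / N} \<longleftrightarrow> j = k" for j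
  proof -
    have "r \<in> {s + real j / N<..s + real (Suc j) / N} \<longleftrightarrow> real j < (r - s) * N \<and> (r - s) * N \<le> real j + 1"
      using N by (auto simp: field_simps)
    also have "\<dots> \<longleftrightarrow> j = k"
      using k1 by (auto simp: order_less_le_trans)
    finally show ?thesis .
  qed
  have "step_approx g s n r = (\<Sum>j. if j = k then g (s + real (Suc k) / N) else 0)"
    unfolding step_approx_def N_def[symmetric]
    by (intro suminf_cong) (simp only: indicator_def in_iff split: if_split, simp)
  also have "\<dots> = (\<Sum>j\<in>{k}. if j = k then g (s + real (Suc k) / N) else 0)"
    by (rule suminf_finite) auto
  finally have "step_approx g s n r = g (s + real (Suc k) / N)" by simp
  moreover have "r \<le> s + real (Suc k) / N" "s + real (Suc k) / N < r + 1 / N"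
  proof -
    have "real k / N < r - s" "r - s \<le> (real k + 1) / N"
      using k1 N by (simp_all add: divide_less_eq le_divide_eq)
    then show "r \<le> s + real (Suc k) / N" "s + real (Suc k) / N < r + 1 / N"
      by (simp_all add: add_divide_distrib)
  qed
  ultimately show thesis using that by (simp add: N_def)
qed

lemma step_approx_le: "s < r \<Longrightarrow> (\<And>c. g c \<le> K) \<Longrightarrow> step_approx g s n r \<le> K"
  by (metis step_approx_eq)

lemma step_approx_outside: "r \<le> s \<Longrightarrow> step_approx g s n r = 0"
proof -
  assume r: "r \<le> s"
  have "0 \<le> real k / real (Suc n)" for k by simp
  then have "r \<notin> {s + real k / real (Suc n)<..s + real (Suc k) / real (Suc n)}" for k
    using r by (smt (verit) greaterThanAtMost_iff)
  then show "step_approx g s n r = 0"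
    by (simp add: step_approx_def)
qed

lemma step_approx_tendsto:
  assumes "s < r" and g: "(g \<longlongrightarrow> g r) (at_right r)"
  shows "(\<lambda>n. step_approx g s n r) \<longlonglongrightarrow> g r"
proof -
  have "\<exists>c. r \<le> c \<and> c < r + 1 / real (Suc n) \<and> step_approx g s n r = g c" for n
    using step_approx_eq[OF assms(1)] by metis
  then obtain c where c: "\<And>n. r \<le> c n" "\<And>n. c n < r + 1 / real (Suc n)" "\<And>n. step_approx g s n r = g (c n)"
    by metis
  have "c \<longlonglongrightarrow> r"
  proof (rule real_tendsto_sandwich)
    show "\<forall>\<^sub>F n in sequentially. r \<le> c n" "\<forall>\<^sub>F n in sequentially. c n \<le> r + 1 / real (Suc n)"
      using c by (auto intro!: always_eventually less_imp_le)
    show "(\<lambda>n. r + 1 / real (Suc n)) \<longlonglongrightarrow> r"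
      using tendsto_add[OF tendsto_const[of r] lim_inverse_n'[THEN LIMSEQ_Suc]] by simp
  qed simp
  \<comment> \<open>The sample point \<open>c n\<close> may coincide with \<open>r\<close>, so the
    limit is taken within the closed half-line and not along \<open>at_right\<close>.\<close>
  have "continuous (at r within {r..}) g"
    using g by (simp add: continuous_within at_within_Ici_at_right)
  moreover have "\<forall>\<^sub>F n in sequentially. c n \<in> {r..}"
    using c by simp
  ultimately have "(\<lambda>n. g (c n)) \<longlonglongrightarrow> g r"
    using \<open>c \<longlonglongrightarrow> r\<close> by (rule continuous_within_tendsto_compose)
  then show ?thesis by (simp add: c)
qed

text \<open>Right continuity makes the function a pointwise limit of its step approximations. A grid
  has a first point, so this is done to the right of -m for every m first.\<close>

lemma right_continuous_borel_measurable:
  fixes g :: "real \<Rightarrow> ennreal"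
  assumes "\<And>r. (g \<longlongrightarrow> g r) (at_right r)"
  shows "g \<in> borel_measurable borel"
proof -
  have "(\<lambda>n. step_approx g (- real m) n r) \<longlonglongrightarrow> g r * indicator {- real m<..} r" for m r
    using step_approx_tendsto[OF _ assms, of "- real m" r] step_approx_outside[of r "- real m" g]
    by (cases "- real m < r") auto
  then have m: "(\<lambda>r. g r * indicator {- real m<..} r) \<in> borel_measurable borel" for m
    by (rule borel_measurable_LIMSEQ_order) simp
  have "(\<lambda>m. g r * indicator {- real m<..} r) \<longlonglongrightarrow> g r" for r
  proof (rule tendsto_eventually)
    obtain n where "- r < real n" using reals_Archimedean2 by blast
    then show "\<forall>\<^sub>F m in sequentially. g r * indicator {- real m<..} r = g r"
      by (intro eventually_sequentiallyI[of n]) auto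
  qed
  then show ?thesis
    using m by (rule borel_measurable_LIMSEQ_order)
qed

context bounded_clock
begin

lemma riemann_sum_eq:
  assumes "\<And>r. s \<le> r \<Longrightarrow> a r = ennreal (F r)"
  shows "riemann_sum g a s n = (\<integral>\<^sup>+r. step_approx g s n r \<partial>M)"
proof -
  have "(\<integral>\<^sup>+r. step_approx g s n r \<partial>M) = (\<Sum>k. \<integral>\<^sup>+r. g (s + real (Suc k) / real (Suc n)) *
      indicator {s + real k / real (Suc n)<..s + real (Suc k) / real (Suc n)} r \<partial>M)"
    unfolding step_approx_def by (intro nn_integral_suminf) measurable
  also have "\<dots> = riemann_sum g a s n"
    unfolding riemann_sum_def
  proof (intro suminf_cong)
    fix k
    have "s + real k / real (Suc n) \<le> s + real (Suc k) / real (Suc n)"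
      by (intro add_left_mono divide_right_mono) auto
    then show "(\<integral>\<^sup>+r. g (s + real (Suc k) / real (Suc n)) *
        indicator {s + real k / real (Suc n)<..s + real (Suc k) / real (Suc n)} r \<partial>M)
      = g (s + real (Suc k) / real (Suc n)) *
        (a (s + real (Suc k) / real (Suc n)) - a (s + real k / real (Suc n)))"
      using assms[of "s + real (Suc k) / real (Suc n)"] assms[of "s + real k / real (Suc n)"]
      by (simp add: nn_integral_cmult_indicator emeasure_interval_measure_Ioc F_mono
          F_right_continuous ennreal_minus F_nonneg del: of_nat_Suc)
  qed
  finally show ?thesis ..
qed

lemma riemann_sum_tendsto:
  assumes a: "\<And>r. s \<le> r \<Longrightarrow> a r = ennreal (F r)"
    and g: "\<And>r. (g \<longlongrightarrow> g r) (at_right r)" and K: "\<And>r. g r \<le> K" "K < \<infinity>"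
  shows "(\<lambda>n. riemann_sum g a s n) \<longlonglongrightarrow> (\<integral>\<^sup>+r. g r * indicator {s<..} r \<partial>M)"
proof (subst riemann_sum_eq, rule a, assumption,
    rule nn_integral_dominated_convergence[where w="\<lambda>_. K"])
  have [measurable]: "g \<in> borel_measurable borel"
    using g by (rule right_continuous_borel_measurable)
  show "(\<lambda>r. g r * indicator {s<..} r) \<in> borel_measurable M" by measurable
  show "AE r in M. step_approx g s j r \<le> K" for j
    using step_approx_le[of s _ g K] K step_approx_outside
    by (intro AE_I2) (metis linorder_not_le zero_le)
  show "(\<integral>\<^sup>+_. K \<partial>M) < \<infinity>"
    using K emeasure_clock by (simp add: ennreal_mult_less_top)
  show "AE r in M. (\<lambda>i. step_approx g s i r) \<longlonglongrightarrow> g r * indicator {s<..} r"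
  proof (intro AE_I2)
    fix r
    show "(\<lambda>i. step_approx g s i r) \<longlonglongrightarrow> g r * indicator {s<..} r"
      using step_approx_tendsto[OF _ g, of s r] step_approx_outside[of r s g]
      by (cases "s < r") auto
  qed
qed auto

text \<open>The exponential weight decreases, so its value at a right endpoint is at most its value
  anywhere in the cell. The resulting bound is uniform in \<open>n\<close> and in the total mass,
  which makes it a dominating function under the expectation.\<close>

lemma riemann_sum_exp_le:
  assumes "\<alpha> > 0" and "\<And>r. s \<le> r \<Longrightarrow> a r = ennreal (F r)"
    and h: "\<And>r. h r \<le> K"
  shows "riemann_sum (\<lambda>r. ennreal (exp (- \<alpha> * F r)) * h r) a s n \<le> K * ennreal (1 / \<alpha>)"
proof -
  have "riemann_sum (\<lambda>r. ennreal (exp (- \<alpha> * F r)) * h r) a s n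
      \<le> (\<integral>\<^sup>+r. K * ennreal (exp (- \<alpha> * F r)) \<partial>M)"
  proof (subst riemann_sum_eq, rule assms(2), assumption, rule nn_integral_mono)
    fix r
    show "step_approx (\<lambda>r. ennreal (exp (- \<alpha> * F r)) * h r) s n r \<le> K * ennreal (exp (- \<alpha> * F r))"
    proof (cases "s < r")
      case True
      then obtain c where c: "r \<le> c" "step_approx (\<lambda>r. ennreal (exp (- \<alpha> * F r)) * h r) s n r
          = ennreal (exp (- \<alpha> * F c)) * h c"
        by (rule step_approx_eq)
      have "exp (- \<alpha> * F c) \<le> exp (- \<alpha> * F r)"
        using F_mono[OF c(1)] assms(1) by simp
      then show ?thesis
        unfolding c(2) using h[of c] by (subst mult.commute) (intro mult_mono ennreal_leI, auto)
    qed (simp add: step_approx_outside)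
  qed
  also have "\<dots> = K * (\<integral>\<^sup>+r. ennreal (exp (- \<alpha> * F r)) \<partial>M)"
    by (rule nn_integral_cmult) simp
  also have "\<dots> \<le> K * ennreal (1 / \<alpha>)"
    using nn_integral_exp_clock_le[OF assms(1)] by (rule mult_left_mono) simp
  finally show ?thesis .
qed

text \<open>Makes the tail integral itself an admissible integrand for
  \<open>riemann_sum_tendsto\<close>.\<close>

lemma tail_right_continuous:
  assumes [measurable]: "g \<in> borel_measurable borel" and K: "\<And>r. g r \<le> K" "K < \<infinity>"
  shows "((\<lambda>s. \<integral>\<^sup>+r. g r * indicator {s<..} r \<partial>M) \<longlongrightarrow> (\<integral>\<^sup>+r. g r * indicator {s<..} r \<partial>M)) (at_right s)"
proof (rule tendsto_at_right_sequentially[of s "s + 1"])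
  fix S assume S: "\<And>n. s < S n" "S \<longlonglongrightarrow> s"
  show "(\<lambda>n. \<integral>\<^sup>+r. g r * indicator {S n<..} r \<partial>M) \<longlonglongrightarrow> (\<integral>\<^sup>+r. g r * indicator {s<..} r \<partial>M)"
  proof (rule nn_integral_dominated_convergence[where w="\<lambda>_. K"])
    show "AE r in M. g r * indicator {S j<..} r \<le> K" for j
      using K by (intro AE_I2) (auto simp: indicator_def)
    show "(\<integral>\<^sup>+_. K \<partial>M) < \<infinity>"
      using K emeasure_clock by (simp add: ennreal_mult_less_top)
    show "AE r in M. (\<lambda>i. g r * indicator {S i<..} r) \<longlonglongrightarrow> g r * indicator {s<..} r"
    proof (intro AE_I2 tendsto_eventually)
      fix r
      show "\<forall>\<^sub>F i in sequentially. g r * indicator {S i<..} r = g r * indicator {s<..} r"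
      proof (cases "s < r")
        case True
        then have "\<forall>\<^sub>F i in sequentially. S i < r"
          using S(2) by (intro order_tendstoD(2))
        then show ?thesis by (rule eventually_mono) (use True in auto)
      next
        case False
        then show ?thesis using S(1) by (intro always_eventually allI) (auto simp: indicator_def dest: order_less_trans)
      qed
    qed
  qed auto
qed simp

text \<open>The pathwise form of the resolvent identity: exchange the order of integration over s <
  r; the inner integral of \<alpha> exp(-\<alpha> F) up to \<open>r\<close> equals 1 - exp(-\<alpha>
  \<open>F r\<close>) by \<open>nn_integral_exp_clock\<close>.\<close>

lemma nn_integral_exp_tail:
  assumes "\<alpha> > 0" and [measurable]: "g \<in> borel_measurable borel"
  shows "ennreal \<alpha> * (\<integral>\<^sup>+s. ennreal (exp (- \<alpha> * F s)) * (\<integral>\<^sup>+r. g r * indicator {s<..} r \<partial>M) \<partial>M)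
    + (\<integral>\<^sup>+s. ennreal (exp (- \<alpha> * F s)) * g s \<partial>M) = (\<integral>\<^sup>+s. g s \<partial>M)"
proof -
  interpret finite_measure M by (rule finite_measure_clock)
  interpret pair_sigma_finite M M by unfold_locales
  have [measurable_cong]: "sets (M \<Otimes>\<^sub>M M) = sets (borel \<Otimes>\<^sub>M borel)"
    by (intro sets_pair_measure_cong) simp_all
  have "(\<integral>\<^sup>+s. ennreal (exp (- \<alpha> * F s)) * (\<integral>\<^sup>+r. g r * indicator {s<..} r \<partial>M) \<partial>M)
      = (\<integral>\<^sup>+s. \<integral>\<^sup>+r. ennreal (exp (- \<alpha> * F s)) * (g r * (if s < r then 1 else 0)) \<partial>M \<partial>M)"
    by (intro nn_integral_cong, subst nn_integral_cmult[symmetric]) (auto simp: indicator_def intro!: nn_integral_cong)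
  also have "\<dots> = (\<integral>\<^sup>+r. \<integral>\<^sup>+s. ennreal (exp (- \<alpha> * F s)) * (g r * (if s < r then 1 else 0)) \<partial>M \<partial>M)"
    by (rule Fubini') measurable
  also have "\<dots> = (\<integral>\<^sup>+r. g r * (\<integral>\<^sup>+s. ennreal (exp (- \<alpha> * F s)) * indicator {..<r} s \<partial>M) \<partial>M)"
    by (intro nn_integral_cong, subst nn_integral_cmult[symmetric])
      (auto simp: indicator_def mult_ac intro!: nn_integral_cong)
  also have "\<dots> = (\<integral>\<^sup>+r. g r * ennreal ((1 - exp (- \<alpha> * F r)) / \<alpha>) \<partial>M)"
    by (simp only: nn_integral_exp_clock[OF assms(1)])
  finally have eq: "(\<integral>\<^sup>+s. ennreal (exp (- \<alpha> * F s)) * (\<integral>\<^sup>+r. g r * indicator {s<..} r \<partial>M) \<partial>M)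
    = (\<integral>\<^sup>+r. g r * ennreal ((1 - exp (- \<alpha> * F r)) / \<alpha>) \<partial>M)" .
  have pw: "ennreal \<alpha> * (g r * ennreal ((1 - exp (- \<alpha> * F r)) / \<alpha>)) + ennreal (exp (- \<alpha> * F r)) * g r = g r" for r
  proof -
    have e: "exp (- \<alpha> * F r) \<le> 1" using assms(1) F_nonneg[of r] by simp
    have "ennreal \<alpha> * (g r * ennreal ((1 - exp (- \<alpha> * F r)) / \<alpha>)) + ennreal (exp (- \<alpha> * F r)) * g r
      = g r * (ennreal \<alpha> * ennreal ((1 - exp (- \<alpha> * F r)) / \<alpha>) + ennreal (exp (- \<alpha> * F r)))"
      by (simp add: distrib_left mult_ac)
    also have "ennreal \<alpha> * ennreal ((1 - exp (- \<alpha> * F r)) / \<alpha>) + ennreal (exp (- \<alpha> * F r)) = 1"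
      using assms(1) e by (simp add: ennreal_mult'[symmetric] flip: ennreal_plus)
    finally show ?thesis by simp
  qed
  show ?thesis
    unfolding eq
    by (subst nn_integral_cmult[symmetric], measurable, subst nn_integral_add[symmetric], measurable)
      (simp only: pw)
qed

end

section \<open>Time change of a path\<close>

text \<open>The same kind of path in the form used by \<open>pcaf\<close>, with time and values in
  [0,\<infinity>]. Here \<open>S\<close> is any real bound; the exact mass is
  \<open>total\<close>.\<close>

locale finite_clock =
  fixes a :: "ennreal \<Rightarrow> ennreal" and S :: real
  assumes a_0: "a 0 = 0"
    and a_mono: "s \<le> t \<Longrightarrow> t < \<infinity> \<Longrightarrow> a s \<le> a t"
    and a_continuous: "continuous_on {t. t < \<infinity>} a"
    and a_bounded: "t < \<infinity> \<Longrightarrow> a t \<le> ennreal S"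
begin

definition clock :: "real \<Rightarrow> real" where
  "clock t = enn2real (a (ennreal t))"

lemma ennreal_clock: "ennreal (clock t) = a (ennreal t)"
  unfolding clock_def using a_bounded[of "ennreal t"]
  by (intro ennreal_enn2real) (auto simp: less_top[symmetric] top_unique)

lemma a_continuous_real: "continuous_on UNIV (\<lambda>t. a (ennreal t))"
  by (rule continuous_on_compose2[OF a_continuous continuous_on_ennreal[OF continuous_on_id]]) auto

lemma clock_mono: "s \<le> t \<Longrightarrow> clock s \<le> clock t"
  unfolding clock_def
  by (intro enn2real_mono a_mono ennreal_leI) (auto intro: le_less_trans[OF a_bounded])

lemma min_clock_continuous: "continuous_on UNIV (\<lambda>t. enn2real (min c (a (ennreal t))))"
proof -
  have fin: "min c (a (ennreal t)) \<noteq> \<top>" for t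
    using a_bounded[of "ennreal t"] by (auto simp: min_def top_unique)
  have "continuous_on UNIV (\<lambda>t. min c (a (ennreal t)))"
    by (intro continuous_on_min continuous_on_const a_continuous_real)
  then show ?thesis
    unfolding continuous_on_eq_continuous_at[OF open_UNIV] isCont_def
    using fin by (intro ballI tendsto_enn2real) (auto simp: ennreal_enn2real_if)
qed

lemma clock_continuous: "continuous_on UNIV clock"
  using min_clock_continuous[of \<top>] by (simp add: clock_def[abs_def] min_def top_unique)

lemma clock_nonpos: "t \<le> 0 \<Longrightarrow> clock t = 0"
  by (simp add: clock_def ennreal_neg a_0)

lemma clock_le: "clock t \<le> max 0 S"
  using a_bounded[of "ennreal t"] by (auto simp: clock_def intro!: enn2real_leI simp: max_def ennreal_neg)

definition total :: real where
  "total = (SUP t. clock t)"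

sublocale bounded_clock clock total
proof
  have bdd: "bdd_above (range clock)"
    using clock_le by (intro bdd_aboveI[of _ "max 0 S"]) auto
  show "(clock \<longlongrightarrow> total) at_top"
    unfolding total_def
  proof (rule order_tendstoI)
    fix x assume "x < (SUP t. clock t)"
    then obtain t where "x < clock t" using bdd by (auto simp: less_cSUP_iff)
    then show "\<forall>\<^sub>F s in at_top. x < clock s"
      using clock_mono by (intro eventually_at_top_linorderI[of t]) (meson order_less_le_trans)
  next
    fix x assume "(SUP t. clock t) < x"
    then show "\<forall>\<^sub>F s in at_top. clock s < x"
      using bdd by (intro always_eventually allI) (meson cSUP_upper UNIV_I order_le_less_trans)
  qed
qed (auto intro: clock_mono clock_continuous clock_nonpos)

lemma min_clock: "enn2real (min (of_nat n) (a (ennreal t))) = min (real n) (clock t)"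
  unfolding ennreal_clock[symmetric] ennreal_of_nat_eq_real_of_nat
  by (simp add: min_def F_nonneg)

lemma bounded_clock_min: "bounded_clock (\<lambda>t. min (real n) (clock t)) (min (real n) total)"
proof
  show "min (real n) (clock s) \<le> min (real n) (clock t)" if "s \<le> t" for s t
    using F_mono[OF that] by (rule min.mono[OF order_refl])
  show "continuous_on UNIV (\<lambda>t. min (real n) (clock t))"
    by (intro continuous_on_min continuous_on_const clock_continuous)
  show "min (real n) (clock t) = 0" if "t \<le> 0" for t
    using F_nonpos[OF that] by simp
  show "((\<lambda>t. min (real n) (clock t)) \<longlongrightarrow> min (real n) total) at_top"
    by (intro tendsto_min tendsto_const F_lim)
qed

text \<open>In the level variable the truncation at n merely removes the levels from n on: below n
  the truncated clock has the same inverse. For n beyond \<open>total\<close> nothing is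
  removed.\<close>

lemma stieltjes_eq:
  assumes [measurable]: "\<phi> \<in> borel_measurable borel"
  shows "stieltjes a \<phi> = (\<integral>\<^sup>+t. \<phi> t \<partial>M)"
proof -
  have n: "(\<integral>\<^sup>+t. \<phi> t \<partial>interval_measure (\<lambda>t. enn2real (min (of_nat n) (a (ennreal t)))))
      = (\<integral>\<^sup>+t. \<phi> (inv_clock t) * indicator {0..<min (real n) total} t \<partial>lborel)" for n
  proof -
    interpret m: bounded_clock "\<lambda>t. min (real n) (clock t)" "min (real n) total"
      by (rule bounded_clock_min)
    have "m.inv_clock t = inv_clock t" if "t < real n" for t
      using that by (simp add: m.inv_clock_def inv_clock_def)
    then show ?thesis
      unfolding min_clock by (subst m.nn_integral_clock) (auto intro!: nn_integral_cong simp: indicator_def)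
  qed
  have le: "(\<integral>\<^sup>+t. \<phi> (inv_clock t) * indicator {0..<min (real n) total} t \<partial>lborel) \<le> (\<integral>\<^sup>+t. \<phi> t \<partial>M)" for n
    unfolding nn_integral_clock[OF assms] by (intro nn_integral_mono) (auto simp: indicator_def)
  obtain n where "total \<le> real n" using real_arch_simple by blast
  then have "(\<integral>\<^sup>+t. \<phi> (inv_clock t) * indicator {0..<min (real n) total} t \<partial>lborel) = (\<integral>\<^sup>+t. \<phi> t \<partial>M)"
    unfolding nn_integral_clock[OF assms] by (simp add: min_def)
  then show ?thesis
    unfolding stieltjes_def n using le by (intro antisym SUP_least SUP_upper2[of n]) auto
qed

text \<open>The inverse time is infinite for levels from \<open>total\<close> on, where
  \<open>Y\<close> vanishes. Below \<open>total\<close> it is \<open>inv_clock\<close>, and the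
  substitution \<open>integral_clock\<close> applies.\<close>

lemma time_change_integral:
  fixes Y :: "ennreal \<Rightarrow> real"
  assumes Y: "(\<lambda>t. Y (ennreal t)) \<in> borel_measurable borel" "Y \<infinity> = 0"
  shows "(LINT t:{0..}|lborel. exp (- \<alpha> * t) * Y (Inf {s. s < \<infinity> \<and> ennreal t < a s}))
    = (\<integral>t. exp (- \<alpha> * clock t) * Y (ennreal t) \<partial>M)"
proof -
  have inv: "Inf {s. s < \<infinity> \<and> ennreal t < a s} = (if t < total then ennreal (inv_clock t) else \<infinity>)"
    if t: "0 \<le> t" for t
  proof (cases "t < total")
    case True
    have set: "{s. s < \<infinity> \<and> ennreal t < a s} = ennreal ` {s. t < clock s}"
    proof (intro set_eqI iffI)
      fix s assume s: "s \<in> {s. s < \<infinity> \<and> ennreal t < a s}"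
      then have "s = ennreal (enn2real s)" by (simp add: less_top)
      moreover from this s have "ennreal t < ennreal (clock (enn2real s))" by (simp add: ennreal_clock)
      ultimately show "s \<in> ennreal ` {s. t < clock s}"
        using t by (intro image_eqI[of _ _ "enn2real s"]) (auto simp: ennreal_less_iff)
    next
      fix s assume "s \<in> ennreal ` {s. t < clock s}"
      then show "s \<in> {s. s < \<infinity> \<and> ennreal t < a s}"
        using t by (auto simp: ennreal_clock[symmetric] ennreal_less_iff)
    qed
    have "Inf (ennreal ` {s. t < clock s}) = ennreal (inv_clock t)"
    proof (rule antisym)
      show "ennreal (inv_clock t) \<le> Inf (ennreal ` {s. t < clock s})"
        unfolding inv_clock_def using inv_set[OF t True]
        by (intro INF_greatest ennreal_leI cInf_lower) auto
      show "Inf (ennreal ` {s. t < clock s}) \<le> ennreal (inv_clock t)"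
      proof (rule ennreal_le_epsilon)
        fix e :: real assume "0 < e"
        then obtain s where s: "t < clock s" "s < inv_clock t + e"
          using cInf_lessD[OF inv_set(1)[OF t True], of "inv_clock t + e"] by (auto simp: inv_clock_def)
        have "Inf (ennreal ` {s. t < clock s}) \<le> ennreal s"
          using s by (intro INF_lower) auto
        also have "\<dots> \<le> ennreal (inv_clock t + e)" using s by (intro ennreal_leI) auto
        also have "\<dots> = ennreal (inv_clock t) + ennreal e"
          using inv_clock_nonneg[OF t True] \<open>0 < e\<close> by (intro ennreal_plus) auto
        finally show "Inf (ennreal ` {s. t < clock s}) \<le> ennreal (inv_clock t) + ennreal e" .
      qed
    qed
    with set True show ?thesis by simp
  next
    case False
    have "\<not> ennreal t < a s" if "s < \<infinity>" for s
    proof -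
      have "a s = ennreal (clock (enn2real s))" using that by (simp add: ennreal_clock less_top)
      moreover have "clock (enn2real s) \<le> t" using F_le[of "enn2real s"] False by simp
      ultimately show ?thesis by (simp add: ennreal_leI leD)
    qed
    then have "{s. s < \<infinity> \<and> ennreal t < a s} = {}" by auto
    then show ?thesis using False by (simp only: Inf_empty if_False infinity_ennreal_def)
  qed
  have "(LINT t:{0..}|lborel. exp (- \<alpha> * t) * Y (Inf {s. s < \<infinity> \<and> ennreal t < a s}))
    = (\<integral>t. indicator {0..<total} t * (exp (- \<alpha> * clock (inv_clock t)) * Y (ennreal (inv_clock t))) \<partial>lborel)"
    unfolding set_lebesgue_integral_def
  proof (intro Bochner_Integration.integral_cong refl)
    fix t
    show "indicator {0..} t *\<^sub>R (exp (- \<alpha> * t) * Y (Inf {s. s < \<infinity> \<and> ennreal t < a s}))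
      = indicator {0..<total} t * (exp (- \<alpha> * clock (inv_clock t)) * Y (ennreal (inv_clock t)))"
    proof (cases "0 \<le> t")
      case True
      show ?thesis
        unfolding inv[OF True] using True F_inv_clock[of t] Y(2) by (cases "t < total") auto
    qed auto
  qed
  also have "\<dots> = (\<integral>t. exp (- \<alpha> * clock t) * Y (ennreal t) \<partial>M)"
    using Y(1) by (intro integral_clock[symmetric]) measurable
  finally show ?thesis .
qed

end

text \<open>An additive functional may become infinite at the lifetime; a finite integral of the
  indicator of being alive excludes this. Before the lifetime the increment is below the integral,
  the value at the lifetime is a left limit, and afterwards the path is constant.\<close>

lemma bounded_of_stieltjes:
  fixes a :: "ennreal \<Rightarrow> ennreal"
  assumes a0: "a 0 = 0" and mono: "\<And>s t. s \<le> t \<Longrightarrow> t < \<infinity> \<Longrightarrow> a s \<le> a t"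
    and cont: "continuous_on {t. t < \<infinity>} a"
    and \<zeta>: "0 < \<zeta>" and fin: "\<And>t. t < \<zeta> \<Longrightarrow> a t < \<infinity>"
    and const: "\<And>t. t < \<infinity> \<Longrightarrow> \<zeta> \<le> t \<Longrightarrow> a t = a \<zeta>"
    and \<phi>: "\<And>t. ennreal t < \<zeta> \<Longrightarrow> \<phi> t = 1" and S: "stieltjes a \<phi> \<le> S"
    and t: "t < \<infinity>"
  shows "a t \<le> S"
proof -
  have less: "a t \<le> S" if less_\<zeta>: "t < \<zeta>" for t
  proof -
    obtain r where r: "t = ennreal r" "0 \<le> r"
      using less_\<zeta> by (cases t) (auto simp: top.extremum_strict)
    obtain c where c: "a t = ennreal c" "0 \<le> c"
      using fin[OF less_\<zeta>] by (cases "a t") auto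
    \<comment> \<open>With this \<open>n\<close> the truncation leaves the value at time
      \<open>r\<close> unchanged, so that \<open>a t\<close> is an increment of a finite Stieltjes
      function.\<close>
    obtain n where n: "c \<le> real n" using real_arch_simple by blast
    let ?F = "\<lambda>t. enn2real (min (of_nat n) (a (ennreal t)))"
    have fin': "min (of_nat n) (a (ennreal t)) < \<top>" for t
      by (simp add: min_less_iff_disj of_nat_less_top)
    have F_mono: "?F s \<le> ?F t" if "s \<le> t" for s t
      using that fin' by (intro enn2real_mono min.mono mono ennreal_leI) auto
    have "continuous_on UNIV (\<lambda>t. min (of_nat n) (a (ennreal t)))"
      by (intro continuous_on_min continuous_on_const
          continuous_on_compose2[OF cont continuous_on_ennreal[OF continuous_on_id]]) auto
    then have "continuous_on UNIV ?F"
      unfolding continuous_on_eq_continuous_at[OF open_UNIV] isCont_def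
      using fin'[THEN less_imp_neq] by (intro ballI tendsto_enn2real) (auto simp: ennreal_enn2real_if)
    then have F_cont: "continuous (at_right s) ?F" for s
      by (simp add: continuous_on_eq_continuous_at continuous_at_imp_continuous_at_within)
    have "a t = ennreal (?F r - ?F 0)"
      using n c r by (simp add: a0 min_def ennreal_of_nat_eq_real_of_nat)
    also have "\<dots> = emeasure (interval_measure ?F) {0<..r}"
      using r F_mono F_cont by (intro emeasure_interval_measure_Ioc[symmetric])
    also have "\<dots> = (\<integral>\<^sup>+s. indicator {0<..r} s \<partial>interval_measure ?F)"
      by simp
    also have "\<dots> \<le> (\<integral>\<^sup>+s. \<phi> s \<partial>interval_measure ?F)"
    proof (rule nn_integral_mono)
      fix s
      show "indicator {0<..r} s \<le> \<phi> s"
      proof (cases "s \<in> {0<..r}")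
        case True
        then have "ennreal s \<le> ennreal r" by (intro ennreal_leI) simp
        then have "ennreal s < \<zeta>" using less_\<zeta> r(1) by (metis order_le_less_trans)
        then show ?thesis using \<phi> by (simp add: indicator_def)
      qed simp
    qed
    also have "\<dots> \<le> stieltjes a \<phi>"
      unfolding stieltjes_def by (rule SUP_upper) simp
    finally show ?thesis using S by simp
  qed
  show ?thesis
  proof (cases "t < \<zeta>")
    case False
    then have \<zeta>t: "\<zeta> \<le> t" and "\<zeta> < \<infinity>" using t by auto
    have "isCont a \<zeta>"
      using cont \<open>\<zeta> < \<infinity>\<close> open_lessThan[of "\<infinity>::ennreal"]
      by (auto simp: continuous_on_eq_continuous_at lessThan_def)
    then have *: "(a \<longlongrightarrow> a \<zeta>) (at_left \<zeta>)"
      unfolding isCont_def by (rule tendsto_within_subset) simp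
    have "a \<zeta> \<le> S"
    proof (rule ccontr)
      assume "\<not> a \<zeta> \<le> S"
      then have "\<forall>\<^sub>F s in at_left \<zeta>. S < a s"
        using * by (intro order_tendstoD(1)) auto
      then obtain b where "b < \<zeta>" "\<And>s. b < s \<Longrightarrow> s < \<zeta> \<Longrightarrow> S < a s"
        unfolding eventually_at_left[OF \<zeta>] by blast
      moreover from dense[OF \<open>b < \<zeta>\<close>] obtain s where "b < s" "s < \<zeta>" by blast
      ultimately have "S < a s" by simp
      then show False using less[OF \<open>s < \<zeta>\<close>] by simp
    qed
    then show ?thesis using const[OF t \<zeta>t] by simp
  qed (rule less)
qed

section \<open>Resolvents of additive functionals\<close>

text \<open>Meant for path integrals that are identified with measurable functions only almost
  surely: the Bochner integral needs them to be measurable, and completeness grants it.\<close>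

lemma (in complete_measure) measurable_AE:
  assumes f: "f \<in> M \<rightarrow>\<^sub>M N" and "AE x in M. f x = g x" and "g \<in> space M \<rightarrow> space N"
  shows "g \<in> M \<rightarrow>\<^sub>M N"
proof (rule measurableI)
  fix A assume A: "A \<in> sets N"
  show "g -` A \<inter> space M \<in> sets M"
  proof (rule in_sets_AE)
    show "AE x in M. (x \<in> f -` A \<inter> space M) = (x \<in> g -` A \<inter> space M)"
      using assms(2) by (rule eventually_mono) simp
  qed (use measurable_sets[OF f A] in auto)
qed (use assms(3) in auto)

lemma ennreal_add_diff_add:
  fixes b c d :: ennreal
  shows "b < \<infinity> \<Longrightarrow> (b + c) - (b + d) = c - d"
  by (cases b; cases c; cases d) (auto simp: ennreal_minus simp flip: ennreal_plus)

context markov_process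
begin

text \<open>\<open>ext0 u\<close> is continuous at every point of \<open>X\<close> even if \<open>u\<close> does not vanish at infinity, and
  constant along a path after the lifetime.\<close>

lemma path_right_continuous:
  fixes u :: "'a \<Rightarrow> real"
  assumes u: "continuous_on UNIV u" and \<omega>: "\<omega> \<in> Omega Z"
    and lim: "\<And>t. t < \<infinity> \<Longrightarrow> limitin Xcem (\<lambda>s. traj Z s \<omega>) (traj Z t \<omega>) (at_right t)"
  shows "((\<lambda>s. ext0 u (traj Z (ennreal s) \<omega>)) \<longlongrightarrow> ext0 u (traj Z (ennreal r) \<omega>)) (at_right r)"
proof -
  have gt: "\<forall>\<^sub>F s in at_right r. r < s"
    by (simp add: eventually_at_filter)
  show ?thesis
  proof (cases "r < 0")
    \<comment> \<open>Negative times are all sent to 0 by \<open>ennreal\<close>, so the path is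
      constant just to the right of \<open>r\<close>.\<close>
    case True
    then have "\<forall>\<^sub>F s in at_right r. s < 0"
      by (auto simp: eventually_at_right_field)
    then show ?thesis
      by (intro tendsto_eventually, elim eventually_mono) (use True in \<open>simp add: ennreal_neg\<close>)
  next
    case False
    show ?thesis
    proof (cases "traj Z (ennreal r) \<omega>")
      case None
      have "\<forall>\<^sub>F s in at_right r. traj Z (ennreal s) \<omega> = None"
        using gt by (rule eventually_mono) (rule absorbed[OF \<omega> None], simp add: ennreal_leI)
      then show ?thesis
        by (intro tendsto_eventually, elim eventually_mono) (simp add: None)
    next
      case (Some x)
      have fl: "filterlim ennreal (at_right (ennreal r)) (at_right r)"
      proof (rule filterlim_at_withinI)
        show "(ennreal \<longlongrightarrow> ennreal r) (at_right r)"
          by (intro tendsto_ennrealI tendsto_ident_at)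
        show "\<forall>\<^sub>F s in at_right r. ennreal s \<in> {ennreal r<..} - {ennreal r}"
          using gt by (rule eventually_mono) (use False in \<open>auto simp: ennreal_less_iff\<close>)
      qed
      show ?thesis
      proof (rule topological_tendstoI)
        fix V :: "real set" assume V: "open V" "ext0 u (traj Z (ennreal r) \<omega>) \<in> V"
        have "open (u -` V)"
          using u V(1) by (simp add: open_vimage)
        then have "openin Xcem (Some ` (u -` V))" by simp
        moreover have "traj Z (ennreal r) \<omega> \<in> Some ` (u -` V)"
          using V(2) by (simp add: Some)
        ultimately have "\<forall>\<^sub>F s in at_right (ennreal r). traj Z s \<omega> \<in> Some ` (u -` V)"
          using lim[of "ennreal r"] by (auto simp: limitin_def)
        then have "\<forall>\<^sub>F s in at_right r. traj Z (ennreal s) \<omega> \<in> Some ` (u -` V)"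
          using fl by (rule eventually_compose_filterlim)
        then show "\<forall>\<^sub>F s in at_right r. ext0 u (traj Z (ennreal s) \<omega>) \<in> V"
          by (rule eventually_mono) auto
      qed
    qed
  qed
qed

end

section \<open>Almost sure properties of the additive functional\<close>

locale additive_functional = standard_process Z
  for Z :: "('w, 'a::{metric_space, second_countable_topology}) process" +
  fixes A :: "ennreal \<Rightarrow> 'w \<Rightarrow> ennreal" and p :: "real \<Rightarrow> 'a \<Rightarrow> 'a \<Rightarrow> real" and \<mu> :: "'a measure"
  assumes pcaf: "pcaf Z A" and potential: "potential_formula p Z A \<mu>" and kato: "green_kato p \<mu>"
begin

abbreviation clk :: "'w \<Rightarrow> real \<Rightarrow> real" where
  "clk \<omega> t \<equiv> enn2real (A (ennreal t) \<omega>)"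

abbreviation path :: "('a \<Rightarrow> real) \<Rightarrow> 'w \<Rightarrow> real \<Rightarrow> ennreal" where
  "path u \<omega> s \<equiv> ennreal (ext0 u (traj Z (ennreal s) \<omega>))"

text \<open>Collects conditions on one path that hold almost surely from every live starting point.
  The positive lifetime excludes paths started in the cemetery; these are handled by
  \<open>tail_dead\<close>.\<close>

definition regular :: "'w \<Rightarrow> bool" where
  "regular \<omega> \<longleftrightarrow> \<omega> \<in> Omega Z \<and> A 0 \<omega> = 0 \<and> continuous_on {t. t < \<infinity>} (\<lambda>t. A t \<omega>)
     \<and> (\<forall>t<lifetime Z \<omega>. A t \<omega> < \<infinity>)
     \<and> (\<forall>t<\<infinity>. lifetime Z \<omega> \<le> t \<longrightarrow> A t \<omega> = A (lifetime Z \<omega>) \<omega>)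
     \<and> (\<forall>s<\<infinity>. \<forall>t<\<infinity>. A (t + s) \<omega> = A t \<omega> + A s (shift Z t \<omega>))
     \<and> 0 < lifetime Z \<omega>
     \<and> (\<forall>t<\<infinity>. limitin Xcem (\<lambda>s. traj Z s \<omega>) (traj Z t \<omega>) (at_right t))"

definition good :: "'w \<Rightarrow> bool" where
  "good \<omega> \<longleftrightarrow> regular \<omega> \<and> (\<exists>S. finite_clock (\<lambda>t. A t \<omega>) S)"

text \<open>Additivity suffices: increments are again values of \<open>A\<close>, along the shifted
  path, and thus lie in [0,\<infinity>].\<close>

lemma regular_mono: "regular \<omega> \<Longrightarrow> s \<le> t \<Longrightarrow> t < \<infinity> \<Longrightarrow> A s \<omega> \<le> A t \<omega>"
proof -
  assume *: "regular \<omega>" "s \<le> t" "t < \<infinity>"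
  have "t = s + (t - s)" using *(2) by (simp add: add_diff_inverse_ennreal)
  moreover have "s < \<infinity>" "t - s < \<infinity>"
    using * le_less_trans[OF diff_le_self_ennreal *(3)] by auto
  ultimately have "A t \<omega> = A s \<omega> + A (t - s) (shift Z s \<omega>)"
    using *(1) unfolding regular_def by metis
  then show ?thesis by simp
qed

lemma pcaf_adapted: "t < \<infinity> \<Longrightarrow> A t \<in> borel_measurable (natural_filtration Z t)"
  using pcaf unfolding pcaf_def by blast

lemma measurable_A_natural: "t < \<infinity> \<Longrightarrow> A t \<in> borel_measurable (natural_filtration Z \<infinity>)"
  by (rule measurable_natural_filtration[OF pcaf_adapted])

lemma measurable_A_hist: "s \<le> t \<Longrightarrow> t < \<infinity> \<Longrightarrow> A s \<in> borel_measurable (hist Z t)"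
  by (rule measurable_hist_mono[OF measurable_natural_filtration_hist[OF _ pcaf_adapted]])
    (auto intro: le_less_trans)

lemma measurable_A_law: "t < \<infinity> \<Longrightarrow> A t \<in> borel_measurable (law Z x)"
  unfolding measurable_law_cong by (rule measurable_hist_events[OF measurable_A_hist[OF order_refl]])

lemma measurable_ext0_traj_law:
  "u \<in> borel_measurable borel \<Longrightarrow> (\<lambda>\<omega>. ext0 u (traj Z t \<omega>)) \<in> borel_measurable (law Z x)"
  by (rule measurable_compose[OF measurable_traj_law measurable_ext0])

lemma AE_regular: "AE \<omega> in law Z (Some x). regular \<omega>"
proof -
  from pcaf[unfolded pcaf_def, THEN conjunct2] obtain \<Lambda> where \<Lambda>: "\<forall>x. AE \<omega> in law Z (Some x). \<omega> \<in> \<Lambda>"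
    and L: "\<forall>\<omega>\<in>\<Lambda>. A 0 \<omega> = 0
           \<and> continuous_on {t. t < \<infinity>} (\<lambda>t. A t \<omega>)
           \<and> (\<forall>t<lifetime Z \<omega>. A t \<omega> < \<infinity>)
           \<and> (\<forall>t<\<infinity>. lifetime Z \<omega> \<le> t \<longrightarrow> A t \<omega> = A (lifetime Z \<omega>) \<omega>)
           \<and> (\<forall>s<\<infinity>. \<forall>t<\<infinity>. A (t + s) \<omega> = A t \<omega> + A s (shift Z t \<omega>))"
    by (elim bexE conjE)
  \<comment> \<open>The live points form an open subset of the compactification, so right continuity
    at time 0 keeps the path alive for a while.\<close>
  have life: "0 < lifetime Z \<omega>" if \<omega>: "\<omega> \<in> Omega Z" "traj Z 0 \<omega> = Some x"
    "limitin Xcem (\<lambda>s. traj Z s \<omega>) (traj Z 0 \<omega>) (at_right 0)" for \<omega>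
  proof -
    have "openin Xcem (range (Some :: 'a \<Rightarrow> _))" by simp
    then have "\<forall>\<^sub>F s in at_right 0. traj Z s \<omega> \<in> range Some"
      using \<omega>(2,3) by (auto simp: limitin_def)
    then obtain b where b: "0 < b" "\<And>s. 0 < s \<Longrightarrow> s < b \<Longrightarrow> traj Z s \<omega> \<noteq> None"
      using eventually_at_right[of "0::ennreal" 1] by fastforce
    have "b \<le> lifetime Z \<omega>"
      unfolding lifetime_def
    proof (rule Inf_greatest)
      fix t assume t: "t \<in> {t. traj Z t \<omega> = None}"
      then have "t \<noteq> 0" using \<omega>(2) by auto
      then show "b \<le> t" using b(2)[of t] t by (auto simp: zero_less_iff_neq_zero not_less[symmetric])
    qed
    then show ?thesis using b(1) by simp
  qed
  show ?thesis
    using spec[OF \<Lambda>, of x] normal[of "Some x"] right_continuous_paths[of "Some x"] AE_space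
  proof eventually_elim
    case (elim \<omega>)
    have \<omega>: "\<omega> \<in> Omega Z" using elim(4) by simp
    have "0 < lifetime Z \<omega>" using life[OF \<omega> elim(2)] elim(3) by simp
    with bspec[OF L elim(1)] elim(3) \<omega> show ?case unfolding regular_def by blast
  qed
qed

context
  fixes u :: "'a \<Rightarrow> real" and B :: real
  assumes u_cont: "continuous_on UNIV u" and u_nonneg: "\<And>x. 0 \<le> u x" and u_le: "\<And>x. u x \<le> B"
begin

lemma path_le: "path u \<omega> s \<le> ennreal B"
  using u_le order_trans[OF u_nonneg u_le] by (cases "traj Z (ennreal s) \<omega>") (auto intro!: ennreal_leI)

lemma path_tendsto:
  "regular \<omega> \<Longrightarrow> (path u \<omega> \<longlongrightarrow> path u \<omega> r) (at_right r)"
  unfolding regular_def using u_cont by (intro tendsto_ennrealI path_right_continuous) auto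

lemma path_measurable: "regular \<omega> \<Longrightarrow> path u \<omega> \<in> borel_measurable borel"
  by (rule right_continuous_borel_measurable) (rule path_tendsto)

text \<open>The Stieltjes integral is not visibly measurable in the path. On regular paths it
  coincides with a supremum of lower limits of Riemann sums, measurable on all of
  \<open>Omega Z\<close>. The clock is truncated because its finiteness is still to be
  proved.\<close>

lemma stieltjes_measurable:
  "\<exists>f\<in>borel_measurable (law Z x). \<forall>\<omega>. regular \<omega> \<longrightarrow> stieltjes (\<lambda>t. A t \<omega>) (path u \<omega>) = f \<omega>"
proof (intro bexI allI impI)
  let ?f = "\<lambda>\<omega>. SUP n. liminf (\<lambda>N. riemann_sum (path u \<omega>) (\<lambda>r. min (of_nat n) (A (ennreal r) \<omega>)) 0 N)"
  show "?f \<in> borel_measurable (law Z x)"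
    unfolding riemann_sum_def
    by (intro borel_measurable_SUP borel_measurable_liminf borel_measurable_suminf_order
        borel_measurable_times_ennreal borel_measurable_minus_ennreal borel_measurable_min
        borel_measurable_const measurable_A_law measurable_compose[OF measurable_ext0_traj_law measurable_ennreal]
        borel_measurable_continuous_onI[OF u_cont]) auto
  fix \<omega> assume \<omega>: "regular \<omega>"
  have "(\<integral>\<^sup>+t. path u \<omega> t \<partial>interval_measure (\<lambda>t. enn2real (min (of_nat n) (A (ennreal t) \<omega>))))
    = liminf (\<lambda>N. riemann_sum (path u \<omega>) (\<lambda>r. min (of_nat n) (A (ennreal r) \<omega>)) 0 N)" for n
  proof -
    interpret c: finite_clock "\<lambda>t. min (of_nat n) (A t \<omega>)" "real n"
    proof
      show "min (of_nat n) (A 0 \<omega>) = 0" using \<omega> by (simp add: regular_def)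
      show "min (of_nat n) (A s \<omega>) \<le> min (of_nat n) (A t \<omega>)" if "s \<le> t" "t < \<infinity>" for s t
        using regular_mono[OF \<omega> that] by (rule min.mono[OF order_refl])
      show "continuous_on {t. t < \<infinity>} (\<lambda>t. min (of_nat n) (A t \<omega>))"
        using \<omega> by (intro continuous_on_min continuous_on_const) (simp add: regular_def)
    qed (simp add: ennreal_of_nat_eq_real_of_nat)
    have "(\<lambda>N. riemann_sum (path u \<omega>) (\<lambda>r. min (of_nat n) (A (ennreal r) \<omega>)) 0 N)
        \<longlonglongrightarrow> (\<integral>\<^sup>+r. path u \<omega> r * indicator {0<..} r \<partial>c.M)"
      by (rule c.riemann_sum_tendsto[OF c.ennreal_clock[symmetric] path_tendsto[OF \<omega>] path_le]) simp
    moreover have "(\<integral>\<^sup>+r. path u \<omega> r * indicator {0<..} r \<partial>c.M) = (\<integral>\<^sup>+r. path u \<omega> r \<partial>c.M)"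
      by (rule nn_integral_cong_AE, rule eventually_mono[OF c.AE_clock_pos]) simp
    ultimately have "(\<lambda>N. riemann_sum (path u \<omega>) (\<lambda>r. min (of_nat n) (A (ennreal r) \<omega>)) 0 N)
        \<longlonglongrightarrow> (\<integral>\<^sup>+r. path u \<omega> r \<partial>c.M)" by simp
    then show ?thesis
      unfolding c.clock_def[abs_def] by (rule lim_imp_Liminf[OF sequentially_bot, symmetric])
  qed
  then show "stieltjes (\<lambda>t. A t \<omega>) (path u \<omega>) = ?f \<omega>"
    unfolding stieltjes_def by simp
qed

lemma nn_integral_stieltjes:
  "(\<integral>\<^sup>+\<omega>. stieltjes (\<lambda>t. A t \<omega>) (path u \<omega>) \<partial>law Z (Some x)) = (\<integral>\<^sup>+y. green p 0 x y * ennreal (u y) \<partial>\<mu>)"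
proof -
  have "ext0 (\<lambda>x. ennreal (u x)) z = ennreal (ext0 u z)" for z
    by (cases z) auto
  then have eq: "(\<lambda>t. ennreal (exp (- 0 * t)) * ext0 (\<lambda>x. ennreal (u x)) (traj Z (ennreal t) \<omega>)) = path u \<omega>" for \<omega>
    by auto
  have "(\<lambda>x. ennreal (u x)) \<in> borel_measurable borel"
    using borel_measurable_continuous_onI[OF u_cont] by measurable
  from potential[unfolded potential_formula_def, rule_format, OF this order_refl, of x]
  show ?thesis unfolding eq .
qed

end

text \<open>The function 1, extended by 0 to the cemetery, is the indicator of being alive along a
  path. Its integral has finite expectation because the Kato condition makes the potential of 1
  finite; so \<open>bounded_of_stieltjes\<close> applies almost surely.\<close>

lemma AE_good: "AE \<omega> in law Z (Some x). good \<omega>"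
proof -
  let ?S = "\<lambda>\<omega>. stieltjes (\<lambda>t. A t \<omega>) (path (\<lambda>_. 1) \<omega>)"
  obtain f where f: "f \<in> borel_measurable (law Z (Some x))" "\<And>\<omega>. regular \<omega> \<Longrightarrow> ?S \<omega> = f \<omega>"
    using stieltjes_measurable[of "\<lambda>_. 1" 1 "Some x"] by auto
  have "(\<integral>\<^sup>+\<omega>. f \<omega> \<partial>law Z (Some x)) = (\<integral>\<^sup>+\<omega>. ?S \<omega> \<partial>law Z (Some x))"
    using AE_regular[of x] by (intro nn_integral_cong_AE) (auto simp: f(2) elim: eventually_mono)
  also have "\<dots> = (\<integral>\<^sup>+y. green p 0 x y * ennreal 1 \<partial>\<mu>)"
    by (rule nn_integral_stieltjes[of _ 1]) auto
  also have "\<dots> \<noteq> \<infinity>"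
    using kato by (simp add: green_kato_def less_top)
  finally have "AE \<omega> in law Z (Some x). f \<omega> \<noteq> \<infinity>"
    using f(1) by (intro nn_integral_PInf_AE)
  then show ?thesis
    using AE_regular[of x]
  proof eventually_elim
    case (elim \<omega>)
    then have r: "regular \<omega>" and fin: "?S \<omega> \<noteq> \<infinity>" by (auto simp: f(2))
    note reg = r[unfolded regular_def]
    have path_1: "path (\<lambda>_. 1) \<omega> t = 1" if "ennreal t < lifetime Z \<omega>" for t
    proof -
      have "traj Z (ennreal t) \<omega> \<noteq> None"
        using that Inf_lower[of "ennreal t" "{t. traj Z t \<omega> = None}"]
        unfolding lifetime_def[symmetric] by (auto dest: leD)
      then obtain y where "traj Z (ennreal t) \<omega> = Some y" by blast
      then show ?thesis by simp
    qed
    have A0: "A 0 \<omega> = 0" and cont: "continuous_on {t. t < \<infinity>} (\<lambda>t. A t \<omega>)" and life: "0 < lifetime Z \<omega>"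
      and fin_life: "\<And>t. t < lifetime Z \<omega> \<Longrightarrow> A t \<omega> < \<infinity>"
      and const: "\<And>t. t < \<infinity> \<Longrightarrow> lifetime Z \<omega> \<le> t \<Longrightarrow> A t \<omega> = A (lifetime Z \<omega>) \<omega>"
      using reg by blast+
    have le: "A t \<omega> \<le> ?S \<omega>" if "t < \<infinity>" for t
    proof (rule bounded_of_stieltjes[of "\<lambda>t. A t \<omega>" "lifetime Z \<omega>" "path (\<lambda>_. 1) \<omega>"])
      show "A s \<omega> \<le> A t \<omega>" if "s \<le> t" "t < \<infinity>" for s t
        using regular_mono[OF r that] .
      show "A t \<omega> = A (lifetime Z \<omega>) \<omega>" if "t < \<infinity>" "lifetime Z \<omega> \<le> t" for t
        using const[OF that] .
      show "path (\<lambda>_. 1) \<omega> t = 1" if "ennreal t < lifetime Z \<omega>" for t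
        using path_1[OF that] .
      show "A t \<omega> < \<infinity>" if "t < lifetime Z \<omega>" for t
        using fin_life[OF that] .
    qed (fact A0 cont life order_refl that)+
    have "finite_clock (\<lambda>t. A t \<omega>) (enn2real (?S \<omega>))"
    proof
      show "A t \<omega> \<le> ennreal (enn2real (?S \<omega>))" if "t < \<infinity>" for t
        using le[OF that] fin by (simp add: less_top)
      show "A s \<omega> \<le> A t \<omega>" if "s \<le> t" "t < \<infinity>" for s t
        using regular_mono[OF r that] .
    qed (fact A0 cont)+
    with r show ?case unfolding good_def by blast
  qed
qed

section \<open>Tail integrals and resolvents of nonnegative functions\<close>

abbreviation add_fun :: "'w \<Rightarrow> real \<Rightarrow> ennreal" where
  "add_fun \<omega> r \<equiv> A (ennreal r) \<omega>"

abbreviation clk_measure :: "'w \<Rightarrow> real measure" where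
  "clk_measure \<omega> \<equiv> interval_measure (clk \<omega>)"

lemma good_clock:
  assumes "good \<omega>"
  shows "\<exists>L. bounded_clock (clk \<omega>) L" and "add_fun \<omega> r = ennreal (clk \<omega> r)"
    and "\<phi> \<in> borel_measurable borel \<Longrightarrow> stieltjes (\<lambda>t. A t \<omega>) \<phi> = (\<integral>\<^sup>+t. \<phi> t \<partial>clk_measure \<omega>)"
proof -
  obtain S where "finite_clock (\<lambda>t. A t \<omega>) S" using assms unfolding good_def by blast
  then interpret c: finite_clock "\<lambda>t. A t \<omega>" S .
  have ck: "c.clock = clk \<omega>" by (rule ext) (simp add: c.clock_def)
  show "\<exists>L. bounded_clock (clk \<omega>) L"
    using c.bounded_clock_axioms unfolding ck by blast
  show "add_fun \<omega> r = ennreal (clk \<omega> r)"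
    using c.ennreal_clock[of r] unfolding ck by simp
  show "\<phi> \<in> borel_measurable borel \<Longrightarrow> stieltjes (\<lambda>t. A t \<omega>) \<phi> = (\<integral>\<^sup>+t. \<phi> t \<partial>clk_measure \<omega>)"
    using c.stieltjes_eq[of \<phi>] unfolding ck .
qed

lemma good_regular: "good \<omega> \<Longrightarrow> regular \<omega>"
  by (simp add: good_def)

lemma good_Omega: "good \<omega> \<Longrightarrow> \<omega> \<in> Omega Z"
  by (simp add: good_def regular_def)

lemma good_riemann_tendsto:
  assumes "good \<omega>" and h: "\<And>r. (h \<longlongrightarrow> h r) (at_right r)" "\<And>r. h r \<le> K" "K < \<infinity>"
  shows "(\<lambda>n. riemann_sum h (add_fun \<omega>) s n) \<longlonglongrightarrow> (\<integral>\<^sup>+r. h r * indicator {s<..} r \<partial>clk_measure \<omega>)"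
    and "(\<lambda>n. riemann_sum h (add_fun \<omega>) 0 n) \<longlonglongrightarrow> (\<integral>\<^sup>+r. h r \<partial>clk_measure \<omega>)"
proof -
  obtain L where "bounded_clock (clk \<omega>) L" using good_clock(1)[OF assms(1)] by blast
  then interpret c: bounded_clock "clk \<omega>" L .
  show *: "(\<lambda>n. riemann_sum h (add_fun \<omega>) s n) \<longlonglongrightarrow> (\<integral>\<^sup>+r. h r * indicator {s<..} r \<partial>clk_measure \<omega>)" for s
    using h by (intro c.riemann_sum_tendsto good_clock(2)[OF assms(1)])
  have "(\<integral>\<^sup>+r. h r * indicator {0<..} r \<partial>clk_measure \<omega>) = (\<integral>\<^sup>+r. h r \<partial>clk_measure \<omega>)"
    by (rule nn_integral_cong_AE, rule eventually_mono[OF c.AE_clock_pos]) simp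
  then show "(\<lambda>n. riemann_sum h (add_fun \<omega>) 0 n) \<longlonglongrightarrow> (\<integral>\<^sup>+r. h r \<partial>clk_measure \<omega>)"
    using *[of 0] by simp
qed

text \<open>Stands for the integral of u(X) against dA over times after \<open>s\<close>. As a lower
  limit of Riemann sums it is measurable for the completed natural filtration on all of
  \<open>Omega Z\<close>, which the Markov property requires; \<open>tail_eq\<close> gives the
  integral on good paths.\<close>

definition tail :: "('a \<Rightarrow> real) \<Rightarrow> real \<Rightarrow> 'w \<Rightarrow> ennreal" where
  "tail u s \<omega> = liminf (\<lambda>n. riemann_sum (path u \<omega>) (add_fun \<omega>) s n)"

definition weight :: "real \<Rightarrow> 'w \<Rightarrow> real \<Rightarrow> ennreal" where
  "weight \<alpha> \<omega> s = ennreal (exp (- \<alpha> * clk \<omega> s))"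

definition path_resolvent :: "real \<Rightarrow> ('a \<Rightarrow> real) \<Rightarrow> 'w \<Rightarrow> ennreal" where
  "path_resolvent \<alpha> u \<omega> = (\<integral>\<^sup>+s. weight \<alpha> \<omega> s * path u \<omega> s \<partial>clk_measure \<omega>)"

text \<open>The resolvent of the time-changed process for nonnegative functions, valued in
  [0,\<infinity>] and written as an integral against dA; \<open>TCR_nonneg\<close> makes the
  connection.\<close>

definition resolvent :: "real \<Rightarrow> ('a \<Rightarrow> real) \<Rightarrow> 'a \<Rightarrow> ennreal" where
  "resolvent \<alpha> u x = (\<integral>\<^sup>+\<omega>. path_resolvent \<alpha> u \<omega> \<partial>law Z (Some x))"

lemma weight_le_1: "0 \<le> \<alpha> \<Longrightarrow> weight \<alpha> \<omega> s \<le> 1"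
  by (simp add: weight_def)

lemma weight_tendsto: "good \<omega> \<Longrightarrow> (weight \<alpha> \<omega> \<longlongrightarrow> weight \<alpha> \<omega> r) (at_right r)"
proof -
  assume "good \<omega>"
  then obtain L where "bounded_clock (clk \<omega>) L" using good_clock(1) by blast
  then interpret c: bounded_clock "clk \<omega>" L .
  have "(clk \<omega> \<longlongrightarrow> clk \<omega> r) (at_right r)"
    using c.F_right_continuous[of r] by (simp add: continuous_within)
  then show ?thesis
    unfolding weight_def[abs_def] by (intro tendsto_ennrealI tendsto_exp tendsto_mult tendsto_const)
qed

lemma weight_times_tendsto:
  assumes "good \<omega>" and "(h \<longlongrightarrow> h r) (at_right r)" and "h r < \<infinity>"
  shows "((\<lambda>s. weight \<alpha> \<omega> s * h s) \<longlongrightarrow> weight \<alpha> \<omega> r * h r) (at_right r)"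
  using assms by (intro tendsto_mult_ennreal weight_tendsto) (auto simp: weight_def)

lemma measurable_weight_law: "(\<lambda>\<omega>. weight \<alpha> \<omega> s) \<in> borel_measurable (law Z x)"
  unfolding weight_def
  by (rule measurable_compose[OF measurable_A_law[of "ennreal s"]]) simp_all

lemma measurable_weight_hist: "s \<le> r \<Longrightarrow> (\<lambda>\<omega>. weight \<alpha> \<omega> s) \<in> borel_measurable (hist Z (ennreal r))"
  unfolding weight_def
  by (rule measurable_compose[OF measurable_A_hist[of "ennreal s" "ennreal r"]])
    (auto intro: ennreal_leI)

lemma measurable_path_law:
  "u \<in> borel_measurable borel \<Longrightarrow> (\<lambda>\<omega>. path u \<omega> s) \<in> borel_measurable (law Z x)"
  by (rule measurable_compose[OF measurable_ext0_traj_law measurable_ennreal])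

lemma measurable_riemann_sum_law:
  assumes "\<And>r. (\<lambda>\<omega>. h \<omega> r) \<in> borel_measurable (law Z x)"
  shows "(\<lambda>\<omega>. riemann_sum (h \<omega>) (add_fun \<omega>) s n) \<in> borel_measurable (law Z x)"
  unfolding riemann_sum_def using assms
  by (intro borel_measurable_suminf_order borel_measurable_times_ennreal borel_measurable_minus_ennreal
      measurable_A_law) simp_all

lemma measurable_tail_law:
  "u \<in> borel_measurable borel \<Longrightarrow> tail u s \<in> borel_measurable (law Z x)"
  unfolding tail_def[abs_def]
  by (intro borel_measurable_liminf measurable_riemann_sum_law measurable_path_law)

lemma measurable_tail_natural:
  assumes "u \<in> borel_measurable borel"
  shows "tail u s \<in> borel_measurable (natural_filtration Z \<infinity>)"
proof -
  have "(\<lambda>\<omega>. path u \<omega> r) \<in> borel_measurable (natural_filtration Z \<infinity>)" for r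
    by (rule measurable_compose[OF measurable_compose[OF measurable_traj_natural_filtration
        measurable_ext0[OF assms]] measurable_ennreal])
  then show ?thesis
    unfolding tail_def[abs_def] riemann_sum_def
    by (intro borel_measurable_liminf borel_measurable_suminf_order borel_measurable_times_ennreal
        borel_measurable_minus_ennreal measurable_A_natural) simp_all
qed

text \<open>The potential formula and \<open>AE_good\<close> concern live starting points. From the
  cemetery the integrand vanishes identically, whatever \<open>A\<close> does.\<close>

lemma tail_dead: "(\<integral>\<^sup>+\<omega>. tail u 0 \<omega> \<partial>law Z None) = 0"
proof -
  have "AE \<omega> in law Z None. tail u 0 \<omega> = 0"
    using normal[of None] AE_space
  proof eventually_elim
    case (elim \<omega>)
    then have "\<omega> \<in> Omega Z" by simp
    from absorbed[OF this elim(1)] have "traj Z t \<omega> = None" for t by simp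
    then have "path u \<omega> s = 0" for s by simp
    then show ?case by (simp add: tail_def riemann_sum_def Liminf_const)
  qed
  then have "(\<integral>\<^sup>+\<omega>. tail u 0 \<omega> \<partial>law Z None) = (\<integral>\<^sup>+\<omega>. 0 \<partial>law Z None)"
    by (rule nn_integral_cong_AE)
  then show ?thesis by simp
qed

text \<open>By additivity, increments of \<open>A\<close> along the shifted path are increments of
  \<open>A\<close> after time \<open>s\<close>; the finite value at \<open>s\<close> cancels. Only
  the original path has to be good.\<close>

lemma tail_shift:
  assumes "good \<omega>" and s: "0 \<le> s"
  shows "tail u 0 (shift Z (ennreal s) \<omega>) = tail u s \<omega>"
proof -
  have \<omega>: "\<omega> \<in> Omega Z" using assms(1) by (rule good_Omega)
  have path: "path u (shift Z (ennreal s) \<omega>) (0 + r) = path u \<omega> (s + r)" if "0 \<le> r" for r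
    using s that by (simp add: homogeneous[OF \<omega>] add.commute flip: ennreal_plus)
  have add: "add_fun \<omega> (s + r) = add_fun \<omega> s + A (ennreal (0 + r)) (shift Z (ennreal s) \<omega>)" if "0 \<le> r" for r
  proof -
    have "A (ennreal s + ennreal r) \<omega> = A (ennreal s) \<omega> + A (ennreal r) (shift Z (ennreal s) \<omega>)"
      using assms(1) unfolding good_def regular_def by simp
    then show ?thesis using s that by simp
  qed
  have "riemann_sum (path u (shift Z (ennreal s) \<omega>)) (add_fun (shift Z (ennreal s) \<omega>)) 0 n
      = riemann_sum (path u \<omega>) (add_fun \<omega>) s n" for n
    unfolding riemann_sum_def
  proof (intro suminf_cong arg_cong2[where f="(*)"])
    fix k
    show "path u (shift Z (ennreal s) \<omega>) (0 + real (Suc k) / real (Suc n)) = path u \<omega> (s + real (Suc k) / real (Suc n))"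
      by (rule path) simp
    have fin: "add_fun \<omega> s < \<infinity>" by (subst good_clock(2)[OF assms(1)]) simp
    show "add_fun (shift Z (ennreal s) \<omega>) (0 + real (Suc k) / real (Suc n)) - add_fun (shift Z (ennreal s) \<omega>) (0 + real k / real (Suc n))
      = add_fun \<omega> (s + real (Suc k) / real (Suc n)) - add_fun \<omega> (s + real k / real (Suc n))"
      unfolding add[of "real (Suc k) / real (Suc n)", OF divide_nonneg_nonneg[OF of_nat_0_le_iff of_nat_0_le_iff]]
        add[of "real k / real (Suc n)", OF divide_nonneg_nonneg[OF of_nat_0_le_iff of_nat_0_le_iff]]
        ennreal_add_diff_add[OF fin] ..
  qed
  then show ?thesis by (simp add: tail_def)
qed

context
  fixes u :: "'a \<Rightarrow> real" and B :: real
  assumes u_cont: "continuous_on UNIV u" and u_nonneg: "\<And>x. 0 \<le> u x" and u_le: "\<And>x. u x \<le> B"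
begin

lemma path_right: "good \<omega> \<Longrightarrow> (path u \<omega> \<longlongrightarrow> path u \<omega> r) (at_right r)"
  using path_tendsto[OF u_cont u_nonneg u_le good_regular] .

lemma tail_eq:
  assumes "good \<omega>"
  shows "tail u s \<omega> = (\<integral>\<^sup>+r. path u \<omega> r * indicator {s<..} r \<partial>clk_measure \<omega>)"
    and "tail u 0 \<omega> = (\<integral>\<^sup>+r. path u \<omega> r \<partial>clk_measure \<omega>)"
  unfolding tail_def
  by (rule lim_imp_Liminf[OF sequentially_bot good_riemann_tendsto(1)[OF assms path_right[OF assms] path_le[OF u_cont u_nonneg u_le] ennreal_less_top[folded infinity_ennreal_def]]],
      rule lim_imp_Liminf[OF sequentially_bot good_riemann_tendsto(2)[OF assms path_right[OF assms] path_le[OF u_cont u_nonneg u_le] ennreal_less_top[folded infinity_ennreal_def]]])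

lemma nn_integral_tail:
  "(\<integral>\<^sup>+\<omega>. tail u 0 \<omega> \<partial>law Z (Some x)) = (\<integral>\<^sup>+y. green p 0 x y * ennreal (u y) \<partial>\<mu>)"
proof -
  have "AE \<omega> in law Z (Some x). tail u 0 \<omega> = stieltjes (\<lambda>t. A t \<omega>) (path u \<omega>)"
    using AE_good[of x]
  proof (rule eventually_mono)
    fix \<omega> assume g: "good \<omega>"
    show "tail u 0 \<omega> = stieltjes (\<lambda>t. A t \<omega>) (path u \<omega>)"
      unfolding tail_eq(2)[OF g]
      by (rule good_clock(3)[OF g path_measurable[OF u_cont u_nonneg u_le good_regular[OF g]], symmetric])
  qed
  then have "(\<integral>\<^sup>+\<omega>. tail u 0 \<omega> \<partial>law Z (Some x)) = (\<integral>\<^sup>+\<omega>. stieltjes (\<lambda>t. A t \<omega>) (path u \<omega>) \<partial>law Z (Some x))"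
    by (rule nn_integral_cong_AE)
  also have "\<dots> = (\<integral>\<^sup>+y. green p 0 x y * ennreal (u y) \<partial>\<mu>)"
    by (rule nn_integral_stieltjes[OF u_cont u_nonneg u_le])
  finally show ?thesis .
qed

lemma weight_path_tendsto:
  "good \<omega> \<Longrightarrow> ((\<lambda>s. weight \<alpha> \<omega> s * path u \<omega> s) \<longlongrightarrow> weight \<alpha> \<omega> r * path u \<omega> r) (at_right r)"
  by (intro weight_times_tendsto path_right) simp_all

lemma weight_path_le: "0 \<le> \<alpha> \<Longrightarrow> weight \<alpha> \<omega> s * path u \<omega> s \<le> ennreal B"
  using mult_mono[OF weight_le_1 path_le[OF u_cont u_nonneg u_le]] by simp

lemma measurable_path_resolvent:
  assumes "0 \<le> \<alpha>"
  obtains f where "f \<in> borel_measurable (law Z x)" "\<And>\<omega>. good \<omega> \<Longrightarrow> path_resolvent \<alpha> u \<omega> = f \<omega>"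
proof
  show "(\<lambda>\<omega>. liminf (\<lambda>n. riemann_sum (\<lambda>s. weight \<alpha> \<omega> s * path u \<omega> s) (add_fun \<omega>) 0 n)) \<in> borel_measurable (law Z x)"
    by (intro borel_measurable_liminf measurable_riemann_sum_law borel_measurable_times_ennreal
        measurable_weight_law measurable_path_law borel_measurable_continuous_onI[OF u_cont])
  fix \<omega> assume g: "good \<omega>"
  show "path_resolvent \<alpha> u \<omega> = liminf (\<lambda>n. riemann_sum (\<lambda>s. weight \<alpha> \<omega> s * path u \<omega> s) (add_fun \<omega>) 0 n)"
    unfolding path_resolvent_def
    by (rule lim_imp_Liminf[symmetric, OF sequentially_bot good_riemann_tendsto(2)[OF g weight_path_tendsto[OF g]
          weight_path_le[OF assms] ennreal_less_top[folded infinity_ennreal_def]]])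
qed

lemma path_resolvent_le:
  assumes "0 < \<alpha>" "good \<omega>"
  shows "path_resolvent \<alpha> u \<omega> \<le> ennreal B * ennreal (1 / \<alpha>)"
proof -
  obtain L where "bounded_clock (clk \<omega>) L" using good_clock(1)[OF assms(2)] by blast
  then interpret c: bounded_clock "clk \<omega>" L .
  have "path_resolvent \<alpha> u \<omega> \<le> (\<integral>\<^sup>+s. ennreal B * ennreal (exp (- \<alpha> * clk \<omega> s)) \<partial>clk_measure \<omega>)"
    unfolding path_resolvent_def weight_def
    by (subst mult.commute, intro nn_integral_mono mult_right_mono path_le[OF u_cont u_nonneg u_le]) simp
  also have "\<dots> = ennreal B * (\<integral>\<^sup>+s. ennreal (exp (- \<alpha> * clk \<omega> s)) \<partial>clk_measure \<omega>)"
    by (rule nn_integral_cmult) (use c.F_measurable in measurable)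
  also have "\<dots> \<le> ennreal B * ennreal (1 / \<alpha>)"
    using c.nn_integral_exp_clock_le[OF assms(1)] by (rule mult_left_mono) simp
  finally show ?thesis .
qed

lemma path_resolvent_le_tail:
  assumes "0 \<le> \<alpha>" "good \<omega>"
  shows "path_resolvent \<alpha> u \<omega> \<le> tail u 0 \<omega>"
  unfolding path_resolvent_def tail_eq(2)[OF assms(2)]
  using mult_right_mono[OF weight_le_1[OF assms(1)]] by (intro nn_integral_mono) fastforce

lemma path_resolvent_0: "good \<omega> \<Longrightarrow> path_resolvent 0 u \<omega> = tail u 0 \<omega>"
  by (simp add: path_resolvent_def tail_eq(2) weight_def)

end

text \<open>The potential \<open>v\<close> at the position at time \<open>s\<close> is the
  conditional expectation of the tail after \<open>s\<close>, also in the cemetery, where both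
  vanish. The weight and the increment up to \<open>s\<close> are known at time \<open>s\<close>:
  this is the second reason for right endpoints.\<close>

lemma markov_weighted_tail:
  assumes u: "continuous_on UNIV u" "\<And>x. 0 \<le> u x" "\<And>x. u x \<le> B"
    and v: "\<And>x. (\<integral>\<^sup>+y. green p 0 x y * ennreal (u y) \<partial>\<mu>) = ennreal (v x)"
    and s: "0 \<le> s'" "s' \<le> s"
  shows "(\<integral>\<^sup>+\<omega>. weight \<alpha> \<omega> s * path v \<omega> s * (add_fun \<omega> s - add_fun \<omega> s') \<partial>law Z (Some x))
    = (\<integral>\<^sup>+\<omega>. weight \<alpha> \<omega> s * tail u s \<omega> * (add_fun \<omega> s - add_fun \<omega> s') \<partial>law Z (Some x))"
proof -
  let ?\<Phi> = "\<lambda>\<omega>. weight \<alpha> \<omega> s * (add_fun \<omega> s - add_fun \<omega> s')"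
  have \<Phi>: "?\<Phi> \<in> borel_measurable (hist Z (ennreal s))"
    using s by (intro borel_measurable_times_ennreal borel_measurable_minus_ennreal
        measurable_weight_hist measurable_A_hist ennreal_leI) simp_all
  have pot: "(\<integral>\<^sup>+\<omega>. tail u 0 \<omega> \<partial>law Z z) = ennreal (ext0 v z)" for z
    by (cases z) (simp_all add: tail_dead nn_integral_tail[OF u] v)
  have "(\<integral>\<^sup>+\<omega>. weight \<alpha> \<omega> s * path v \<omega> s * (add_fun \<omega> s - add_fun \<omega> s') \<partial>law Z (Some x))
      = (\<integral>\<^sup>+\<omega>. ?\<Phi> \<omega> * (\<integral>\<^sup>+\<omega>'. tail u 0 \<omega>' \<partial>law Z (traj Z (ennreal s) \<omega>)) \<partial>law Z (Some x))"
    unfolding pot by (intro nn_integral_cong) (simp add: mult_ac)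
  also have "\<dots> = (\<integral>\<^sup>+\<omega>. ?\<Phi> \<omega> * tail u 0 (shift Z (ennreal s) \<omega>) \<partial>law Z (Some x))"
    by (rule markov_natural_filtration[OF measurable_tail_natural[OF borel_measurable_continuous_onI[OF u(1)]] _ \<Phi>, symmetric]) simp
  also have "\<dots> = (\<integral>\<^sup>+\<omega>. weight \<alpha> \<omega> s * tail u s \<omega> * (add_fun \<omega> s - add_fun \<omega> s') \<partial>law Z (Some x))"
  proof (rule nn_integral_cong_AE, rule eventually_mono[OF AE_good[of x]])
    fix \<omega> assume g: "good \<omega>"
    have "tail u 0 (shift Z (ennreal s) \<omega>) = tail u s \<omega>"
      using s by (intro tail_shift[OF g]) simp
    then show "?\<Phi> \<omega> * tail u 0 (shift Z (ennreal s) \<omega>) = weight \<alpha> \<omega> s * tail u s \<omega> * (add_fun \<omega> s - add_fun \<omega> s')"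
      by (simp add: mult_ac)
  qed
  finally show ?thesis .
qed

text \<open>The Markov property is applied at the right endpoints of Riemann sums of
  \<open>\<integral> e\<^sup>-\<^sup>\<alpha>\<^sup>A v(X) dA\<close>; it replaces \<open>v(X\<^sub>s)\<close> by \<open>\<integral>\<^sub>s\<^sup>\<infinity> u(X) dA\<close>.\<close>

lemma resolvent_identity:
  assumes \<alpha>: "0 < \<alpha>"
    and u: "continuous_on UNIV u" "\<And>x. 0 \<le> u x" "\<And>x. u x \<le> B"
    and v: "continuous_on UNIV v" "\<And>x. 0 \<le> v x" "\<And>x. v x \<le> B'"
    and eq: "\<And>x. (\<integral>\<^sup>+y. green p 0 x y * ennreal (u y) \<partial>\<mu>) = ennreal (v x)"
  shows "ennreal \<alpha> * resolvent \<alpha> v x + resolvent \<alpha> u x = ennreal (v x)"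
proof -
  let ?P = "law Z (Some x)"
  \<comment> \<open>\<open>T\<close> and \<open>T'\<close> are Riemann sums for the integrands
    v(X_s) and \<open>tail u s\<close>. They have equal expectations for each n; the pathwise limit
    \<open>X\<close> of \<open>T'\<close> is the term treated by
    \<open>nn_integral_exp_tail\<close>.\<close>
  define T where "T n \<omega> = riemann_sum (\<lambda>s. weight \<alpha> \<omega> s * path v \<omega> s) (add_fun \<omega>) 0 n" for n \<omega>
  define T' where "T' n \<omega> = riemann_sum (\<lambda>s. weight \<alpha> \<omega> s * tail u s \<omega>) (add_fun \<omega>) 0 n" for n \<omega>
  define X where "X \<omega> = (\<integral>\<^sup>+s. weight \<alpha> \<omega> s * (\<integral>\<^sup>+r. path u \<omega> r * indicator {s<..} r \<partial>clk_measure \<omega>) \<partial>clk_measure \<omega>)" for \<omega>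
  have \<alpha>': "0 \<le> \<alpha>" using \<alpha> by simp
  have um: "u \<in> borel_measurable borel" and vm: "v \<in> borel_measurable borel"
    using borel_measurable_continuous_onI[OF u(1)] borel_measurable_continuous_onI[OF v(1)] .
  have P_space: "emeasure ?P (space ?P) = 1"
    using prob_space.emeasure_space_1[OF law_prob] .
  have T_meas: "T n \<in> borel_measurable ?P" for n
    unfolding T_def[abs_def]
    by (intro measurable_riemann_sum_law borel_measurable_times_ennreal measurable_weight_law measurable_path_law vm)
  have T'_meas: "T' n \<in> borel_measurable ?P" for n
    unfolding T'_def[abs_def]
    by (intro measurable_riemann_sum_law borel_measurable_times_ennreal measurable_weight_law measurable_tail_law um)
  have T_T': "(\<integral>\<^sup>+\<omega>. T n \<omega> \<partial>?P) = (\<integral>\<^sup>+\<omega>. T' n \<omega> \<partial>?P)" for n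
  proof -
    have m: "(\<lambda>\<omega>. weight \<alpha> \<omega> (0 + real (Suc k) / real (Suc n)) * h \<omega> *
        (add_fun \<omega> (0 + real (Suc k) / real (Suc n)) - add_fun \<omega> (0 + real k / real (Suc n)))) \<in> borel_measurable ?P"
      if "h \<in> borel_measurable ?P" for h k
      by (intro borel_measurable_times_ennreal measurable_weight_law that borel_measurable_minus_ennreal measurable_A_law) simp_all
    have le: "0 \<le> 0 + real k / real (Suc n)" "0 + real k / real (Suc n) \<le> 0 + real (Suc k) / real (Suc n)" for k
      by (auto intro: divide_right_mono)
    show ?thesis
      unfolding T_def T'_def riemann_sum_def
      by (subst nn_integral_suminf[OF m[OF measurable_path_law[OF vm]]],
          subst nn_integral_suminf[OF m[OF measurable_tail_law[OF um]]])
        (intro suminf_cong markov_weighted_tail[OF u eq] le)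
  qed
  have T_lim: "(\<lambda>n. T n \<omega>) \<longlonglongrightarrow> path_resolvent \<alpha> v \<omega>" if g: "good \<omega>" for \<omega>
    unfolding T_def path_resolvent_def
    by (rule good_riemann_tendsto(2)[OF g weight_path_tendsto[OF v g] weight_path_le[OF v \<alpha>']]) simp
  \<comment> \<open>Expectations converge by domination: \<open>T\<close> is bounded by a constant,
    and \<open>T'\<close> by the tail from 0 divided by \<alpha>, whose expectation is finite by
    \<open>tail_fin\<close>.\<close>
  have T'_lim: "(\<lambda>n. T' n \<omega>) \<longlonglongrightarrow> X \<omega>" and T'_le: "T' n \<omega> \<le> tail u 0 \<omega> * ennreal (1 / \<alpha>)"
    and X: "ennreal \<alpha> * X \<omega> + path_resolvent \<alpha> u \<omega> = tail u 0 \<omega>"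
    and T_le: "T n \<omega> \<le> ennreal B' * ennreal (1 / \<alpha>)" if g: "good \<omega>" for \<omega> n
  proof -
    obtain L where "bounded_clock (clk \<omega>) L" using good_clock(1)[OF g] by blast
    then interpret c: bounded_clock "clk \<omega>" L .
    have [measurable]: "path u \<omega> \<in> borel_measurable borel"
      by (rule path_measurable[OF u good_regular[OF g]])
    have tail_le: "tail u s \<omega> \<le> tail u 0 \<omega>" for s
      unfolding tail_eq(1)[OF u g, of s] tail_eq(2)[OF u g]
      by (intro nn_integral_mono) (auto simp: indicator_def)
    have "tail u 0 \<omega> \<le> (\<integral>\<^sup>+r. ennreal B \<partial>clk_measure \<omega>)"
      unfolding tail_eq(2)[OF u g] by (intro nn_integral_mono path_le[OF u])
    also have "\<dots> < \<infinity>"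
      by (simp add: c.emeasure_clock ennreal_mult_less_top)
    finally have fin: "tail u 0 \<omega> < \<infinity>" .
    have right: "((\<lambda>s. tail u s \<omega>) \<longlongrightarrow> tail u r \<omega>) (at_right r)" for r
      unfolding tail_eq(1)[OF u g] by (rule c.tail_right_continuous[OF _ path_le[OF u]]) simp_all
    have wright: "((\<lambda>s. weight \<alpha> \<omega> s * tail u s \<omega>) \<longlongrightarrow> weight \<alpha> \<omega> r * tail u r \<omega>) (at_right r)" for r
      by (rule weight_times_tendsto[OF g right]) (rule le_less_trans[OF tail_le fin])
    have wle: "weight \<alpha> \<omega> s * tail u s \<omega> \<le> tail u 0 \<omega>" for s
      using mult_mono[OF weight_le_1[OF \<alpha>'] tail_le] by simp
    show "(\<lambda>n. T' n \<omega>) \<longlonglongrightarrow> X \<omega>"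
      unfolding T'_def X_def tail_eq(1)[OF u g, symmetric]
      by (rule good_riemann_tendsto(2)[OF g wright wle fin])
    show "T' n \<omega> \<le> tail u 0 \<omega> * ennreal (1 / \<alpha>)"
      unfolding T'_def weight_def
      by (rule c.riemann_sum_exp_le[OF \<alpha> good_clock(2)[OF g] tail_le])
    show "T n \<omega> \<le> ennreal B' * ennreal (1 / \<alpha>)"
      unfolding T_def weight_def
      by (rule c.riemann_sum_exp_le[OF \<alpha> good_clock(2)[OF g] path_le[OF v]])
    show "ennreal \<alpha> * X \<omega> + path_resolvent \<alpha> u \<omega> = tail u 0 \<omega>"
      unfolding X_def path_resolvent_def weight_def tail_eq(2)[OF u g]
      by (rule c.nn_integral_exp_tail[OF \<alpha>]) simp
  qed
  have tail_fin: "(\<integral>\<^sup>+\<omega>. tail u 0 \<omega> \<partial>?P) = ennreal (v x)"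
    by (simp add: nn_integral_tail[OF u] eq)
  \<comment> \<open>Lower limits are measurable for all paths, whereas the limits are known to exist
    on good paths only.\<close>
  let ?f = "\<lambda>\<omega>. liminf (\<lambda>n. T n \<omega>)" and ?f' = "\<lambda>\<omega>. liminf (\<lambda>n. T' n \<omega>)"
  have f_meas: "?f \<in> borel_measurable ?P" and f'_meas: "?f' \<in> borel_measurable ?P"
    using T_meas T'_meas by (auto intro!: borel_measurable_liminf)
  have f: "?f \<omega> = path_resolvent \<alpha> v \<omega>" and f': "?f' \<omega> = X \<omega>" if g: "good \<omega>" for \<omega>
    using lim_imp_Liminf[OF sequentially_bot T_lim[OF g]] lim_imp_Liminf[OF sequentially_bot T'_lim[OF g]] by auto
  have "(\<lambda>n. \<integral>\<^sup>+\<omega>. T n \<omega> \<partial>?P) \<longlonglongrightarrow> (\<integral>\<^sup>+\<omega>. ?f \<omega> \<partial>?P)"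
  proof (rule nn_integral_dominated_convergence[OF T_meas f_meas, where w="\<lambda>_. ennreal B' * ennreal (1 / \<alpha>)"])
    show "AE \<omega> in ?P. T n \<omega> \<le> ennreal B' * ennreal (1 / \<alpha>)" for n
      by (rule eventually_mono[OF AE_good T_le])
    show "(\<integral>\<^sup>+_. ennreal B' * ennreal (1 / \<alpha>) \<partial>?P) < \<infinity>"
      using P_space by (simp add: ennreal_mult_less_top)
    show "AE \<omega> in ?P. (\<lambda>n. T n \<omega>) \<longlonglongrightarrow> ?f \<omega>"
      by (rule eventually_mono[OF AE_good]) (simp add: f T_lim)
  qed simp
  moreover have "(\<lambda>n. \<integral>\<^sup>+\<omega>. T' n \<omega> \<partial>?P) \<longlonglongrightarrow> (\<integral>\<^sup>+\<omega>. ?f' \<omega> \<partial>?P)"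
  proof (rule nn_integral_dominated_convergence[OF T'_meas f'_meas, where w="\<lambda>\<omega>. tail u 0 \<omega> * ennreal (1 / \<alpha>)"])
    show "AE \<omega> in ?P. T' n \<omega> \<le> tail u 0 \<omega> * ennreal (1 / \<alpha>)" for n
      by (rule eventually_mono[OF AE_good T'_le])
    show "(\<integral>\<^sup>+\<omega>. tail u 0 \<omega> * ennreal (1 / \<alpha>) \<partial>?P) < \<infinity>"
      using measurable_tail_law[OF um] by (subst nn_integral_multc) (simp_all add: tail_fin ennreal_mult_less_top)
    show "AE \<omega> in ?P. (\<lambda>n. T' n \<omega>) \<longlonglongrightarrow> ?f' \<omega>"
      by (rule eventually_mono[OF AE_good]) (simp add: f' T'_lim)
  qed (intro borel_measurable_times_ennreal measurable_tail_law um borel_measurable_const)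
  ultimately have "(\<integral>\<^sup>+\<omega>. ?f \<omega> \<partial>?P) = (\<integral>\<^sup>+\<omega>. ?f' \<omega> \<partial>?P)"
    unfolding T_T' by (rule LIMSEQ_unique)
  moreover have "(\<integral>\<^sup>+\<omega>. ?f \<omega> \<partial>?P) = resolvent \<alpha> v x"
    unfolding resolvent_def by (rule nn_integral_cong_AE, rule eventually_mono[OF AE_good f])
  ultimately have rv: "resolvent \<alpha> v x = (\<integral>\<^sup>+\<omega>. ?f' \<omega> \<partial>?P)" by simp
  obtain h where h: "h \<in> borel_measurable ?P" "\<And>\<omega>. good \<omega> \<Longrightarrow> path_resolvent \<alpha> u \<omega> = h \<omega>"
    using measurable_path_resolvent[OF u \<alpha>'] by blast
  have ru: "resolvent \<alpha> u x = (\<integral>\<^sup>+\<omega>. h \<omega> \<partial>?P)"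
    unfolding resolvent_def by (rule nn_integral_cong_AE, rule eventually_mono[OF AE_good h(2)])
  have "ennreal \<alpha> * resolvent \<alpha> v x + resolvent \<alpha> u x = (\<integral>\<^sup>+\<omega>. ennreal \<alpha> * ?f' \<omega> + h \<omega> \<partial>?P)"
    unfolding rv ru using f'_meas h(1) by (simp add: nn_integral_add nn_integral_cmult)
  also have "\<dots> = (\<integral>\<^sup>+\<omega>. tail u 0 \<omega> \<partial>?P)"
    by (rule nn_integral_cong_AE, rule eventually_mono[OF AE_good]) (simp only: f' h(2)[symmetric] X)
  finally show ?thesis by (simp only: tail_fin)
qed

section \<open>Signed path integrals after the time change\<close>

definition bpath :: "real \<Rightarrow> ('a \<Rightarrow> real) \<Rightarrow> 'w \<Rightarrow> real" where
  "bpath \<alpha> w \<omega> = (\<integral>s. exp (- \<alpha> * clk \<omega> s) * ext0 w (traj Z (ennreal s) \<omega>) \<partial>clk_measure \<omega>)"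

lemma ext0_path_measurable:
  fixes w :: "'a \<Rightarrow> real"
  assumes w: "continuous_on UNIV w" "\<And>x. \<bar>w x\<bar> \<le> B" and g: "good \<omega>"
  shows "(\<lambda>s. ext0 w (traj Z (ennreal s) \<omega>)) \<in> borel_measurable borel"
proof -
  have "(\<lambda>s. enn2real (path (\<lambda>x. max 0 (w x)) \<omega> s) - enn2real (path (\<lambda>x. max 0 (- w x)) \<omega> s)) \<in> borel_measurable borel"
    using w(1) order_trans[OF abs_ge_self w(2)] order_trans[OF abs_ge_minus_self w(2)] order_trans[OF abs_ge_zero w(2)]
    by (intro borel_measurable_diff borel_measurable_enn2real
        path_measurable[where B=B] good_regular g continuous_on_max continuous_on_minus continuous_on_const)
      simp_all
  also have "(\<lambda>s. enn2real (path (\<lambda>x. max 0 (w x)) \<omega> s) - enn2real (path (\<lambda>x. max 0 (- w x)) \<omega> s))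
      = (\<lambda>s. ext0 w (traj Z (ennreal s) \<omega>))"
  proof
    fix s
    show "enn2real (path (\<lambda>x. max 0 (w x)) \<omega> s) - enn2real (path (\<lambda>x. max 0 (- w x)) \<omega> s)
      = ext0 w (traj Z (ennreal s) \<omega>)"
      by (cases "traj Z (ennreal s) \<omega>") (auto simp: max_def)
  qed
  finally show ?thesis .
qed

lemma inner_eq_bpath:
  assumes w: "continuous_on UNIV w" "\<And>x. \<bar>w x\<bar> \<le> B" and g: "good \<omega>"
  shows "(LINT t:{0..}|lborel. exp (- \<alpha> * t) * ext0 w (traj Z (inverse_time A t \<omega>) \<omega>)) = bpath \<alpha> w \<omega>"
proof -
  obtain S where "finite_clock (\<lambda>t. A t \<omega>) S" using g unfolding good_def by blast
  then interpret c: finite_clock "\<lambda>t. A t \<omega>" S .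
  have ck: "c.clock = clk \<omega>" by (rule ext) (simp add: c.clock_def)
  have "ext0 w (traj Z \<infinity> \<omega>) = 0"
    by (simp only: at_infinity[OF good_Omega[OF g]] ext0_simps)
  from c.time_change_integral[of "\<lambda>t. ext0 w (traj Z t \<omega>)" \<alpha>, OF ext0_path_measurable[OF w g] this]
  show ?thesis unfolding ck bpath_def inverse_time_def .
qed

lemma bpath_integrable:
  assumes w: "continuous_on UNIV w" "\<And>x. \<bar>w x\<bar> \<le> B" and g: "good \<omega>" and \<alpha>: "0 \<le> \<alpha>"
  shows "integrable (clk_measure \<omega>) (\<lambda>s. exp (- \<alpha> * clk \<omega> s) * ext0 w (traj Z (ennreal s) \<omega>))"
proof -
  obtain L where "bounded_clock (clk \<omega>) L" using good_clock(1)[OF g] by blast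
  then interpret c: bounded_clock "clk \<omega>" L .
  interpret finite_measure "clk_measure \<omega>" by (rule c.finite_measure_clock)
  note [measurable] = c.F_measurable ext0_path_measurable[OF w g]
  have "\<bar>exp (- \<alpha> * clk \<omega> s) * ext0 w (traj Z (ennreal s) \<omega>)\<bar> \<le> 1 * B" for s
    unfolding abs_mult using \<alpha> w(2) order_trans[OF abs_ge_zero w(2)]
    by (intro mult_mono) (auto simp: ext0_def split: option.split)
  then show ?thesis
    by (intro integrable_const_bound[where B=B]) (auto, measurable)
qed

lemma ennreal_bpath:
  assumes u: "continuous_on UNIV u" "\<And>x. 0 \<le> u x" "\<And>x. u x \<le> B" and g: "good \<omega>" and \<alpha>: "0 \<le> \<alpha>"
  shows "ennreal (bpath \<alpha> u \<omega>) = path_resolvent \<alpha> u \<omega>"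
proof -
  have b: "\<bar>u x\<bar> \<le> B" for x using u(2,3) by simp
  have "path_resolvent \<alpha> u \<omega> = (\<integral>\<^sup>+s. ennreal (exp (- \<alpha> * clk \<omega> s) * ext0 u (traj Z (ennreal s) \<omega>)) \<partial>clk_measure \<omega>)"
    unfolding path_resolvent_def weight_def by (intro nn_integral_cong) (simp add: ennreal_mult')
  also have "\<dots> = ennreal (bpath \<alpha> u \<omega>)"
    unfolding bpath_def using u(2)
    by (intro nn_integral_eq_integral bpath_integrable[OF u(1) b g \<alpha>] AE_I2)
      (auto simp: ext0_def split: option.split)
  finally show ?thesis ..
qed

lemma bpath_nonneg:
  assumes "\<And>x. 0 \<le> u x"
  shows "0 \<le> bpath \<alpha> u \<omega>"
  unfolding bpath_def using assms
  by (intro integral_nonneg_AE AE_I2 mult_nonneg_nonneg) (auto simp: ext0_def split: option.split)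

lemma bpath_lin:
  assumes w: "continuous_on UNIV w" "\<And>x. \<bar>w x\<bar> \<le> B" and w': "continuous_on UNIV w'" "\<And>x. \<bar>w' x\<bar> \<le> B'"
    and g: "good \<omega>" and \<alpha>: "0 \<le> \<alpha>"
  shows "bpath \<alpha> (\<lambda>x. w x + c * w' x) \<omega> = bpath \<alpha> w \<omega> + c * bpath \<alpha> w' \<omega>"
proof -
  have "bpath \<alpha> (\<lambda>x. w x + c * w' x) \<omega>
      = (\<integral>s. exp (- \<alpha> * clk \<omega> s) * ext0 w (traj Z (ennreal s) \<omega>)
        + c * (exp (- \<alpha> * clk \<omega> s) * ext0 w' (traj Z (ennreal s) \<omega>)) \<partial>clk_measure \<omega>)"
    unfolding bpath_def
    by (intro Bochner_Integration.integral_cong refl) (simp add: ext0_def algebra_simps split: option.split)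
  also have "\<dots> = bpath \<alpha> w \<omega> + c * bpath \<alpha> w' \<omega>"
    unfolding bpath_def
    by (subst Bochner_Integration.integral_add)
      (simp_all add: bpath_integrable[OF w g \<alpha>, simplified] bpath_integrable[OF w' g \<alpha>, simplified])
  finally show ?thesis .
qed

section \<open>Linearity, positivity and contraction of the time-changed resolvent\<close>

abbreviation TCR :: "real \<Rightarrow> ('a \<Rightarrow> real) \<Rightarrow> 'a \<Rightarrow> real" where
  "TCR \<equiv> time_changed_resolvent Z A"

abbreviation cP :: "'a \<Rightarrow> 'w measure" where
  "cP x \<equiv> completion (law Z (Some x))"

lemma AE_good_completion: "AE \<omega> in cP x. good \<omega>"
  using AE_good by (rule AE_completion)

lemma resolvent_le:
  assumes u: "continuous_on UNIV u" "\<And>x. 0 \<le> u x" "\<And>x. u x \<le> B" and \<alpha>: "0 \<le> \<alpha>"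
  shows "resolvent \<alpha> u x \<le> (\<integral>\<^sup>+y. green p 0 x y * ennreal (u y) \<partial>\<mu>)"
  unfolding resolvent_def nn_integral_tail[OF u, symmetric]
  by (rule nn_integral_mono_AE, rule eventually_mono[OF AE_good])
    (rule path_resolvent_le_tail[OF u \<alpha>])

lemma resolvent_finite:
  assumes u: "continuous_on UNIV u" "\<And>x. 0 \<le> u x" "\<And>x. u x \<le> B" and \<alpha>: "0 \<le> \<alpha>"
  shows "resolvent \<alpha> u x < \<infinity>"
proof -
  have "(\<integral>\<^sup>+\<omega>. tail u 0 \<omega> \<partial>law Z (Some x)) \<le> (\<integral>\<^sup>+\<omega>. ennreal (max 0 B) * tail (\<lambda>_. 1) 0 \<omega> \<partial>law Z (Some x))"
  proof (rule nn_integral_mono_AE, rule eventually_mono[OF AE_good])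
    fix \<omega> assume g: "good \<omega>"
    have "tail u 0 \<omega> \<le> (\<integral>\<^sup>+r. ennreal (max 0 B) * path (\<lambda>_. 1) \<omega> r \<partial>clk_measure \<omega>)"
      unfolding tail_eq(2)[OF u g] using u(3)
      by (intro nn_integral_mono)
        (auto simp: ext0_def le_max_iff_disj intro!: ennreal_leI split: option.split)
    also have "\<dots> = ennreal (max 0 B) * (\<integral>\<^sup>+r. path (\<lambda>_. 1) \<omega> r \<partial>clk_measure \<omega>)"
      using path_measurable[of "\<lambda>_. 1" 1 \<omega>] good_regular[OF g] by (intro nn_integral_cmult) simp
    also have "(\<integral>\<^sup>+r. path (\<lambda>_. 1) \<omega> r \<partial>clk_measure \<omega>) = tail (\<lambda>_. 1) 0 \<omega>"
      by (rule tail_eq(2)[symmetric, of _ 1]) (simp_all add: g)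
    finally show "tail u 0 \<omega> \<le> ennreal (max 0 B) * tail (\<lambda>_. 1) 0 \<omega>" .
  qed
  also have "\<dots> = ennreal (max 0 B) * (\<integral>\<^sup>+y. green p 0 x y * ennreal 1 \<partial>\<mu>)"
    using measurable_tail_law[of "\<lambda>_. 1" 0 "Some x"] nn_integral_tail[of "\<lambda>_. 1" 1 x]
    by (subst nn_integral_cmult) simp_all
  also have "\<dots> < \<infinity>"
    using kato by (simp add: green_kato_def ennreal_mult_less_top less_top)
  finally have "(\<integral>\<^sup>+\<omega>. tail u 0 \<omega> \<partial>law Z (Some x)) < \<infinity>" .
  then show ?thesis
    using resolvent_le[OF u \<alpha>, of x] unfolding nn_integral_tail[OF u] by (rule le_less_trans[rotated])
qed

text \<open>On good paths the integral agrees with a measurable function; the remaining paths lie in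
  a null set, so it is measurable for the completed law.\<close>

lemma bpath_integrable_completion_nonneg:
  assumes u: "continuous_on UNIV u" "\<And>x. 0 \<le> u x" "\<And>x. u x \<le> B" and \<alpha>: "0 \<le> \<alpha>"
  shows "integrable (cP x) (bpath \<alpha> u)"
    and "ennreal (\<integral>\<omega>. bpath \<alpha> u \<omega> \<partial>cP x) = resolvent \<alpha> u x"
proof -
  obtain f where f: "f \<in> borel_measurable (law Z (Some x))" "\<And>\<omega>. good \<omega> \<Longrightarrow> path_resolvent \<alpha> u \<omega> = f \<omega>"
    using measurable_path_resolvent[OF u \<alpha>] by blast
  have "(\<lambda>\<omega>. enn2real (f \<omega>)) \<in> borel_measurable (cP x)"
    using f(1) by (intro measurable_completion) measurable
  moreover have "AE \<omega> in cP x. enn2real (f \<omega>) = bpath \<alpha> u \<omega>"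
  proof (rule eventually_mono[OF AE_good_completion])
    fix \<omega> assume g: "good \<omega>"
    show "enn2real (f \<omega>) = bpath \<alpha> u \<omega>"
      unfolding f(2)[OF g, symmetric] ennreal_bpath[OF u g \<alpha>, symmetric]
      by (simp add: bpath_nonneg u(2))
  qed
  ultimately have meas: "bpath \<alpha> u \<in> borel_measurable (cP x)"
    by (rule complete_measure.measurable_AE[OF completion.complete_measure_axioms]) simp
  have nn: "(\<integral>\<^sup>+\<omega>. ennreal (bpath \<alpha> u \<omega>) \<partial>cP x) = resolvent \<alpha> u x"
    unfolding nn_integral_completion resolvent_def
    by (rule nn_integral_cong_AE, rule eventually_mono[OF AE_good]) (rule ennreal_bpath[OF u _ \<alpha>])
  show int: "integrable (cP x) (bpath \<alpha> u)"
    using meas bpath_nonneg[OF u(2)] resolvent_finite[OF u \<alpha>, of x]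
    by (intro integrableI_nonneg) (auto simp: nn)
  show "ennreal (\<integral>\<omega>. bpath \<alpha> u \<omega> \<partial>cP x) = resolvent \<alpha> u x"
    unfolding nn[symmetric] using bpath_nonneg[OF u(2)]
    by (intro nn_integral_eq_integral[symmetric] int) simp
qed

text \<open>The inner integral in the definition equals \<open>bpath\<close> on good paths only, so
  its measurability has to be transferred before the outer Bochner integrals can be
  compared.\<close>

lemma TCR_eq:
  assumes w: "continuous_on UNIV w" "\<And>x. \<bar>w x\<bar> \<le> B" and \<alpha>: "0 \<le> \<alpha>"
  shows "integrable (cP x) (bpath \<alpha> w)" and "TCR \<alpha> w x = (\<integral>\<omega>. bpath \<alpha> w \<omega> \<partial>cP x)"
proof -
  let ?i = "\<lambda>\<omega>. LINT t:{0..}|lborel. exp (- \<alpha> * t) * ext0 w (traj Z (inverse_time A t \<omega>) \<omega>)"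
  let ?u = "\<lambda>x. max 0 (w x)" and ?v = "\<lambda>x. max 0 (- w x)"
  have u: "continuous_on UNIV ?u" "\<And>x. 0 \<le> ?u x" "\<And>x. ?u x \<le> B" "\<And>x. \<bar>?u x\<bar> \<le> B"
    and v: "continuous_on UNIV ?v" "\<And>x. 0 \<le> ?v x" "\<And>x. ?v x \<le> B" "\<And>x. \<bar>?v x\<bar> \<le> B"
    using w(1) order_trans[OF abs_ge_self w(2)] order_trans[OF abs_ge_minus_self w(2)] order_trans[OF abs_ge_zero w(2)]
    by (auto intro!: continuous_intros)
  have d: "(\<lambda>x. ?u x + (- 1) * ?v x) = w" by (auto simp: max_def)
  have eq: "bpath \<alpha> ?u \<omega> - bpath \<alpha> ?v \<omega> = bpath \<alpha> w \<omega>" if g: "good \<omega>" for \<omega>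
    using bpath_lin[OF u(1,4) v(1,4) g \<alpha>, of "-1"] unfolding d by simp
  have int: "integrable (cP x) (\<lambda>\<omega>. bpath \<alpha> ?u \<omega> - bpath \<alpha> ?v \<omega>)"
    by (intro Bochner_Integration.integrable_diff bpath_integrable_completion_nonneg(1)[OF u(1-3) \<alpha>]
        bpath_integrable_completion_nonneg(1)[OF v(1-3) \<alpha>])
  have "AE \<omega> in cP x. bpath \<alpha> ?u \<omega> - bpath \<alpha> ?v \<omega> = bpath \<alpha> w \<omega>"
    by (rule eventually_mono[OF AE_good_completion eq])
  moreover from this have m: "bpath \<alpha> w \<in> borel_measurable (cP x)"
    by (rule complete_measure.measurable_AE[OF completion.complete_measure_axioms borel_measurable_integrable[OF int]]) simp
  ultimately show i: "integrable (cP x) (bpath \<alpha> w)"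
    using integrable_cong_AE[OF borel_measurable_integrable[OF int] m] int by blast
  have ae: "AE \<omega> in cP x. bpath \<alpha> w \<omega> = ?i \<omega>"
    by (rule eventually_mono[OF AE_good_completion]) (rule inner_eq_bpath[OF w, symmetric])
  then have "?i \<in> borel_measurable (cP x)"
    by (rule complete_measure.measurable_AE[OF completion.complete_measure_axioms m]) simp
  then show "TCR \<alpha> w x = (\<integral>\<omega>. bpath \<alpha> w \<omega> \<partial>cP x)"
    unfolding time_changed_resolvent_def using ae by (intro integral_cong_AE m) auto
qed

lemma TCR_lin:
  assumes w: "continuous_on UNIV w" "\<And>x. \<bar>w x\<bar> \<le> B" and w': "continuous_on UNIV w'" "\<And>x. \<bar>w' x\<bar> \<le> B'"
    and \<alpha>: "0 \<le> \<alpha>"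
  shows "TCR \<alpha> (\<lambda>x. w x + c * w' x) x = TCR \<alpha> w x + c * TCR \<alpha> w' x"
proof -
  have c: "continuous_on UNIV (\<lambda>x. w x + c * w' x)" and b: "\<bar>w x + c * w' x\<bar> \<le> B + \<bar>c\<bar> * B'" for x
    using w w' by (auto intro!: continuous_intros order_trans[OF abs_triangle_ineq] add_mono mult_left_mono simp: abs_mult)
  have "TCR \<alpha> (\<lambda>x. w x + c * w' x) x = (\<integral>\<omega>. bpath \<alpha> w \<omega> + c * bpath \<alpha> w' \<omega> \<partial>cP x)"
    unfolding TCR_eq(2)[OF c b \<alpha>]
    using TCR_eq(1)[OF c b \<alpha>, of x] TCR_eq(1)[OF w \<alpha>, of x] TCR_eq(1)[OF w' \<alpha>, of x]
    by (intro integral_cong_AE eventually_mono[OF AE_good_completion] bpath_lin[OF w w' _ \<alpha>]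
        borel_measurable_integrable Bochner_Integration.integrable_add integrable_mult_right) auto
  also have "\<dots> = TCR \<alpha> w x + c * TCR \<alpha> w' x"
    unfolding TCR_eq(2)[OF w \<alpha>] TCR_eq(2)[OF w' \<alpha>]
    using TCR_eq(1)[OF w \<alpha>, of x] TCR_eq(1)[OF w' \<alpha>, of x] by simp
  finally show ?thesis .
qed

lemma TCR_nonneg:
  assumes u: "continuous_on UNIV u" "\<And>x. 0 \<le> u x" "\<And>x. u x \<le> B" and \<alpha>: "0 \<le> \<alpha>"
  shows "0 \<le> TCR \<alpha> u x" and "ennreal (TCR \<alpha> u x) = resolvent \<alpha> u x"
proof -
  have b: "\<bar>u x\<bar> \<le> B" for x using u(2,3) by simp
  show "0 \<le> TCR \<alpha> u x" "ennreal (TCR \<alpha> u x) = resolvent \<alpha> u x"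
    unfolding TCR_eq(2)[OF u(1) b \<alpha>]
    using bpath_integrable_completion_nonneg(2)[OF u \<alpha>] bpath_nonneg[OF u(2)]
    by (auto intro!: Bochner_Integration.integral_nonneg)
qed

text \<open>Positivity applied to \<open>B\<close> - \<open>w\<close> and \<open>B\<close> +
  \<open>w\<close> reduces the estimate to the constant \<open>B\<close>, for which the pathwise
  bound by \<open>B\<close> / \<alpha> is available.\<close>

lemma TCR_bound:
  assumes w: "continuous_on UNIV w" "\<And>x. \<bar>w x\<bar> \<le> B" and \<alpha>: "0 < \<alpha>"
  shows "\<alpha> * \<bar>TCR \<alpha> w x\<bar> \<le> B"
proof -
  have \<alpha>': "0 \<le> \<alpha>" using \<alpha> by simp
  have B: "0 \<le> B" using order_trans[OF abs_ge_zero w(2)] .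
  have wB': "0 \<le> B + (- 1) * w x" "0 \<le> B + 1 * w x" "B + (- 1) * w x \<le> 2 * B" "B + 1 * w x \<le> 2 * B" for x
    using w(2)[of x] by linarith+
  have c: "continuous_on UNIV (\<lambda>_. B)" "\<And>x. \<bar>B\<bar> \<le> B" using B by auto
  have "0 \<le> TCR \<alpha> (\<lambda>x. B + (- 1) * w x) x"
    by (rule TCR_nonneg(1)[where B="2 * B"]) (fact wB' \<alpha>' | intro continuous_intros w(1))+
  moreover have "0 \<le> TCR \<alpha> (\<lambda>x. B + 1 * w x) x"
    by (rule TCR_nonneg(1)[where B="2 * B"]) (fact wB' \<alpha>' | intro continuous_intros w(1))+
  ultimately have "\<bar>TCR \<alpha> w x\<bar> \<le> TCR \<alpha> (\<lambda>_. B) x"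
    unfolding TCR_lin[OF c w \<alpha>'] by auto
  moreover have "ennreal (TCR \<alpha> (\<lambda>_. B) x) \<le> ennreal (B * (1 / \<alpha>))"
  proof -
    have "ennreal (TCR \<alpha> (\<lambda>_. B) x) = resolvent \<alpha> (\<lambda>_. B) x"
      by (rule TCR_nonneg(2)[where B=B]) (use B \<alpha>' in auto)
    also have "\<dots> \<le> (\<integral>\<^sup>+\<omega>. ennreal B * ennreal (1 / \<alpha>) \<partial>law Z (Some x))"
      unfolding resolvent_def
      by (rule nn_integral_mono_AE, rule eventually_mono[OF AE_good], rule path_resolvent_le) (use B \<alpha> in auto)
    also have "\<dots> = ennreal (B * (1 / \<alpha>))"
      using B \<alpha> prob_space.emeasure_space_1[OF law_prob[of "Some x"]]
      by (simp only: nn_integral_const) (simp flip: ennreal_mult)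
    finally show ?thesis .
  qed
  ultimately have "\<bar>TCR \<alpha> w x\<bar> \<le> B * (1 / \<alpha>)"
    using \<alpha> B by (auto simp: ennreal_le_iff)
  then show ?thesis
    using \<alpha> by (simp add: pos_le_divide_eq mult.commute)
qed

end

section \<open>Lower semicontinuous functions and cut-offs\<close>

lemma lower_semicontinuous_borel:
  "lower_semicontinuous f \<Longrightarrow> f \<in> borel_measurable borel"
  unfolding lower_semicontinuous_def by (intro borel_measurableI_greater) auto

lemma lower_semicontinuous_section:
  assumes "lower_semicontinuous (\<lambda>(x, y). G x y)"
  shows "lower_semicontinuous (G x)"
proof -
  have "open (Pair x -` {z. c < (case z of (x, y) \<Rightarrow> G x y)})" for c
    using assms unfolding lower_semicontinuous_def by (intro open_vimage continuous_intros) auto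
  then show ?thesis by (simp add: lower_semicontinuous_def vimage_def)
qed

text \<open>A \<open>k\<close>-Lipschitz minorant of \<open>min k f\<close>; these increase to \<open>f\<close> if \<open>f\<close> is lower semicontinuous.\<close>

definition inf_conv :: "('b::metric_space \<Rightarrow> ennreal) \<Rightarrow> nat \<Rightarrow> 'b \<Rightarrow> real" where
  "inf_conv f k z = (INF w. enn2real (min (of_nat k) (f w)) + real k * dist z w)"

context
  fixes f :: "'b::metric_space \<Rightarrow> ennreal"
begin

lemma inf_conv_bdd: "bdd_below (range (\<lambda>w. enn2real (min (of_nat k) (f w)) + real k * dist z w))"
  by (intro bdd_belowI[of _ 0]) auto

lemma min_finite: "min (of_nat k) (f w) < \<top>"
  by (simp add: min_less_iff_disj of_nat_less_top)

lemma inf_conv_nonneg: "0 \<le> inf_conv f k z"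
  unfolding inf_conv_def by (intro cINF_greatest) auto

lemma inf_conv_le_min: "inf_conv f k z \<le> enn2real (min (of_nat k) (f z))"
  unfolding inf_conv_def using cINF_lower[OF inf_conv_bdd[of k z], of z] by simp

lemma ennreal_inf_conv_le: "ennreal (inf_conv f k z) \<le> f z"
proof -
  have "ennreal (inf_conv f k z) \<le> ennreal (enn2real (min (of_nat k) (f z)))"
    by (rule ennreal_leI[OF inf_conv_le_min])
  also have "\<dots> = min (of_nat k) (f z)"
    using min_finite by (simp add: ennreal_enn2real)
  finally show ?thesis by simp
qed

lemma inf_conv_lipschitz: "inf_conv f k z \<le> inf_conv f k z' + real k * dist z z'"
proof -
  have "inf_conv f k z - real k * dist z z' \<le> inf_conv f k z'"
    unfolding inf_conv_def[of _ _ z']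
  proof (rule cINF_greatest)
    fix w
    have "inf_conv f k z \<le> enn2real (min (of_nat k) (f w)) + real k * dist z w"
      unfolding inf_conv_def by (rule cINF_lower[OF inf_conv_bdd]) simp
    also have "real k * dist z w \<le> real k * dist z z' + real k * dist z' w"
      using mult_left_mono[OF dist_triangle[of z w z'], of "real k"] by (simp add: distrib_left)
    finally show "inf_conv f k z - real k * dist z z' \<le> enn2real (min (of_nat k) (f w)) + real k * dist z' w"
      by simp
  qed simp
  then show ?thesis by simp
qed

lemma inf_conv_continuous: "continuous_on UNIV (inf_conv f k)"
proof -
  have "dist (inf_conv f k z) (inf_conv f k z') \<le> real k * dist z z'" for z z'
    using inf_conv_lipschitz[of k z z'] inf_conv_lipschitz[of k z' z]
    by (simp add: dist_real_def abs_le_iff dist_commute)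
  then show ?thesis
    by (intro lipschitz_on_continuous_on[of "real k"] lipschitz_onI) auto
qed

lemma inf_conv_mono: "inf_conv f k z \<le> inf_conv f (Suc k) z"
  unfolding inf_conv_def[of _ "Suc k"]
proof (rule cINF_greatest)
  fix w
  have "inf_conv f k z \<le> enn2real (min (of_nat k) (f w)) + real k * dist z w"
    unfolding inf_conv_def by (rule cINF_lower[OF inf_conv_bdd]) simp
  also have "\<dots> \<le> enn2real (min (of_nat (Suc k)) (f w)) + real (Suc k) * dist z w"
    using min_finite[of "Suc k" w] by (intro add_mono enn2real_mono mult_right_mono min.mono) auto
  finally show "inf_conv f k z \<le> enn2real (min (of_nat (Suc k)) (f w)) + real (Suc k) * dist z w" .
qed simp

text \<open>Within distance \<open>r\<close> of \<open>z\<close> the function exceeds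
  \<open>c\<close>, which survives the truncation once k \<ge> c; farther away the Lipschitz penalty
  is at least k r, which is at least c once k \<ge> c / r.\<close>

lemma inf_conv_exceeds:
  assumes lsc: "lower_semicontinuous f" and c: "0 \<le> c" "ennreal c < f z"
  shows "\<exists>k0. \<forall>k\<ge>k0. c \<le> inf_conv f k z"
proof -
  have "open {w. ennreal c < f w}" using lsc by (simp add: lower_semicontinuous_def)
  moreover have "z \<in> {w. ennreal c < f w}" using c(2) by simp
  ultimately obtain r where "r > 0" "\<forall>w. dist w z < r \<longrightarrow> w \<in> {w. ennreal c < f w}"
    unfolding open_dist by blast
  then have r: "r > 0" "\<And>w. dist w z < r \<Longrightarrow> ennreal c < f w" by simp_all
  obtain k0 where k0: "max c (c / r) \<le> real k0" using real_arch_simple by blast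
  have "c \<le> inf_conv f k z" if "k0 \<le> k" for k
    unfolding inf_conv_def
  proof (rule cINF_greatest)
    fix w
    have k: "c \<le> real k" "c / r \<le> real k" using k0 that by auto
    show "c \<le> enn2real (min (of_nat k) (f w)) + real k * dist z w"
    proof (cases "dist w z < r")
      case True
      have "ennreal c \<le> min (of_nat k) (f w)"
        using r(2)[OF True] k(1) by (auto simp: ennreal_of_nat_eq_real_of_nat intro!: ennreal_leI)
      then have "c \<le> enn2real (min (of_nat k) (f w))"
        using enn2real_mono[OF _ min_finite, of "ennreal c" k w] c(1) by simp
      then show ?thesis by (simp add: add_increasing2)
    next
      case False
      have "c \<le> real k * r" using k(2) r(1) by (simp add: pos_divide_le_eq)
      also have "\<dots> \<le> real k * dist z w" using False by (intro mult_left_mono) (auto simp: dist_commute)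
      finally show ?thesis by (simp add: add_increasing)
    qed
  qed simp
  then show ?thesis by blast
qed

end

text \<open>Countably many relatively compact open sets \<open>U n\<close> cover the space. Each
  carries a bump function \<open>\<psi> n\<close>, and finite sums of these are supported in finite
  unions of compact sets.\<close>

lemma exhausting_cutoffs:
  assumes "locally_compact_space (euclidean :: ('a::{metric_space, second_countable_topology}) topology)"
  obtains \<kappa> :: "nat \<Rightarrow> ('a::{metric_space, second_countable_topology}) \<Rightarrow> real" where
    "\<And>k. continuous_on UNIV (\<kappa> k)" "\<And>k y. 0 \<le> \<kappa> k y" "\<And>k y. \<kappa> k y \<le> 1"
    "\<And>k. compact (closure {y. \<kappa> k y \<noteq> 0})" "\<And>k y. \<kappa> k y \<le> \<kappa> (Suc k) y"
    "\<And>y. \<exists>k0. \<forall>k\<ge>k0. \<kappa> k y = 1"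
proof -
  define \<U> where "\<U> = {U :: 'a set. open U \<and> (\<exists>K. compact K \<and> U \<subseteq> K)}"
  have cover: "\<Union> \<U> = UNIV"
  proof -
    have "\<exists>U\<in>\<U>. x \<in> U" for x
    proof -
      have "\<exists>U. open U \<and> (\<exists>K. compact K \<and> x \<in> U \<and> U \<subseteq> K)"
        using assms unfolding locally_compact_space_def by simp
      then obtain U K where "open U" "compact K" "x \<in> U" "U \<subseteq> K" by blast
      then show ?thesis unfolding \<U>_def by blast
    qed
    then show ?thesis by blast
  qed
  obtain \<V> where \<V>: "\<V> \<subseteq> \<U>" "countable \<V>" "\<Union> \<V> = UNIV"
  proof (rule Lindelof[of \<U>])
    show "open S" if "S \<in> \<U>" for S using that unfolding \<U>_def by blast
  qed (simp add: cover)
  have "\<V> \<noteq> {}" using \<V>(3) by auto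
  define U where "U = from_nat_into \<V>"
  have U_in: "U n \<in> \<U>" for n
    using from_nat_into[OF \<open>\<V> \<noteq> {}\<close>] \<V>(1) by (auto simp: U_def)
  have U_open: "open (U n)" for n
    using U_in[of n] unfolding \<U>_def by blast
  have "\<forall>n. \<exists>K. compact K \<and> U n \<subseteq> K"
    using U_in unfolding \<U>_def by blast
  from choice[OF this] obtain K where "\<forall>n. compact (K n) \<and> U n \<subseteq> K n" by blast
  then have K: "\<And>n. compact (K n)" "\<And>n. U n \<subseteq> K n" by blast+
  have U_cover: "\<exists>n. y \<in> U n" for y
  proof -
    obtain V where "V \<in> \<V>" "y \<in> V" using \<V>(3) by blast
    moreover from from_nat_into_surj[OF \<V>(2) this(1)] obtain n where "U n = V" by (auto simp: U_def)
    ultimately show ?thesis by blast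
  qed
  \<comment> \<open>The distance to the empty set is 0 by convention, so the whole space as
    \<open>U n\<close> needs the value 1 explicitly.\<close>
  define \<psi> where "\<psi> n y = (if U n = UNIV then 1 else min 1 (infdist y (- U n)))" for n and y :: 'a
  have \<psi>_cont: "continuous_on UNIV (\<psi> n)" for n
    unfolding \<psi>_def by (cases "U n = UNIV") (auto intro!: continuous_intros)
  have \<psi>_nonneg: "0 \<le> \<psi> n y" for n y by (simp add: \<psi>_def infdist_nonneg)
  have \<psi>_supp: "y \<in> U n" if "\<psi> n y \<noteq> 0" for n y
    using that infdist_zero[of y "- U n"] by (auto simp: \<psi>_def split: if_splits)
  have \<psi>_pos: "0 < \<psi> n y" if "y \<in> U n" for n y
  proof (cases "U n = UNIV")
    case False
    then have "- U n \<noteq> {}" by auto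
    moreover have "closed (- U n)" using U_open by (simp add: closed_Compl)
    ultimately have "infdist y (- U n) \<noteq> 0"
      using that in_closed_iff_infdist_zero[of "- U n" y] by auto
    then show ?thesis using False infdist_nonneg[of y "- U n"] by (simp add: \<psi>_def less_le)
  qed (simp add: \<psi>_def)
  \<comment> \<open>The factor k lifts the sum, which is eventually positive at each point, above
    the level 1 where the minimum cuts it off.\<close>
  define \<kappa> where "\<kappa> k y = min 1 (real k * (\<Sum>n<k. \<psi> n y))" for k y
  have sum_nonneg: "0 \<le> (\<Sum>n<k. \<psi> n y)" for k y by (intro sum_nonneg \<psi>_nonneg)
  show thesis
  proof
    show "continuous_on UNIV (\<kappa> k)" for k
      unfolding \<kappa>_def using \<psi>_cont by (intro continuous_intros) auto
    show "0 \<le> \<kappa> k y" "\<kappa> k y \<le> 1" for k y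
      using sum_nonneg by (auto simp: \<kappa>_def)
    show "compact (closure {y. \<kappa> k y \<noteq> 0})" for k
    proof -
      have "{y. \<kappa> k y \<noteq> 0} \<subseteq> (\<Union>n<k. K n)"
      proof
        fix y assume "y \<in> {y. \<kappa> k y \<noteq> 0}"
        then have "(\<Sum>n<k. \<psi> n y) \<noteq> 0" by (auto simp: \<kappa>_def)
        then obtain n where "n \<in> {..<k}" "\<psi> n y \<noteq> 0"
          by (rule sum.not_neutral_contains_not_neutral)
        then show "y \<in> (\<Union>n<k. K n)" using \<psi>_supp K(2) by blast
      qed
      moreover have "compact (\<Union>n<k. K n)" using K(1) by (intro compact_UN) auto
      ultimately have "closure {y. \<kappa> k y \<noteq> 0} \<subseteq> (\<Union>n<k. K n)"
        by (intro closure_minimal compact_imp_closed)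
      then have "(\<Union>n<k. K n) \<inter> closure {y. \<kappa> k y \<noteq> 0} = closure {y. \<kappa> k y \<noteq> 0}"
        by (rule Int_absorb1)
      then show ?thesis
        using compact_Int_closed[OF \<open>compact (\<Union>n<k. K n)\<close> closed_closure[of "{y. \<kappa> k y \<noteq> 0}"]]
        by (simp only:)
    qed
    show "\<kappa> k y \<le> \<kappa> (Suc k) y" for k y
      unfolding \<kappa>_def using sum_nonneg \<psi>_nonneg
      by (intro min.mono mult_mono) auto
    show "\<exists>k0. \<forall>k\<ge>k0. \<kappa> k y = 1" for y
    proof -
      obtain n where n: "y \<in> U n" using U_cover by blast
      obtain k1 where k1: "1 / \<psi> n y \<le> real k1" using real_arch_simple by blast
      have "\<kappa> k y = 1" if k: "k \<ge> max k1 (Suc n)" for k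
      proof -
        have "\<psi> n y \<le> (\<Sum>n<k. \<psi> n y)" using k \<psi>_nonneg by (intro member_le_sum) auto
        moreover have "1 \<le> real k * \<psi> n y"
        proof -
          have "1 / \<psi> n y \<le> real k" using k1 k by linarith
          then show ?thesis using \<psi>_pos[OF n] by (simp add: pos_divide_le_eq)
        qed
        ultimately have "1 \<le> real k * (\<Sum>n<k. \<psi> n y)"
          by (meson mult_left_mono of_nat_0_le_iff order_trans)
        then show ?thesis by (simp add: \<kappa>_def)
      qed
      then show ?thesis by blast
    qed
  qed
qed

lemma radon_integrable:
  fixes f :: "'a::{metric_space, second_countable_topology} \<Rightarrow> real"
  assumes "radon_measure \<nu>" and "continuous_on UNIV f" and "compact (closure {y. f y \<noteq> 0})"
  shows "integrable \<nu> f"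
proof -
  let ?K = "closure {y. f y \<noteq> 0}"
  have sets: "sets \<nu> = sets borel" and fin: "emeasure \<nu> ?K < \<infinity>"
    using assms by (auto simp: radon_measure_def)
  have "compact (f ` ?K)"
    using assms(2,3) by (intro compact_continuous_image) (auto intro: continuous_on_subset)
  then obtain B where B: "\<And>y. y \<in> ?K \<Longrightarrow> norm (f y) \<le> B"
    by (meson bounded_iff compact_imp_bounded imageI)
  have "f \<in> borel_measurable \<nu>"
    using borel_measurable_continuous_onI[OF assms(2)] sets by (simp cong: measurable_cong_sets)
  then show ?thesis
    using fin B sets closure_subset[of "{y. f y \<noteq> 0}"]
    by (intro integrableI_bounded_set[of ?K _ _ B]) (auto intro!: AE_I2)
qed

section \<open>Green potentials\<close>

locale green_kernel =
  fixes p :: "real \<Rightarrow> 'a::{metric_space, second_countable_topology} \<Rightarrow> 'a \<Rightarrow> real"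
  assumes locally_compact: "locally_compact_space (euclidean :: 'a topology)"
    and green_lsc: "lower_semicontinuous (\<lambda>(x, y). green p 0 x y)"
begin

abbreviation G :: "'a \<Rightarrow> 'a \<Rightarrow> ennreal" where
  "G \<equiv> green p 0"

abbreviation GP :: "'a measure \<Rightarrow> ('a \<Rightarrow> real) \<Rightarrow> 'a \<Rightarrow> real" where
  "GP \<equiv> green_potential p"

lemma green_measurable: "G x \<in> borel_measurable borel"
  by (rule lower_semicontinuous_borel[OF lower_semicontinuous_section[OF green_lsc]])

context
  fixes \<nu> :: "'a measure"
  assumes \<nu>: "green_kato p \<nu>"
begin

lemma kato_radon: "radon_measure \<nu>"
  using \<nu> by (simp add: green_kato_def)

lemma kato_sets: "sets \<nu> = sets borel"
  using kato_radon by (simp add: radon_measure_def)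

lemma kato_measurable: "f \<in> borel_measurable borel \<Longrightarrow> f \<in> borel_measurable \<nu>"
  using kato_sets by (simp cong: measurable_cong_sets)

lemma kato_finite: "(\<integral>\<^sup>+y. G x y \<partial>\<nu>) < \<infinity>"
  using \<nu> by (simp add: green_kato_def)

lemma green_AE_finite: "AE y in \<nu>. G x y \<noteq> \<infinity>"
  using kato_finite[of x] by (intro nn_integral_PInf_AE kato_measurable green_measurable) auto

lemma green_integrable: "integrable \<nu> (\<lambda>y. enn2real (G x y))"
proof (rule integrableI_bounded)
  show "(\<lambda>y. enn2real (G x y)) \<in> borel_measurable \<nu>"
    by (intro borel_measurable_enn2real kato_measurable green_measurable)
  have "(\<integral>\<^sup>+y. ennreal (norm (enn2real (G x y))) \<partial>\<nu>) \<le> (\<integral>\<^sup>+y. G x y \<partial>\<nu>)"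
    by (intro nn_integral_mono) (simp add: ennreal_enn2real_if)
  then show "(\<integral>\<^sup>+y. ennreal (norm (enn2real (G x y))) \<partial>\<nu>) < \<infinity>"
    using kato_finite by (rule le_less_trans)
qed

lemma potential_integrable:
  assumes "w \<in> borel_measurable borel" and "\<And>y. \<bar>w y\<bar> \<le> B"
  shows "integrable \<nu> (\<lambda>y. enn2real (G x y) * w y)"
proof (rule Bochner_Integration.integrable_bound)
  show "integrable \<nu> (\<lambda>y. enn2real (G x y) * B)"
    using green_integrable by (rule integrable_mult_left)
  show "(\<lambda>y. enn2real (G x y) * w y) \<in> borel_measurable \<nu>"
    by (intro borel_measurable_times borel_measurable_enn2real kato_measurable green_measurable assms)
  show "AE y in \<nu>. norm (enn2real (G x y) * w y) \<le> norm (enn2real (G x y) * B)"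
    using assms(2) order_trans[OF abs_ge_zero assms(2)]
    by (intro AE_I2) (simp add: abs_mult mult_left_mono)
qed

lemma potential_nonneg:
  assumes "w \<in> borel_measurable borel" and "\<And>y. 0 \<le> w y" and "\<And>y. w y \<le> B"
  shows "0 \<le> GP \<nu> w x" and "(\<integral>\<^sup>+y. G x y * ennreal (w y) \<partial>\<nu>) = ennreal (GP \<nu> w x)"
proof -
  have b: "\<bar>w y\<bar> \<le> B" for y using assms(2,3) by simp
  show "0 \<le> GP \<nu> w x"
    unfolding green_potential_def using assms(2) by (intro Bochner_Integration.integral_nonneg) simp
  have "(\<integral>\<^sup>+y. G x y * ennreal (w y) \<partial>\<nu>) = (\<integral>\<^sup>+y. ennreal (enn2real (G x y) * w y) \<partial>\<nu>)"
    by (rule nn_integral_cong_AE, rule eventually_mono[OF green_AE_finite[of x]])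
      (simp add: less_top assms(2) ennreal_mult)
  also have "\<dots> = ennreal (GP \<nu> w x)"
    unfolding green_potential_def using assms(2)
    by (intro nn_integral_eq_integral potential_integrable[OF assms(1) b]) simp
  finally show "(\<integral>\<^sup>+y. G x y * ennreal (w y) \<partial>\<nu>) = ennreal (GP \<nu> w x)" .
qed

lemma potential_lin:
  assumes "w \<in> borel_measurable borel" "\<And>y. \<bar>w y\<bar> \<le> B" "w' \<in> borel_measurable borel" "\<And>y. \<bar>w' y\<bar> \<le> B'"
  shows "GP \<nu> (\<lambda>y. w y + c * w' y) x = GP \<nu> w x + c * GP \<nu> w' x"
proof -
  have "GP \<nu> (\<lambda>y. w y + c * w' y) x = (\<integral>y. enn2real (G x y) * w y + c * (enn2real (G x y) * w' y) \<partial>\<nu>)"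
    unfolding green_potential_def by (intro Bochner_Integration.integral_cong refl) (simp add: algebra_simps)
  then show ?thesis
    using potential_integrable[OF assms(1,2), of x] potential_integrable[OF assms(3,4), of x]
    by (simp add: green_potential_def)
qed

lemma potential_1: "GP \<nu> (\<lambda>_. 1) = (\<lambda>x. enn2real (\<integral>\<^sup>+y. G x y \<partial>\<nu>))"
proof
  fix x
  show "GP \<nu> (\<lambda>_. 1) x = enn2real (\<integral>\<^sup>+y. G x y \<partial>\<nu>)"
    using potential_nonneg[of "\<lambda>_. 1" 1 x] by simp
qed

lemma potential_1_C0: "GP \<nu> (\<lambda>_. 1) \<in> C0"
  using \<nu> by (simp add: potential_1 green_kato_def)

lemma potential_bound:
  assumes "w \<in> borel_measurable borel" "\<And>y. \<bar>w y\<bar> \<le> B"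
  shows "\<bar>GP \<nu> w x\<bar> \<le> B * GP \<nu> (\<lambda>_. 1) x"
proof -
  have "\<bar>GP \<nu> w x\<bar> \<le> (\<integral>y. enn2real (G x y) * B \<partial>\<nu>)"
    unfolding green_potential_def
  proof (rule order_trans[OF integral_abs_bound integral_mono])
    show "integrable \<nu> (\<lambda>y. \<bar>enn2real (G x y) * w y\<bar>)"
      using potential_integrable[OF assms] by (rule integrable_abs)
    show "integrable \<nu> (\<lambda>y. enn2real (G x y) * B)"
      using green_integrable by (rule integrable_mult_left)
    show "\<bar>enn2real (G x y) * w y\<bar> \<le> enn2real (G x y) * B" for y
      using assms(2) by (simp add: abs_mult mult_left_mono)
  qed
  then show ?thesis by (simp add: green_potential_def mult.commute)
qed

end

text \<open>Vague convergence tests only one fixed compactly supported function at a time. The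
  kernel is therefore approximated from below by Lipschitz functions times cut-offs, and the moving
  point \<open>X n\<close> is exchanged for \<open>x\<close> at a cost of k times their
  distance.\<close>

lemma potential_liminf:
  assumes \<nu>: "\<And>n. green_kato p (\<nu> n)" and \<nu>0: "green_kato p \<nu>0" and vague: "vague_convergence \<nu> \<nu>0"
    and w: "continuous_on UNIV w" "\<And>y. 0 \<le> w y" "\<And>y. w y \<le> B"
    and x: "X \<longlonglongrightarrow> x" and c: "c < GP \<nu>0 w x"
  shows "\<forall>\<^sub>F n in sequentially. c < GP (\<nu> n) w (X n)"
proof (cases "c < 0")
  \<comment> \<open>Treated separately because the embedding into \<open>ennreal\<close> used below
    needs a nonnegative \<open>c\<close>.\<close>
  case True
  then show ?thesis
    using potential_nonneg(1)[OF \<nu> borel_measurable_continuous_onI[OF w(1)] w(2,3)]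
    by (intro always_eventually allI) (metis order_less_le_trans)
next
  case False
  have wm: "w \<in> borel_measurable borel" using w(1) by (rule borel_measurable_continuous_onI)
  obtain \<kappa> :: "nat \<Rightarrow> 'a \<Rightarrow> real" where \<kappa>: "\<And>k. continuous_on UNIV (\<kappa> k)" "\<And>k y. 0 \<le> \<kappa> k y" "\<And>k y. \<kappa> k y \<le> 1"
    "\<And>k. compact (closure {y. \<kappa> k y \<noteq> 0})" "\<And>k y. \<kappa> k y \<le> \<kappa> (Suc k) y"
    "\<And>y. \<exists>k0. \<forall>k\<ge>k0. \<kappa> k y = 1"
    using exhausting_cutoffs[OF locally_compact] by blast
  define \<phi> where "\<phi> k x y = inf_conv (\<lambda>(x, y). G x y) k (x, y)" for k x y
  have \<phi>_nonneg: "0 \<le> \<phi> k x y" for k x y by (simp add: \<phi>_def inf_conv_nonneg)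
  have \<phi>_cont: "continuous_on UNIV (\<lambda>y. \<phi> k x y)" for k x
    unfolding \<phi>_def by (rule continuous_on_compose2[OF inf_conv_continuous]) (auto intro!: continuous_intros)
  have \<phi>_le: "ennreal (\<phi> k x y) \<le> G x y" for k x y
    unfolding \<phi>_def using ennreal_inf_conv_le[of "\<lambda>(x, y). G x y" k "(x, y)"] by simp
  define f where "f k x y = \<phi> k x y * (\<kappa> k y * w y)" for k x y
  have supp: "compact (closure {y. h y * (\<kappa> k y * w y) \<noteq> 0})" for h k
  proof -
    have "closure {y. h y * (\<kappa> k y * w y) \<noteq> 0} \<subseteq> closure {y. \<kappa> k y \<noteq> 0}"
      by (rule closure_mono) auto
    then have "closure {y. \<kappa> k y \<noteq> 0} \<inter> closure {y. h y * (\<kappa> k y * w y) \<noteq> 0} = closure {y. h y * (\<kappa> k y * w y) \<noteq> 0}"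
      by (rule Int_absorb1)
    then show ?thesis
      using compact_Int_closed[OF \<kappa>(4)[of k] closed_closure[of "{y. h y * (\<kappa> k y * w y) \<noteq> 0}"]]
      by (simp only:)
  qed
  have f_cont: "continuous_on UNIV (f k x)" for k x
    unfolding f_def by (intro continuous_on_mult \<phi>_cont \<kappa>(1) w(1))
  have f_supp: "compact (closure {y. f k x y \<noteq> 0})" for k x
    unfolding f_def by (rule supp)
  have f_nonneg: "0 \<le> f k x y" for k x y
    unfolding f_def by (intro mult_nonneg_nonneg \<phi>_nonneg \<kappa>(2) w(2))
  have f_int: "integrable \<rho> (f k x)" if "green_kato p \<rho>" for k x \<rho>
    by (rule radon_integrable[OF kato_radon[OF that] f_cont f_supp])
  have f_le: "ennreal (f k x y) \<le> G x y * ennreal (w y)" for k x y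
  proof -
    have "ennreal (f k x y) \<le> ennreal (\<phi> k x y * w y)"
      unfolding f_def using \<kappa>(3)[of k y] w(2)[of y] \<phi>_nonneg[of k x y] \<kappa>(2)[of k y]
      by (intro ennreal_leI mult_left_mono) (simp_all add: mult_left_le_one_le)
    also have "\<dots> = ennreal (\<phi> k x y) * ennreal (w y)"
      by (rule ennreal_mult[OF \<phi>_nonneg w(2)])
    also have "\<dots> \<le> G x y * ennreal (w y)"
      by (rule mult_right_mono[OF \<phi>_le]) simp
    finally show ?thesis .
  qed
  have f_LINT: "ennreal (LINT y|\<rho>. f k x y) = (\<integral>\<^sup>+y. ennreal (f k x y) \<partial>\<rho>)" if "green_kato p \<rho>" for k x \<rho>
    by (rule nn_integral_eq_integral[symmetric, OF f_int[OF that]]) (simp add: f_nonneg)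
  have f_GP: "(LINT y|\<rho>. f k x y) \<le> GP \<rho> w x" if "green_kato p \<rho>" for k x \<rho>
  proof -
    have "ennreal (LINT y|\<rho>. f k x y) \<le> ennreal (GP \<rho> w x)"
      unfolding f_LINT[OF that] potential_nonneg(2)[OF that wm w(2,3), symmetric]
      by (intro nn_integral_mono f_le)
    then show ?thesis
      using potential_nonneg(1)[OF that wm w(2,3), of x] by (simp add: ennreal_le_iff)
  qed
  have mono: "f k x y \<le> f (Suc k) x y" for k x y
    unfolding f_def \<phi>_def using \<kappa>(2,5) w(2)
    by (intro mult_mono inf_conv_mono mult_right_mono mult_nonneg_nonneg inf_conv_nonneg) auto
  have sup: "(SUP k. ennreal (f k x y)) = G x y * ennreal (w y)" for x y
  proof (rule antisym)
    show "(SUP k. ennreal (f k x y)) \<le> G x y * ennreal (w y)"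
      using f_le by (intro SUP_least)
    obtain k1 where k1: "\<And>k. k \<ge> k1 \<Longrightarrow> \<kappa> k y = 1" using \<kappa>(6) by blast
    \<comment> \<open>The supremum starts at \<open>k1\<close>, from where on the cut-off equals 1
      at \<open>y\<close>; by monotonicity nothing is lost.\<close>
    have "G x y \<le> (SUP k\<in>{k1..}. ennreal (\<phi> k x y))"
    proof (rule dense_le)
      fix d assume d: "d < G x y"
      then obtain r where r: "d = ennreal r" "0 \<le> r" by (cases d) auto
      have "ennreal r < (case (x, y) of (x, y) \<Rightarrow> G x y)" using d r by simp
      from inf_conv_exceeds[OF green_lsc r(2) this] obtain k0 where k0: "\<And>k. k \<ge> k0 \<Longrightarrow> r \<le> \<phi> k x y"
        unfolding \<phi>_def by blast
      show "d \<le> (SUP k\<in>{k1..}. ennreal (\<phi> k x y))"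
        using k0[of "max k0 k1"] by (intro SUP_upper2[of "max k0 k1"]) (auto simp: r intro!: ennreal_leI)
    qed
    then have "G x y * ennreal (w y) \<le> (SUP k\<in>{k1..}. ennreal (\<phi> k x y)) * ennreal (w y)"
      by (rule mult_right_mono) simp
    also have "\<dots> = (SUP k\<in>{k1..}. ennreal (\<phi> k x y) * ennreal (w y))"
      by (rule SUP_mult_right_ennreal)
    also have "\<dots> \<le> (SUP k. ennreal (f k x y))"
    proof (rule SUP_least)
      fix k assume "k \<in> {k1..}"
      then have "f k x y = \<phi> k x y * w y" using k1 by (simp add: f_def)
      then have "ennreal (\<phi> k x y) * ennreal (w y) = ennreal (f k x y)"
        using ennreal_mult[OF \<phi>_nonneg w(2), of k x y y] by simp
      then show "ennreal (\<phi> k x y) * ennreal (w y) \<le> (SUP k. ennreal (f k x y))"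
        using SUP_upper[of k UNIV "\<lambda>k. ennreal (f k x y)"] by simp
    qed
    finally show "G x y * ennreal (w y) \<le> (SUP k. ennreal (f k x y))" .
  qed
  have "ennreal c < (SUP k. ennreal (LINT y|\<nu>0. f k x y))"
  proof -
    have "ennreal c < ennreal (GP \<nu>0 w x)" using c False by (simp add: ennreal_less_iff)
    also have "\<dots> = (\<integral>\<^sup>+y. (SUP k. ennreal (f k x y)) \<partial>\<nu>0)"
      unfolding sup potential_nonneg(2)[OF \<nu>0 wm w(2,3)] ..
    also have "\<dots> = (SUP k. \<integral>\<^sup>+y. ennreal (f k x y) \<partial>\<nu>0)"
      by (rule nn_integral_monotone_convergence_SUP)
        (auto intro!: incseq_SucI le_funI ennreal_leI mono borel_measurable_integrable f_int[OF \<nu>0]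
          measurable_compose[OF _ measurable_ennreal])
    finally show ?thesis by (simp only: f_LINT[OF \<nu>0])
  qed
  then obtain k where "ennreal c < ennreal (LINT y|\<nu>0. f k x y)"
    by (auto simp: less_SUP_iff)
  then have ck: "c < (LINT y|\<nu>0. f k x y)"
    using False by (simp add: ennreal_less_iff)
  \<comment> \<open>Integrates the error of the exchange of points: its integrals converge vaguely,
    hence stay bounded, while the factor \<open>dist x (X n)\<close> tends to 0. The leading 1
    matches the shape of \<open>supp\<close>.\<close>
  let ?h = "\<lambda>y. 1 * (\<kappa> k y * w y)"
  have h_cont: "continuous_on UNIV ?h" by (intro continuous_on_mult continuous_on_const \<kappa>(1) w(1))
  have h_int: "integrable \<rho> ?h" if "green_kato p \<rho>" for \<rho>
    by (rule radon_integrable[OF kato_radon[OF that] h_cont supp])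
  have lim_f: "(\<lambda>n. LINT y|\<nu> n. f k x y) \<longlonglongrightarrow> (LINT y|\<nu>0. f k x y)"
    using vague f_cont f_supp unfolding vague_convergence_def by blast
  have lim_h: "(\<lambda>n. LINT y|\<nu> n. ?h y) \<longlonglongrightarrow> (LINT y|\<nu>0. ?h y)"
    using vague h_cont supp[of "\<lambda>_. 1" k] unfolding vague_convergence_def by blast
  have "(\<lambda>n. (LINT y|\<nu> n. f k x y) - real k * dist x (X n) * (LINT y|\<nu> n. ?h y))
      \<longlonglongrightarrow> (LINT y|\<nu>0. f k x y) - real k * dist x x * (LINT y|\<nu>0. ?h y)"
    by (intro tendsto_diff tendsto_mult tendsto_const tendsto_dist x lim_f lim_h)
  then have "\<forall>\<^sub>F n in sequentially. c < (LINT y|\<nu> n. f k x y) - real k * dist x (X n) * (LINT y|\<nu> n. ?h y)"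
    using ck by (intro order_tendstoD(1)) auto
  then show ?thesis
  proof (rule eventually_mono)
    fix n assume n: "c < (LINT y|\<nu> n. f k x y) - real k * dist x (X n) * (LINT y|\<nu> n. ?h y)"
    have "(LINT y|\<nu> n. f k x y) \<le> (LINT y|\<nu> n. f k (X n) y + real k * dist x (X n) * ?h y)"
    proof (rule integral_mono)
      show "integrable (\<nu> n) (\<lambda>y. f k (X n) y + real k * dist x (X n) * ?h y)"
        by (intro Bochner_Integration.integrable_add f_int[OF \<nu>] integrable_mult_right h_int[OF \<nu>])
      fix y
      have "\<phi> k x y \<le> \<phi> k (X n) y + real k * dist x (X n)"
        using inf_conv_lipschitz[of "\<lambda>(x, y). G x y" k "(x, y)" "(X n, y)"] by (simp add: \<phi>_def dist_Pair_Pair)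
      then have "\<phi> k x y * (\<kappa> k y * w y) \<le> (\<phi> k (X n) y + real k * dist x (X n)) * (\<kappa> k y * w y)"
        by (intro mult_right_mono mult_nonneg_nonneg \<kappa>(2) w(2))
      then show "f k x y \<le> f k (X n) y + real k * dist x (X n) * ?h y"
        by (simp add: f_def distrib_right)
    qed (rule f_int[OF \<nu>])
    also have "\<dots> = (LINT y|\<nu> n. f k (X n) y) + real k * dist x (X n) * (LINT y|\<nu> n. ?h y)"
      using f_int[OF \<nu>, of n k "X n"] h_int[OF \<nu>, of n] by simp
    finally show "c < GP (\<nu> n) w (X n)"
      using n f_GP[OF \<nu>, of n k "X n"] by linarith
  qed
qed

text \<open>Apply the lower bound to \<open>w\<close> and to \<open>B - w\<close>: the sum of the two potentials converges.\<close>

lemma potential_continuous_convergence: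
  assumes \<nu>: "\<And>n. green_kato p (\<nu> n)" and \<nu>0: "green_kato p \<nu>0" and vague: "vague_convergence \<nu> \<nu>0"
    and w: "continuous_on UNIV w" "\<And>y. \<bar>w y\<bar> \<le> B"
    and x: "X \<longlonglongrightarrow> x" and one: "(\<lambda>n. GP (\<nu> n) (\<lambda>_. 1) (X n)) \<longlonglongrightarrow> GP \<nu>0 (\<lambda>_. 1) x"
  shows "(\<lambda>n. GP (\<nu> n) w (X n)) \<longlonglongrightarrow> GP \<nu>0 w x"
proof -
  have wm: "w \<in> borel_measurable borel" using w(1) by (rule borel_measurable_continuous_onI)
  have cm: "(\<lambda>_. B) \<in> borel_measurable borel" and cb: "\<bar>B\<bar> \<le> B"
    using order_trans[OF abs_ge_zero w(2)] by auto
  have const: "GP \<rho> (\<lambda>_. B) z = B * GP \<rho> (\<lambda>_. 1) z" if "green_kato p \<rho>" for \<rho> z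
    by (simp add: green_potential_def mult.commute)
  have plus: "GP \<rho> (\<lambda>y. B + c * w y) z = B * GP \<rho> (\<lambda>_. 1) z + c * GP \<rho> w z" if "green_kato p \<rho>" for \<rho> z c
    using potential_lin[OF that cm cb wm w(2), of c z] const[OF that] by simp
  have limB: "(\<lambda>n. B * GP (\<nu> n) (\<lambda>_. 1) (X n)) \<longlonglongrightarrow> B * GP \<nu>0 (\<lambda>_. 1) x"
    using one by (intro tendsto_mult tendsto_const)
  have wB: "0 \<le> B + 1 * w y" "B + 1 * w y \<le> 2 * B" "0 \<le> B + (- 1) * w y" "B + (- 1) * w y \<le> 2 * B" for y
    using w(2)[of y] by linarith+
  have cont: "continuous_on UNIV (\<lambda>y. B + c * w y)" for c
    using w(1) by (intro continuous_intros)
  note low = potential_liminf[OF \<nu> \<nu>0 vague cont _ _ x, where B="2 * B"]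
  show ?thesis
  proof (rule order_tendstoI)
    fix a assume a: "a < GP \<nu>0 w x"
    \<comment> \<open>Half of the gap is spent on the lower bound for \<open>B\<close> +
      \<open>w\<close>, the other half on the convergence of \<open>B\<close> times the potential of
      1.\<close>
    define e where "e = (GP \<nu>0 w x - a) / 2"
    have e: "e > 0" using a by (simp add: e_def)
    have "\<forall>\<^sub>F n in sequentially. B * GP \<nu>0 (\<lambda>_. 1) x + GP \<nu>0 w x - e < GP (\<nu> n) (\<lambda>y. B + 1 * w y) (X n)"
      by (rule low) (use wB e in \<open>simp_all add: plus[OF \<nu>0, of 1, simplified]\<close>)
    moreover have "\<forall>\<^sub>F n in sequentially. B * GP (\<nu> n) (\<lambda>_. 1) (X n) < B * GP \<nu>0 (\<lambda>_. 1) x + e"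
      using limB e by (intro order_tendstoD(2)) auto
    ultimately show "\<forall>\<^sub>F n in sequentially. a < GP (\<nu> n) w (X n)"
    proof eventually_elim
      case (elim n)
      then show ?case unfolding plus[OF \<nu>] e_def by (simp add: field_simps)
    qed
  next
    fix a assume a: "GP \<nu>0 w x < a"
    define e where "e = (a - GP \<nu>0 w x) / 2"
    have e: "e > 0" using a by (simp add: e_def)
    have "\<forall>\<^sub>F n in sequentially. B * GP \<nu>0 (\<lambda>_. 1) x - GP \<nu>0 w x - e < GP (\<nu> n) (\<lambda>y. B + (- 1) * w y) (X n)"
      by (rule low) (use wB e in \<open>simp_all add: plus[OF \<nu>0, of "-1", simplified]\<close>)
    moreover have "\<forall>\<^sub>F n in sequentially. B * GP (\<nu> n) (\<lambda>_. 1) (X n) < B * GP \<nu>0 (\<lambda>_. 1) x + e"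
      using limB e by (intro order_tendstoD(2)) auto
    ultimately show "\<forall>\<^sub>F n in sequentially. GP (\<nu> n) w (X n) < a"
    proof eventually_elim
      case (elim n)
      then show ?case unfolding plus[OF \<nu>] e_def by (simp add: field_simps)
    qed
  qed
qed

text \<open>The case of a constant sequence of measures; the required convergence for the function 1
  is the continuity contained in the Kato condition.\<close>

lemma potential_continuous:
  assumes \<nu>: "green_kato p \<nu>" and w: "continuous_on UNIV w" "\<And>y. \<bar>w y\<bar> \<le> B"
  shows "continuous_on UNIV (GP \<nu> w)"
proof -
  have "isCont (GP \<nu> w) x" for x
  proof (rule continuous_at_sequentiallyI)
    fix X assume X: "X \<longlonglongrightarrow> x"
    have "isCont (GP \<nu> (\<lambda>_. 1)) x"
      using potential_1_C0[OF \<nu>] by (simp add: C0_def continuous_on_eq_continuous_at)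
    then have "(\<lambda>n. GP \<nu> (\<lambda>_. 1) (X n)) \<longlonglongrightarrow> GP \<nu> (\<lambda>_. 1) x"
      using X by (rule isCont_tendsto_compose)
    then show "(\<lambda>n. GP \<nu> w (X n)) \<longlonglongrightarrow> GP \<nu> w x"
      by (intro potential_continuous_convergence[OF \<nu> \<nu> _ w X]) (simp_all add: vague_convergence_def)
  qed
  then show ?thesis by (simp add: continuous_at_imp_continuous_on)
qed

text \<open>If uniform convergence failed, there would be bad points for infinitely many n. They
  stay in a compact set, so a subsequence of them converges, contradicting
  \<open>potential_continuous_convergence\<close> and the continuity of the limit potential.\<close>

lemma potential_uniform_limit:
  assumes \<nu>: "\<And>n. green_kato p (\<nu> n)" and \<nu>0: "green_kato p \<nu>0" and vague: "vague_convergence \<nu> \<nu>0"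
    and one: "uniform_limit UNIV (\<lambda>n. GP (\<nu> n) (\<lambda>_. 1)) (GP \<nu>0 (\<lambda>_. 1)) sequentially"
    and w: "continuous_on UNIV w" "\<And>y. \<bar>w y\<bar> \<le> B"
  shows "uniform_limit UNIV (\<lambda>n. GP (\<nu> n) w) (GP \<nu>0 w) sequentially"
proof (rule ccontr)
  have wm: "w \<in> borel_measurable borel" using w(1) by (rule borel_measurable_continuous_onI)
  have B: "0 \<le> B" using order_trans[OF abs_ge_zero w(2)] .
  assume "\<not> ?thesis"
  then obtain e where e: "e > 0" "\<not> (\<forall>\<^sub>F n in sequentially. \<forall>x\<in>UNIV. dist (GP (\<nu> n) w x) (GP \<nu>0 w x) < e)"
    unfolding uniform_limit_iff by blast
  then have "\<exists>\<^sub>F n in sequentially. \<exists>x. e \<le> dist (GP (\<nu> n) w x) (GP \<nu>0 w x)"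
    by (simp add: frequently_def not_le)
  then have inf: "\<exists>n\<ge>N. \<exists>x. e \<le> dist (GP (\<nu> n) w x) (GP \<nu>0 w x)" for N
    by (auto simp: frequently_sequentially)
  \<comment> \<open>Off \<open>K\<close> the potentials of 1 are at most \<open>d\<close> in the
    limit and 2\<open>d\<close> for late n, so those of \<open>w\<close> differ by at most
    3\<open>B d\<close> < \<open>e\<close>; \<open>B\<close> + 1 keeps the denominator
    positive.\<close>
  define d where "d = e / (3 * (B + 1))"
  have d: "d > 0" using e(1) B by (simp add: d_def)
  obtain K where K: "compact K" "\<And>x. x \<notin> K \<Longrightarrow> \<bar>GP \<nu>0 (\<lambda>_. 1) x\<bar> < d"
    using potential_1_C0[OF \<nu>0] d unfolding C0_def by blast
  obtain N where N: "\<And>n x. n \<ge> N \<Longrightarrow> dist (GP (\<nu> n) (\<lambda>_. 1) x) (GP \<nu>0 (\<lambda>_. 1) x) < d"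
    using one d unfolding uniform_limit_iff eventually_sequentially by blast
  have in_K: "x \<in> K" if "n \<ge> N" "e \<le> dist (GP (\<nu> n) w x) (GP \<nu>0 w x)" for n x
  proof (rule ccontr)
    assume "x \<notin> K"
    then have d0: "GP \<nu>0 (\<lambda>_. 1) x \<le> d" using K(2)[of x] by linarith
    have d1: "GP (\<nu> n) (\<lambda>_. 1) x \<le> 2 * d" using N[OF that(1), of x] d0 by (simp add: dist_real_def)
    have "dist (GP (\<nu> n) w x) (GP \<nu>0 w x) \<le> \<bar>GP (\<nu> n) w x\<bar> + \<bar>GP \<nu>0 w x\<bar>"
      by (simp add: dist_real_def)
    also have "\<dots> \<le> B * GP (\<nu> n) (\<lambda>_. 1) x + B * GP \<nu>0 (\<lambda>_. 1) x"
      by (intro add_mono potential_bound[OF \<nu> wm w(2)] potential_bound[OF \<nu>0 wm w(2)])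
    also have "\<dots> \<le> B * (2 * d) + B * d"
      using B d0 d1 by (intro add_mono mult_left_mono)
    also have "\<dots> < 3 * (B + 1) * d" using d by (simp add: algebra_simps)
    also have "\<dots> = e" using B by (simp add: d_def)
    finally show False using that(2) by simp
  qed
  have "\<forall>N'. \<exists>n\<ge>N'. \<exists>x. e \<le> dist (GP (\<nu> n) w x) (GP \<nu>0 w x)" using inf by blast
  then have "infinite {n. \<exists>x. e \<le> dist (GP (\<nu> n) w x) (GP \<nu>0 w x)}"
    by (simp add: infinite_nat_iff_unbounded_le)
  \<comment> \<open>Indices below \<open>N\<close> are discarded so that \<open>in_K\<close>
    confines every chosen point to \<open>K\<close>.\<close>
  then have infin: "infinite ({n. \<exists>x. e \<le> dist (GP (\<nu> n) w x) (GP \<nu>0 w x)} - {..<N})"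
    by (rule Diff_infinite_finite[rotated]) simp
  then obtain r :: "nat \<Rightarrow> nat" where r: "strict_mono r" "\<And>j. r j \<in> {n. \<exists>x. e \<le> dist (GP (\<nu> n) w x) (GP \<nu>0 w x)} - {..<N}"
    using infinite_enumerate by blast
  then have "\<forall>j. \<exists>x. e \<le> dist (GP (\<nu> (r j)) w x) (GP \<nu>0 w x)" by blast
  from choice[OF this] obtain X where X: "\<And>j. e \<le> dist (GP (\<nu> (r j)) w (X j)) (GP \<nu>0 w (X j))" by blast
  have "X j \<in> K" for j using in_K[OF _ X] r(2)[of j] by simp
  then obtain x s where x: "x \<in> K" and s: "strict_mono (s :: nat \<Rightarrow> nat)" and lim: "(X \<circ> s) \<longlonglongrightarrow> x"
    using K(1) unfolding compact_eq_seq_compact_metric seq_compact_def by blast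
  let ?q = "\<lambda>j. r (s j)"
  have q: "filterlim ?q sequentially sequentially"
    using filterlim_subseq[OF strict_mono_o[OF r(1) s]] by (simp add: comp_def)
  have lim': "(\<lambda>j. X (s j)) \<longlonglongrightarrow> x" using lim by (simp add: comp_def)
  have vague_q: "vague_convergence (\<lambda>j. \<nu> (?q j)) \<nu>0"
    using vague unfolding vague_convergence_def by (auto intro: filterlim_compose[OF _ q])
  have c1: "(\<lambda>j. GP \<nu>0 h (X (s j))) \<longlonglongrightarrow> GP \<nu>0 h x" if "continuous_on UNIV h" "\<And>y. \<bar>h y\<bar> \<le> b" for h b
    using potential_continuous[OF \<nu>0 that] lim'
    by (intro isCont_tendsto_compose[of _ "GP \<nu>0 h"]) (simp_all add: continuous_on_eq_continuous_at)
  have "(\<lambda>j. GP (\<nu> (?q j)) (\<lambda>_. 1) (X (s j)) - GP \<nu>0 (\<lambda>_. 1) (X (s j))) \<longlonglongrightarrow> 0"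
  proof (rule tendstoI)
    fix \<epsilon> :: real assume "\<epsilon> > 0"
    then have "\<forall>\<^sub>F n in sequentially. \<forall>z. dist (GP (\<nu> n) (\<lambda>_. 1) z) (GP \<nu>0 (\<lambda>_. 1) z) < \<epsilon>"
      using one unfolding uniform_limit_iff by simp
    from eventually_compose_filterlim[OF this q]
    show "\<forall>\<^sub>F j in sequentially. dist (GP (\<nu> (?q j)) (\<lambda>_. 1) (X (s j)) - GP \<nu>0 (\<lambda>_. 1) (X (s j))) 0 < \<epsilon>"
      by (rule eventually_mono) (simp add: dist_real_def)
  qed
  from tendsto_add[OF this c1[of "\<lambda>_. 1" 1]]
  have "(\<lambda>j. GP (\<nu> (?q j)) (\<lambda>_. 1) (X (s j))) \<longlonglongrightarrow> GP \<nu>0 (\<lambda>_. 1) x" by simp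
  then have "(\<lambda>j. GP (\<nu> (?q j)) w (X (s j))) \<longlonglongrightarrow> GP \<nu>0 w x"
    by (intro potential_continuous_convergence[OF \<nu> \<nu>0 vague_q w lim'])
  from tendsto_dist[OF this c1[OF w]]
  have "(\<lambda>j. dist (GP (\<nu> (?q j)) w (X (s j))) (GP \<nu>0 w (X (s j)))) \<longlonglongrightarrow> 0" by simp
  then have "e \<le> 0"
    using X by (intro tendsto_lowerbound[of _ 0 sequentially]) (auto intro: always_eventually)
  with e(1) show False by simp
qed

end

section \<open>Convergence of the resolvents\<close>

text \<open>The estimate makes any solution map at the parameter \<beta> Lipschitz with constant
  \<open>C\<close>, so the equation at \<beta> + \<gamma> becomes a contraction problem for small
  \<gamma>. As \<open>C\<close> is the same for all \<beta>, the step size is fixed and finitely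
  many steps from the trivial case 0 reach \<alpha>.\<close>

lemma method_of_continuity:
  fixes T :: "'b::{real_normed_vector, complete_space} \<Rightarrow> 'b"
  assumes T: "bounded_linear T" and C: "0 < C"
    and est: "\<And>\<beta> w. 0 \<le> \<beta> \<Longrightarrow> norm w \<le> C * norm (w + \<beta> *\<^sub>R T w)"
    and \<alpha>: "0 \<le> \<alpha>"
  shows "\<exists>w. w + \<alpha> *\<^sub>R T w = f"
proof -
  interpret bounded_linear T by fact
  obtain K where K: "K > 0" "\<And>x. norm (T x) \<le> norm x * K" using pos_bounded by blast
  \<comment> \<open>For steps up to \<open>\<delta>\<close> the fixed-point map has Lipschitz
    constant at most \<open>C\<close> \<open>\<delta>\<close> \<open>K\<close> = 1/2.\<close>
  define \<delta> where "\<delta> = 1 / (2 * C * K)"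
  have \<delta>: "\<delta> > 0" using C K(1) by (simp add: \<delta>_def)
  have step: "\<exists>w. w + (\<beta> + \<gamma>) *\<^sub>R T w = f"
    if surj: "\<And>g. \<exists>w. w + \<beta> *\<^sub>R T w = g" and \<beta>: "0 \<le> \<beta>" and \<gamma>: "0 \<le> \<gamma>" "\<gamma> \<le> \<delta>" for \<beta> \<gamma> f
  proof -
    obtain S where S: "\<And>g. S g + \<beta> *\<^sub>R T (S g) = g" using surj by metis
    let ?H = "\<lambda>w. S (f - \<gamma> *\<^sub>R T w)"
    have lip: "dist (?H w) (?H w') \<le> (1 / 2) * dist w w'" for w w'
    proof -
      let ?a = "?H w - ?H w'"
      have "?a + \<beta> *\<^sub>R T ?a = (?H w + \<beta> *\<^sub>R T (?H w)) - (?H w' + \<beta> *\<^sub>R T (?H w'))"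
        by (simp add: diff scaleR_diff_right)
      also have "\<dots> = - (\<gamma> *\<^sub>R T (w - w'))"
        unfolding S by (simp add: diff scaleR_diff_right)
      finally have "norm ?a \<le> C * (\<gamma> * norm (T (w - w')))"
        using est[OF \<beta>, of ?a] \<gamma>(1) by simp
      also have "\<dots> \<le> C * (\<delta> * (norm (w - w') * K))"
        using C \<gamma> K \<delta> by (intro mult_left_mono mult_mono) auto
      also have "\<dots> = (1 / 2) * norm (w - w')"
        using C K(1) by (simp add: \<delta>_def)
      finally show ?thesis by (simp add: dist_norm)
    qed
    have "\<exists>!w. ?H w = w"
      by (rule banach_fix_type[of "1 / 2"]) (use lip in auto)
    then obtain w where "?H w = w" by blast
    then have "w + \<beta> *\<^sub>R T w = f - \<gamma> *\<^sub>R T w" using S[of "f - \<gamma> *\<^sub>R T w"] by simp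
    then have "w + (\<beta> + \<gamma>) *\<^sub>R T w = f" by (simp add: scaleR_add_left algebra_simps)
    then show ?thesis by blast
  qed
  obtain n :: nat where n: "\<alpha> / \<delta> \<le> real n" using real_arch_simple by blast
  \<comment> \<open>Dividing by \<open>Suc n\<close> keeps the denominator nonzero when \<alpha> = 0
    allows n = 0.\<close>
  define \<gamma> where "\<gamma> = \<alpha> / real (Suc n)"
  have \<gamma>: "0 \<le> \<gamma>" "\<gamma> \<le> \<delta>"
  proof -
    show "0 \<le> \<gamma>" using \<alpha> by (simp add: \<gamma>_def)
    have "\<alpha> \<le> real n * \<delta>" using n \<delta> by (simp add: pos_divide_le_eq)
    also have "\<dots> \<le> \<delta> * real (Suc n)" using \<delta> by (simp add: algebra_simps)
    finally show "\<gamma> \<le> \<delta>" by (simp add: \<gamma>_def divide_le_eq)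
  qed
  have "\<exists>w. w + (real k * \<gamma>) *\<^sub>R T w = g" for k g
  proof (induction k arbitrary: g)
    case (Suc k)
    have "\<exists>w. w + (real k * \<gamma> + \<gamma>) *\<^sub>R T w = g"
      using Suc \<gamma> by (intro step) auto
    then show ?case by (simp add: algebra_simps)
  qed simp
  from this[of "Suc n" f] show ?thesis
    by (simp only: \<gamma>_def) simp
qed

lemma C0_bounded:
  fixes u :: "'a::metric_space \<Rightarrow> real"
  assumes "u \<in> C0"
  obtains B where "\<And>x. \<bar>u x\<bar> \<le> B"
proof -
  obtain K where K: "compact K" "\<And>x. x \<notin> K \<Longrightarrow> \<bar>u x\<bar> < 1"
    using assms unfolding C0_def by (auto dest: spec[of _ "1::real"])
  have "continuous_on K u" using assms unfolding C0_def by (auto intro: continuous_on_subset)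
  then have "bounded (u ` K)" using K(1) by (intro compact_imp_bounded compact_continuous_image)
  then obtain b where b: "\<And>x. x \<in> K \<Longrightarrow> \<bar>u x\<bar> \<le> b" by (auto simp: bounded_iff)
  have "\<bar>u x\<bar> \<le> max 1 b" for x
    using K(2)[of x] b[of x] by (cases "x \<in> K") auto
  then show thesis by (rule that)
qed

lemma supnorm_tendsto_0:
  assumes "uniform_limit UNIV f l sequentially"
  shows "(\<lambda>n. supnorm (\<lambda>x. f n x - l x)) \<longlonglongrightarrow> 0"
proof (rule order_tendstoI)
  fix a :: ennreal assume "0 < a"
  \<comment> \<open>The target \<open>a\<close> may be infinite, and a supremum of values below a
    bound need not stay strictly below it; a smaller finite \<open>b\<close> settles both.\<close>
  then obtain b where b: "0 < b" "b < a" using dense by blast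
  then obtain e where e: "b = ennreal e" "0 \<le> e" by (cases b) (auto simp: top.extremum_strict)
  have "0 < e" using b(1) e by (simp add: ennreal_less_zero_iff)
  then have "\<forall>\<^sub>F n in sequentially. \<forall>x. dist (f n x) (l x) < e"
    using assms unfolding uniform_limit_iff by simp
  then show "\<forall>\<^sub>F n in sequentially. supnorm (\<lambda>x. f n x - l x) < a"
  proof (rule eventually_mono)
    fix n assume "\<forall>x. dist (f n x) (l x) < e"
    then have "supnorm (\<lambda>x. f n x - l x) \<le> b"
      unfolding supnorm_def e(1) by (intro SUP_least ennreal_leI) (simp add: dist_real_def less_imp_le)
    then show "supnorm (\<lambda>x. f n x - l x) < a" using b(2) by (rule le_less_trans)
  qed
qed simp

lemma pos_neg_parts:
  fixes w :: "'a::topological_space \<Rightarrow> real"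
  assumes "continuous_on UNIV w" "\<And>x. \<bar>w x\<bar> \<le> B"
  shows "continuous_on UNIV (\<lambda>x. max 0 (w x))" "\<bar>max 0 (w x)\<bar> \<le> B" "max 0 (w x) \<le> B"
    "continuous_on UNIV (\<lambda>x. max 0 (- w x))" "\<bar>max 0 (- w x)\<bar> \<le> B" "max 0 (- w x) \<le> B"
    "max 0 (w x) + (- 1) * max 0 (- w x) = w x"
proof -
  show "continuous_on UNIV (\<lambda>x. max 0 (w x))" "continuous_on UNIV (\<lambda>x. max 0 (- w x))"
    using assms(1) by (auto intro!: continuous_intros)
qed (use assms(2)[of x] in auto)

locale kato_time_change = additive_functional Z A p \<mu> + green_kernel p
  for Z :: "('w, 'a::{metric_space, second_countable_topology}) process" and A p \<mu>
begin

lemma GP_bounded: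
  assumes "continuous_on UNIV w" "\<And>x. \<bar>w x\<bar> \<le> B"
  obtains B' where "\<And>x. \<bar>GP \<mu> w x\<bar> \<le> B'"
proof -
  obtain b where b: "\<And>x. \<bar>GP \<mu> (\<lambda>_. 1) x\<bar> \<le> b"
    using C0_bounded[OF potential_1_C0[OF kato]] by blast
  have B: "0 \<le> B" using order_trans[OF abs_ge_zero assms(2)] .
  have "\<bar>GP \<mu> w x\<bar> \<le> B * b" for x
    using potential_bound[OF kato borel_measurable_continuous_onI[OF assms(1)] assms(2), of x]
      mult_left_mono[OF order_trans[OF abs_ge_self b] B, of x] by linarith
  then show thesis by (rule that)
qed

text \<open>Without discounting, the resolvent is the expected total integral against dA, that is,
  the Green potential. The case \<alpha> = 0 thus reduces to the convergence of potentials.\<close>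

lemma TCR_0_nonneg:
  assumes "continuous_on UNIV u" "\<And>x. 0 \<le> u x" "\<And>x. u x \<le> B"
  shows "TCR 0 u x = GP \<mu> u x"
proof -
  have "ennreal (TCR 0 u x) = resolvent 0 u x"
    by (rule TCR_nonneg(2)[OF assms]) simp
  also have "\<dots> = (\<integral>\<^sup>+\<omega>. tail u 0 \<omega> \<partial>law Z (Some x))"
    unfolding resolvent_def
    by (rule nn_integral_cong_AE, rule eventually_mono[OF AE_good]) (rule path_resolvent_0[OF assms])
  also have "\<dots> = ennreal (GP \<mu> u x)"
    unfolding nn_integral_tail[OF assms]
    by (rule potential_nonneg(2)[OF kato borel_measurable_continuous_onI[OF assms(1)] assms(2,3)])
  finally show ?thesis
    using TCR_nonneg(1)[OF assms order_refl, of x] potential_nonneg(1)[OF kato borel_measurable_continuous_onI[OF assms(1)] assms(2,3), of x]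
    by simp
qed

lemma TCR_0:
  assumes w: "continuous_on UNIV w" "\<And>x. \<bar>w x\<bar> \<le> B"
  shows "TCR 0 w x = GP \<mu> w x"
proof -
  note pn = pos_neg_parts[OF w]
  have "TCR 0 (\<lambda>x. max 0 (w x) + (- 1) * max 0 (- w x)) x
      = GP \<mu> (\<lambda>x. max 0 (w x) + (- 1) * max 0 (- w x)) x"
    unfolding TCR_lin[OF pn(1,2,4,5) order_refl]
      potential_lin[OF kato borel_measurable_continuous_onI[OF pn(1)] pn(2) borel_measurable_continuous_onI[OF pn(4)] pn(5)]
    using TCR_0_nonneg[OF pn(1) _ pn(3)] TCR_0_nonneg[OF pn(4) _ pn(6)] by simp
  then show ?thesis unfolding pn(7) .
qed

text \<open>The real form of \<open>resolvent_identity\<close>. The potential becomes an argument of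
  the resolvent here, which is why its continuity and boundedness have to be established
  first.\<close>

lemma TCR_identity_nonneg:
  assumes \<alpha>: "0 < \<alpha>" and u: "continuous_on UNIV u" "\<And>x. 0 \<le> u x" "\<And>x. u x \<le> B"
  shows "TCR \<alpha> u x + \<alpha> * TCR \<alpha> (GP \<mu> u) x = GP \<mu> u x"
proof -
  have \<alpha>': "0 \<le> \<alpha>" using \<alpha> by simp
  have b: "\<bar>u x\<bar> \<le> B" for x using u(2,3) by simp
  have eq: "(\<integral>\<^sup>+y. green p 0 x y * ennreal (u y) \<partial>\<mu>) = ennreal (GP \<mu> u x)" for x
    by (rule potential_nonneg(2)[OF kato borel_measurable_continuous_onI[OF u(1)] u(2,3)])
  have nonneg: "0 \<le> GP \<mu> u x" for x
    by (rule potential_nonneg(1)[OF kato borel_measurable_continuous_onI[OF u(1)] u(2,3)])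
  obtain B' where "\<And>x. \<bar>GP \<mu> u x\<bar> \<le> B'" using GP_bounded[OF u(1) b] by blast
  then have B': "GP \<mu> u x \<le> B'" for x using order_trans[OF abs_ge_self] by blast
  have cont: "continuous_on UNIV (GP \<mu> u)" by (rule potential_continuous[OF kato u(1) b])
  note T = TCR_nonneg[OF cont nonneg B' \<alpha>'] TCR_nonneg[OF u \<alpha>']
  have "ennreal \<alpha> * ennreal (TCR \<alpha> (GP \<mu> u) x) + ennreal (TCR \<alpha> u x) = ennreal (GP \<mu> u x)"
    unfolding T(2,4) by (rule resolvent_identity[OF \<alpha> u cont nonneg B' eq])
  then have "ennreal (\<alpha> * TCR \<alpha> (GP \<mu> u) x + TCR \<alpha> u x) = ennreal (GP \<mu> u x)"
    using \<alpha>' T(1,3) by (simp add: ennreal_mult)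
  then have "\<alpha> * TCR \<alpha> (GP \<mu> u) x + TCR \<alpha> u x = GP \<mu> u x"
    using \<alpha>' T(1,3)[of x] nonneg[of x] by (subst (asm) ennreal_inj) auto
  then show ?thesis by simp
qed

lemma TCR_identity:
  assumes \<alpha>: "0 < \<alpha>" and w: "continuous_on UNIV w" "\<And>x. \<bar>w x\<bar> \<le> B"
  shows "TCR \<alpha> (\<lambda>x. w x + \<alpha> * GP \<mu> w x) x = GP \<mu> w x"
proof -
  have \<alpha>': "0 \<le> \<alpha>" using \<alpha> by simp
  note pn = pos_neg_parts[OF w]
  let ?u = "\<lambda>x. max 0 (w x)" and ?v = "\<lambda>x. max 0 (- w x)"
  obtain Bu Bv where Bu: "\<And>x. \<bar>GP \<mu> ?u x\<bar> \<le> Bu" and Bv: "\<And>x. \<bar>GP \<mu> ?v x\<bar> \<le> Bv"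
    using GP_bounded[OF pn(1,2)] GP_bounded[OF pn(4,5)] by metis
  have cu: "continuous_on UNIV (GP \<mu> ?u)" and cv: "continuous_on UNIV (GP \<mu> ?v)"
    using potential_continuous[OF kato pn(1,2)] potential_continuous[OF kato pn(4,5)] by auto
  obtain Bw where Bw: "\<And>x. \<bar>GP \<mu> w x\<bar> \<le> Bw" using GP_bounded[OF w] by blast
  have cw: "continuous_on UNIV (GP \<mu> w)" by (rule potential_continuous[OF kato w])
  have GPw: "GP \<mu> w x = GP \<mu> ?u x + (- 1) * GP \<mu> ?v x" for x
    using potential_lin[OF kato borel_measurable_continuous_onI[OF pn(1)] pn(2)
        borel_measurable_continuous_onI[OF pn(4)] pn(5), of "- 1" x] unfolding pn(7) .
  have Tw: "TCR \<alpha> w x = TCR \<alpha> ?u x + (- 1) * TCR \<alpha> ?v x"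
    using TCR_lin[OF pn(1,2,4,5) \<alpha>', of "- 1" x] unfolding pn(7) .
  have TG: "TCR \<alpha> (GP \<mu> w) x = TCR \<alpha> (GP \<mu> ?u) x + (- 1) * TCR \<alpha> (GP \<mu> ?v) x"
    using TCR_lin[OF cu Bu cv Bv \<alpha>', of "- 1" x] unfolding GPw[symmetric] .
  have "TCR \<alpha> (\<lambda>x. w x + \<alpha> * GP \<mu> w x) x = TCR \<alpha> w x + \<alpha> * TCR \<alpha> (GP \<mu> w) x"
    by (rule TCR_lin[OF w cw Bw \<alpha>'])
  also have "\<dots> = (TCR \<alpha> ?u x + \<alpha> * TCR \<alpha> (GP \<mu> ?u) x) - (TCR \<alpha> ?v x + \<alpha> * TCR \<alpha> (GP \<mu> ?v) x)"
    unfolding Tw TG by (simp add: algebra_simps)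
  also have "\<dots> = GP \<mu> w x"
    unfolding GPw using TCR_identity_nonneg[OF \<alpha> pn(1) _ pn(3), of x] TCR_identity_nonneg[OF \<alpha> pn(4) _ pn(6), of x]
    by simp
  finally show ?thesis .
qed

text \<open>The method of continuity in the Banach space of bounded continuous functions. The
  potential acts there as a bounded operator because G^mu 1 is bounded and potentials of bounded
  continuous functions are continuous.\<close>

lemma solve_resolvent_equation:
  assumes \<alpha>: "0 < \<alpha>" and u: "continuous_on UNIV u" "\<And>x. \<bar>u x\<bar> \<le> B"
  obtains w B' where "continuous_on UNIV w" "\<And>x. \<bar>w x\<bar> \<le> B'" "\<And>x. w x + \<alpha> * GP \<mu> w x = u x"
proof -
  have ap: "continuous_on UNIV (apply_bcontfun g)" "\<bar>apply_bcontfun g x\<bar> \<le> norm g" for g :: "'a \<Rightarrow>\<^sub>C real" and x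
    using norm_bounded[of g x] by auto
  have apm: "apply_bcontfun g \<in> borel_measurable borel" for g :: "'a \<Rightarrow>\<^sub>C real"
    by (rule borel_measurable_continuous_onI[OF ap(1)])
  define T where "T g = Bcontfun (GP \<mu> (apply_bcontfun g))" for g :: "'a \<Rightarrow>\<^sub>C real"
  have T: "apply_bcontfun (T g) x = GP \<mu> (apply_bcontfun g) x" for g x
  proof -
    obtain b where b: "\<And>x. \<bar>GP \<mu> (apply_bcontfun g) x\<bar> \<le> b" using GP_bounded[OF ap] by blast
    have "GP \<mu> (apply_bcontfun g) \<in> bcontfun"
      using potential_continuous[OF kato ap] b by (intro bcontfun_normI) auto
    then show ?thesis by (simp add: T_def Bcontfun_inverse)
  qed
  obtain b where b: "\<And>x. \<bar>GP \<mu> (\<lambda>_. 1) x\<bar> \<le> b"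
    using C0_bounded[OF potential_1_C0[OF kato]] by blast
  have "bounded_linear T"
  proof (rule bounded_linear_intro)
    show "T (g + h) = T g + T h" for g h
      using potential_lin[OF kato apm[of g] ap(2)[of g] apm[of h] ap(2)[of h], of 1]
      by (intro bcontfun_eqI) (simp add: T plus_bcontfun.rep_eq)
    show "T (r *\<^sub>R g) = r *\<^sub>R T g" for r g
      by (intro bcontfun_eqI) (simp add: T scaleR_bcontfun.rep_eq green_potential_def mult.left_commute[of _ r])
    show "norm (T g) \<le> norm g * b" for g
    proof (rule norm_bound)
      fix x
      show "norm (apply_bcontfun (T g) x) \<le> norm g * b"
        unfolding T using potential_bound[OF kato apm ap(2), of g x]
          mult_left_mono[OF order_trans[OF abs_ge_self b], of "norm g" x] by simp
    qed
  qed
  \<comment> \<open>The constant 2 counts two terms: \<open>g\<close> is \<open>?f\<close> minus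
    \<beta> times its resolvent, and \<open>TCR_bound\<close> controls the second term by the norm
    of \<open>?f\<close>.\<close>
  moreover have "norm g \<le> 2 * norm (g + \<beta> *\<^sub>R T g)" if "0 \<le> \<beta>" for \<beta> g
  proof (cases "\<beta> = 0")
    case False
    then have \<beta>: "0 < \<beta>" using that by simp
    let ?f = "g + \<beta> *\<^sub>R T g"
    have f: "apply_bcontfun ?f x = apply_bcontfun g x + \<beta> * GP \<mu> (apply_bcontfun g) x" for x
      by (simp add: plus_bcontfun.rep_eq scaleR_bcontfun.rep_eq T)
    show ?thesis
    proof (rule norm_bound)
      fix x
      have "TCR \<beta> (apply_bcontfun ?f) x = GP \<mu> (apply_bcontfun g) x"
        using TCR_identity[OF \<beta> ap, of g x] unfolding f[symmetric] .
      then have "\<bar>\<beta> * GP \<mu> (apply_bcontfun g) x\<bar> \<le> norm ?f"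
        using TCR_bound[OF ap \<beta>, of ?f x] \<beta> by (simp add: abs_mult)
      then show "norm (apply_bcontfun g x) \<le> 2 * norm ?f"
        using ap(2)[of ?f x] unfolding f real_norm_def by linarith
    qed
  qed simp
  ultimately obtain g where g: "g + \<alpha> *\<^sub>R T g = Bcontfun u"
    using method_of_continuity[of T 2 \<alpha> "Bcontfun u"] \<alpha> by auto
  have "u \<in> bcontfun" using u by (intro bcontfun_normI) auto
  then have "apply_bcontfun g x + \<alpha> * GP \<mu> (apply_bcontfun g) x = u x" for x
    using arg_cong[OF g, of "\<lambda>h. apply_bcontfun h x"]
    by (simp add: plus_bcontfun.rep_eq scaleR_bcontfun.rep_eq T Bcontfun_inverse)
  then show thesis using ap[of g] that by blast
qed

end

theorem theorem3p1:
  fixes m :: "'a::{metric_space, second_countable_topology} measure"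
    and Z :: "('w, 'a) process"
    and Z' :: "('v, 'a) process"
    and p :: "real \<Rightarrow> 'a \<Rightarrow> 'a \<Rightarrow> real"
    and \<mu> :: "enat \<Rightarrow> 'a measure"
    and A :: "enat \<Rightarrow> ennreal \<Rightarrow> 'w \<Rightarrow> ennreal"
  assumes "locally_compact_space (euclidean :: 'a topology)"
    and "radon_measure m" and "full_support m"
    and "standard_process Z" and "transient Z"
    and "standard_process Z'" and "transient Z'"
    and "in_duality m Z Z'"
    and "transition_density m Z p"
    and "\<And>t x y. t > 0 \<Longrightarrow> p t x y > 0"
    and "\<exists>x y. green p 0 x y \<noteq> \<infinity>"
    and "lower_semicontinuous (\<lambda>(x, y). green p 0 x y)"
    and "\<And>n. green_kato p (\<mu> n)"
    and "\<And>n. pcaf Z (A n)"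
    and "\<And>n. revuz_measure m Z (A n) (\<mu> n)"
    and "\<And>n. potential_formula p Z (A n) (\<mu> n)"
    and "vague_convergence (\<lambda>n. \<mu> (enat n)) (\<mu> \<infinity>)"
    and "uniform_limit UNIV (\<lambda>n. green_potential p (\<mu> (enat n)) (\<lambda>_. 1))
           (green_potential p (\<mu> \<infinity>) (\<lambda>_. 1)) sequentially"
  shows "\<forall>u\<in>C0.
      (\<lambda>n. supnorm (\<lambda>x. green_potential p (\<mu> (enat n)) u x - green_potential p (\<mu> \<infinity>) u x))
         \<longlonglongrightarrow> 0
    \<and> (\<forall>\<alpha>\<ge>0. (\<lambda>n. supnorm (\<lambda>x. time_changed_resolvent Z (A (enat n)) \<alpha> u x
                                   - time_changed_resolvent Z (A \<infinity>) \<alpha> u x)) \<longlonglongrightarrow> 0)"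
proof (intro ballI conjI allI impI)
  fix u :: "'a \<Rightarrow> real" assume u: "u \<in> C0"
  then have u_cont: "continuous_on UNIV u" by (simp add: C0_def)
  obtain B where B: "\<And>x. \<bar>u x\<bar> \<le> B" using C0_bounded[OF u] by blast
  have G: "green_kernel p"
    using assms(1,12) by (rule green_kernel.intro)
  have K: "kato_time_change Z (A n) p (\<mu> n)" for n
    using assms(4,13,14,16) G by (intro kato_time_change.intro additive_functional.intro additive_functional_axioms.intro)
  note lim = green_kernel.potential_uniform_limit[OF G assms(13,13,17,18)]
  show "(\<lambda>n. supnorm (\<lambda>x. green_potential p (\<mu> (enat n)) u x - green_potential p (\<mu> \<infinity>) u x)) \<longlonglongrightarrow> 0"
    by (rule supnorm_tendsto_0[OF lim[OF u_cont B]])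
  fix \<alpha> :: real assume \<alpha>: "0 \<le> \<alpha>"
  let ?T = "\<lambda>n. time_changed_resolvent Z (A n) \<alpha>" and ?G = "\<lambda>n. green_potential p (\<mu> n)"
  have "uniform_limit UNIV (\<lambda>n. ?T (enat n) u) (?T \<infinity> u) sequentially"
  proof (cases "\<alpha> = 0")
    case True
    have "?T n u = ?G n u" for n
      unfolding True by (intro ext kato_time_change.TCR_0[OF K u_cont B])
    then show ?thesis using lim[OF u_cont B] by simp
  next
    case False
    with \<alpha> have \<alpha>: "0 < \<alpha>" by simp
    \<comment> \<open>The equation is solved for the limit measure only, so \<open>w\<close> does
      not vary with n and the convergence of potentials applies to it.\<close>
    obtain w b where w: "continuous_on UNIV w" "\<And>x. \<bar>w x\<bar> \<le> b"
      and eq: "\<And>x. w x + \<alpha> * ?G \<infinity> w x = u x"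
      using kato_time_change.solve_resolvent_equation[OF K \<alpha> u_cont B] by metis
    show ?thesis
    proof (rule uniform_limitI)
      \<comment> \<open>The difference of the resolvents has two terms, each controlled by the
        uniform distance of the potentials of \<open>w\<close>; each receives half of
        \<open>e\<close>.\<close>
      fix e :: real assume e: "0 < e"
      have "\<forall>\<^sub>F n in sequentially. \<forall>x\<in>UNIV. dist (?G (enat n) w x) (?G \<infinity> w x) < e / 2"
        using lim[OF w] e by (intro uniform_limitD) auto
      then show "\<forall>\<^sub>F n in sequentially. \<forall>x\<in>UNIV. dist (?T (enat n) u x) (?T \<infinity> u x) < e"
      proof (rule eventually_mono, intro ballI)
        fix n x assume n: "\<forall>x\<in>UNIV. dist (?G (enat n) w x) (?G \<infinity> w x) < e / 2"
        interpret N: kato_time_change Z "A (enat n)" p "\<mu> (enat n)" by (rule K)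
        interpret I: kato_time_change Z "A \<infinity>" p "\<mu> \<infinity>" by (rule K)
        \<comment> \<open>With these, \<open>u\<close> = \<open>?f\<close> + \<alpha>
          \<open>?d\<close>, where \<open>?f\<close> has a known resolvent for the n-th measure and
          \<open>?d\<close> is uniformly small.\<close>
        let ?d = "\<lambda>x. ?G \<infinity> w x - ?G (enat n) w x" and ?f = "\<lambda>x. w x + \<alpha> * ?G (enat n) w x"
        have d_cont: "continuous_on UNIV ?d"
          by (intro continuous_intros N.potential_continuous[OF assms(13) w])
        have d_less: "\<bar>?d x\<bar> < e / 2" for x
          using bspec[OF n UNIV_I, of x] unfolding dist_real_def by linarith
        then have d_le: "\<bar>?d x\<bar> \<le> e / 2" for x by (rule less_imp_le)
        obtain b' where "\<And>x. \<bar>?G (enat n) w x\<bar> \<le> b'" using N.GP_bounded[OF w] by blast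
        then have f_le: "\<bar>?f x\<bar> \<le> b + \<alpha> * b'" for x
          using w(2) \<alpha> by (intro order_trans[OF abs_triangle_ineq] add_mono) (auto simp: abs_mult)
        have f_cont: "continuous_on UNIV ?f"
          by (intro continuous_intros w(1) N.potential_continuous[OF assms(13) w])
        have "u = (\<lambda>x. ?f x + \<alpha> * ?d x)"
          by (rule ext) (simp add: eq[symmetric] algebra_simps)
        then have "?T (enat n) u x = ?T (enat n) ?f x + \<alpha> * ?T (enat n) ?d x"
          using N.TCR_lin[OF f_cont f_le d_cont d_le less_imp_le[OF \<alpha>], of \<alpha> x] by simp
        also have "?T (enat n) ?f x = ?G (enat n) w x"
          by (rule N.TCR_identity[OF \<alpha> w])
        finally have Tn: "?T (enat n) u x = ?G (enat n) w x + \<alpha> * ?T (enat n) ?d x" .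
        have "(\<lambda>x. w x + \<alpha> * ?G \<infinity> w x) = u" by (rule ext) (rule eq)
        then have Ti: "?T \<infinity> u x = ?G \<infinity> w x"
          using I.TCR_identity[OF \<alpha> w, of x] by simp
        have "dist (?T (enat n) u x) (?T \<infinity> u x) \<le> \<bar>?d x\<bar> + \<alpha> * \<bar>?T (enat n) ?d x\<bar>"
          unfolding Tn Ti dist_real_def using \<alpha> abs_mult[of \<alpha> "?T (enat n) ?d x"] by linarith
        also have "\<dots> < e / 2 + e / 2"
          by (rule add_less_le_mono[OF d_less N.TCR_bound[OF d_cont d_le \<alpha>]])
        finally show "dist (?T (enat n) u x) (?T \<infinity> u x) < e" by simp
      qed
    qed
  qed
  then show "(\<lambda>n. supnorm (\<lambda>x. ?T (enat n) u x - ?T \<infinity> u x)) \<longlonglongrightarrow> 0"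
    by (rule supnorm_tendsto_0)
qed

end
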